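(* Let $a_f(n)$ be the coefficients of $f(q)=\sum_{n\ge0}a_f(n)q^n=1+\sum_{n\ge1}\frac{q^{n^2}}{(1+q)^2(1+q^2)^2\cdots(1+q^n)^2}$, with the convention $a_f(x)=0$ if $x$ is not a nonnegative integer. Then, with $J_k=\prod_{m\ge1}(1-q^{km})$, $$\sum_{n=0}^\infty\big(a_f(5n-1)+a_f(n/5)\big)q^n=\frac{J_2^4J_{10}^2}{J_1J_4^3J_{20}}-4q\frac{J_1^2J_4^3J_5J_{20}}{J_2^5J_{10}}.$$ *)

theory Defs
  imports "HOL-Analysis.Analysis"
begin

text \<open>
  All series are formal power series in \<open>q\<close> (written \<^const>\<open>fps_X\<close>) over the rationals; infinite
  sums and products are limits in the usual \<open>q\<close>-adic topology on \<^typ>\<open>rat fps\<close>. Every denominator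
  below has constant coefficient 1, so \<open>/\<close> is division by a unit.
\<close>

definition mock_f_term :: "nat \<Rightarrow> rat fps" where
  "mock_f_term n = fps_X ^ (n ^ 2) / (\<Prod>j=1..n. (1 + fps_X ^ j) ^ 2)"

definition mock_f :: "rat fps" where
  "mock_f = 1 + (\<Sum>n. mock_f_term (Suc n))"

text \<open>The argument is rational so that \<open>a_f (n / 5)\<close> and \<open>a_f (-1)\<close> make sense.\<close>

definition a_f :: "rat \<Rightarrow> rat" where
  "a_f x = (if x \<in> \<nat> then fps_nth mock_f (nat \<lfloor>x\<rfloor>) else 0)"

lemma a_f_of_nat: "a_f (of_nat n) = fps_nth mock_f n"
  by (simp add: a_f_def)

text \<open>Only meaningful for \<open>k \<ge> 1\<close>; the constant coefficient is then 1.\<close>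

definition J :: "nat \<Rightarrow> rat fps" where
  "J k = (\<Prod>m. 1 - fps_X ^ (k * Suc m))"

text \<open>The library's \<^const>\<open>suminf\<close> and \<^const>\<open>prodinf\<close> are unspecified in the divergent case; the
  following facts show that this case does not occur.\<close>

lemma fps_prod_nth_0: "fps_nth (prod f A) 0 = (\<Prod>x\<in>A. fps_nth (f x :: rat fps) 0)"
  by (induction A rule: infinite_finite_induct) auto

lemma fps_partial_limit:
  fixes P :: "nat \<Rightarrow> rat fps"
  assumes "\<And>n N. N \<le> n \<Longrightarrow> fps_nth (P (Suc n)) N = fps_nth (P n) N"
  shows "P \<longlonglongrightarrow> Abs_fps (\<lambda>n. fps_nth (P n) n)"
proof (rule tendsto_fpsI)
  fix N
  have "fps_nth (P n) N = fps_nth (P N) N" if "n \<ge> N" for n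
    using that by (induction n rule: dec_induct) (simp_all add: assms)
  then show "\<forall>\<^sub>F n in sequentially. fps_nth (P n) N = fps_nth (Abs_fps (\<lambda>n. fps_nth (P n) n)) N"
    unfolding eventually_sequentially fps_nth_Abs_fps by blast
qed

lemma summable_mock_f: "summable (\<lambda>n. mock_f_term (Suc n))"
proof -
  have *: "fps_nth (mock_f_term (Suc n)) N = 0" if "N \<le> n" for n N
  proof -
    have c: "fps_nth (\<Prod>j=1..Suc n. (1 + fps_X ^ j) ^ 2 :: rat fps) 0 = 1"
      unfolding fps_prod_nth_0 by (intro prod.neutral) (auto simp: fps_power_zeroth zero_power)
    have "mock_f_term (Suc n) = fps_X ^ (Suc n ^ 2) * inverse (\<Prod>j=1..Suc n. (1 + fps_X ^ j) ^ 2)"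
      unfolding mock_f_term_def using c by (intro fps_divide_unit) simp
    moreover have "N < Suc n ^ 2"
      using that self_le_power[of "Suc n" 2] by simp
    ultimately show ?thesis
      by (simp add: fps_X_power_mult_nth)
  qed
  have "(\<lambda>n. \<Sum>i<n. mock_f_term (Suc i)) \<longlonglongrightarrow>
          Abs_fps (\<lambda>n. fps_nth (\<Sum>i<n. mock_f_term (Suc i)) n)"
    by (rule fps_partial_limit) (simp add: *)
  then show ?thesis
    unfolding summable_def sums_def by blast
qed

lemma has_prod_J:
  assumes "k \<ge> 1"
  shows "(\<lambda>m. 1 - fps_X ^ (k * Suc m)) has_prod J k"
proof -
  let ?P = "\<lambda>n. \<Prod>i\<le>n. 1 - fps_X ^ (k * Suc i) :: rat fps"
  let ?L = "Abs_fps (\<lambda>n. fps_nth (?P n) n)"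
  have "?P \<longlonglongrightarrow> ?L"
  proof (rule fps_partial_limit)
    fix n N :: nat
    assume "N \<le> n"
    moreover have "n < k * Suc (Suc n)"
      using assms by (cases k) auto
    ultimately have "N < k * Suc (Suc n)"
      by simp
    then have "fps_nth (?P n * (1 - fps_X ^ (k * Suc (Suc n)))) N = fps_nth (?P n) N"
      unfolding right_diff_distrib fps_sub_nth by (subst fps_X_power_mult_right_nth) simp
    then show "fps_nth (?P (Suc n)) N = fps_nth (?P n) N"
      by (simp only: prod.atMost_Suc)
  qed
  moreover have "fps_nth ?L 0 = 1"
    using assms by (simp add: fps_prod_nth_0 fps_power_zeroth)
  then have "?L \<noteq> 0"
    by (auto simp only: fps_zero_nth)
  ultimately have L: "(\<lambda>m. 1 - fps_X ^ (k * Suc m) :: rat fps) has_prod ?L"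
    unfolding has_prod_def raw_has_prod_def add_0_right by (intro disjI1 conjI)
  then have "?L = J k"
    unfolding J_def by (rule has_prod_unique)
  with L show ?thesis
    by (rule back_subst)
qed

end

theory Submission
  imports Defs "HOL-Computational_Algebra.Formal_Laurent_Series"
begin

text \<open>
  Lagrange interpolation at the nodes \<open>q\<^sup>k\<close>, \<open>k \<in> A\<close>, evaluated at \<open>-1\<close>, gives one identity for every
  set \<open>A\<close> of integers, infinite ones included. The symmetric interval \<open>A = {-n..n}\<close> yields a Bailey pair, hence
  Watson's expression of \<open>f(q) J\<^sub>1\<close> as an Appell sum. A union \<open>A\<close> of three residue classes modulo 5 yields linear
  relations, with infinite products as constant terms, between the pieces of that sum with summation index in a
  fixed class. Dividing by the 5-dissection of \<open>J\<^sub>1\<close>, which comes from the same identity without the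
  factor \<open>1 + q\<^sup>k\<close>, the pieces of the Appell sum cancel from \<open>a_f(5n-1) + a_f(n/5)\<close>, and a combination of
  infinite products remains.

  Two product identities for theta functions modulo 5 show that all these products are rational in a single series
  \<open>k\<close>, up to powers of two others; the combination collapses to
  \<open>J\<^sub>1\<^sup>3 J\<^sub>5\<^sup>4 / (J\<^sub>2\<^sup>4 J\<^bsub>10\<^esub>\<^sup>2) (1 + k\<^sup>2) / (1 - k\<^sup>2)\<close>. The square of this is an eta quotient times
  \<open>1 + 4h\<^sup>2\<close>, where \<open>h = k / (1 - k\<^sup>2)\<close> is an eta quotient of level 10. Since \<open>h(q)\<close> and \<open>h(q\<^sup>2)\<close>
  satisfy a quadratic equation, the square of the right-hand side is the same, and the constant coefficients
  determine the sign.
\<close>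

text \<open>Why three classes: with three nodes in every five, the power of q in the weight at node
  n grows like 3n^2/10, a fifth of the pentagonal exponent, so the node sums are pieces of Watson's
  sum once q^5 has become q. The sum of the three classes fixes the linear term b n. Expanding 1/(1
  + x) over 1 + x^5 and reflecting n leaves b = 0, 1, 2, and each of these b admits exactly two
  triples. They share one class and together cover all five, so one unknown piece per b remains. For
  b = 0 and 1 its coefficient is zero; for b = 2 it is f(q^5) up to a product, which the summand
  a_f(n/5) removes. Why squares: h is invariant under k -> -1/k, while (1 + k^2)/(1 - k^2) changes
  sign and hence is not rational in h; its square is 1 + 4h^2. On the other side, the quadratic
  equation for h(q^2) over h has discriminant (1 - 4h)(1 + 4h^2), so the same square root appears
  there. Laurent series serve because nodes q^k with k < 0 occur.\<close>

unbundle fps_syntax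

declare fls_X_power_int [simp del] fls_compose_power_X [simp del]

section \<open>Formal sums and products of Laurent series\<close>

text \<open>Reads f = O(q^n). Unlike a bound on \<open>fls_subdegree\<close>, it holds for the zero
  series at every n, so congruences modulo q^n, written \<open>vanishes_below n (f - g)\<close>,
  need no case distinction.\<close>

definition vanishes_below :: "int \<Rightarrow> 'a::zero fls \<Rightarrow> bool" where
  "vanishes_below n f \<longleftrightarrow> (\<forall>m<n. f $$ m = 0)"

lemma vanishes_below_0 [simp]: "vanishes_below n 0"
  by (simp add: vanishes_below_def)

lemma vanishes_below_mono: "vanishes_below n f \<Longrightarrow> m \<le> n \<Longrightarrow> vanishes_below m f"
  by (auto simp: vanishes_below_def)

lemma vanishes_below_add:
  "vanishes_below n f \<Longrightarrow> vanishes_below n g \<Longrightarrow> vanishes_below n (f + g :: 'a::monoid_add fls)"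
  by (auto simp: vanishes_below_def)

lemma vanishes_below_uminus [simp]:
  "vanishes_below n (- f) \<longleftrightarrow> vanishes_below n (f :: 'a::group_add fls)"
  by (auto simp: vanishes_below_def)

lemma vanishes_below_diff:
  "vanishes_below n f \<Longrightarrow> vanishes_below n g \<Longrightarrow> vanishes_below n (f - g :: 'a::group_add fls)"
  by (auto simp: vanishes_below_def)

lemma vanishes_below_minus_commute:
  "vanishes_below n (f - g) \<longleftrightarrow> vanishes_below n (g - f :: 'a::ab_group_add fls)"
  by (metis minus_diff_eq vanishes_below_uminus)

lemma vanishes_below_trans:
  assumes "vanishes_below n (f - g)" "vanishes_below n (g - h :: 'a::ab_group_add fls)"
  shows "vanishes_below n (f - h)"
  using vanishes_below_add[OF assms] by simp

lemma vanishes_below_sum: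
  "(\<And>i. i \<in> A \<Longrightarrow> vanishes_below n (f i)) \<Longrightarrow> vanishes_below n (\<Sum>i\<in>A. f i :: 'a::comm_monoid_add fls)"
  by (auto simp: vanishes_below_def fls_nth_sum intro!: sum.neutral)

lemma vanishes_below_iff_subdegree:
  "f \<noteq> 0 \<Longrightarrow> vanishes_below n f \<longleftrightarrow> n \<le> fls_subdegree f"
  unfolding vanishes_below_def
  by (meson fls_eq0_below_subdegree fls_subdegree_geI order_less_le_trans)

lemma vanishes_below_mult:
  assumes "vanishes_below m f" "vanishes_below n (g :: 'a::idom fls)"
  shows "vanishes_below (m + n) (f * g)"
  using assms by (cases "f = 0 \<or> g = 0") (auto simp: vanishes_below_iff_subdegree)

text \<open>The offset \<open>c\<close> lets an approximation indexed by n lose a fixed power of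
  q.\<close>

lemma vanishes_below_eqI:
  assumes "\<And>n :: nat. vanishes_below (int n - c) (f - g)"
  shows "f = (g :: 'a::ab_group_add fls)"
proof (rule fls_eqI)
  fix m
  have "vanishes_below (int (nat (m + c + 1)) - c) (f - g)" by (rule assms)
  moreover have "m < int (nat (m + c + 1)) - c" by simp
  ultimately have "(f - g) $$ m = 0" unfolding vanishes_below_def by blast
  then show "f $$ m = g $$ m" by simp
qed

lemma vanishes_below_X_powi [simp]: "vanishes_below n (fls_X powi k :: 'a::field fls) \<longleftrightarrow> n \<le> k"
  by (simp add: vanishes_below_iff_subdegree)

lemma vanishes_below_X_power [simp]: "vanishes_below n (fls_X ^ k :: 'a::field fls) \<longleftrightarrow> n \<le> int k"
  by (simp add: vanishes_below_iff_subdegree)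

lemma vanishes_below_one [simp]: "vanishes_below n (1 :: 'a::field fls) \<longleftrightarrow> n \<le> 0"
  by (simp add: vanishes_below_iff_subdegree)

lemma vanishes_below_mult_int:
  "vanishes_below n f \<Longrightarrow> vanishes_below 0 (g :: 'a::idom fls) \<Longrightarrow> vanishes_below n (f * g)"
  using vanishes_below_mult[of n f 0 g] by simp

lemma vanishes_below_int_mult:
  "vanishes_below 0 f \<Longrightarrow> vanishes_below n (g :: 'a::idom fls) \<Longrightarrow> vanishes_below n (f * g)"
  using vanishes_below_mult[of 0 f n g] by simp

lemma vanishes_below_diff_mult:
  assumes "vanishes_below n (f - f')" "vanishes_below n (g - g')" "vanishes_below 0 f'" "vanishes_below 0 (g :: 'a::idom fls)"
  shows "vanishes_below n (f * g - f' * g')"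
proof -
  have "f * g - f' * g' = (f - f') * g + f' * (g - g')" by (simp add: algebra_simps)
  moreover have "vanishes_below n ((f - f') * g)" by (rule vanishes_below_mult_int) fact+
  moreover have "vanishes_below n (f' * (g - g'))" by (rule vanishes_below_int_mult) fact+
  ultimately show ?thesis by (simp add: vanishes_below_add)
qed

section \<open>Units with constant term 1\<close>

definition unipotent :: "'a::field fls \<Rightarrow> bool" where
  "unipotent f \<longleftrightarrow> vanishes_below 1 (f - 1)"

lemma unipotent_one [simp]: "unipotent 1"
  by (simp add: unipotent_def)

lemma unipotent_imp_integral: "unipotent f \<Longrightarrow> vanishes_below 0 f"
  unfolding unipotent_def
  using vanishes_below_add[of 0 "f - 1" 1] vanishes_below_mono[of 1 "f - 1" 0] by simp

lemma unipotent_nth_0: "unipotent f \<Longrightarrow> f $$ 0 = 1"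
  by (auto simp: unipotent_def vanishes_below_def dest!: spec[of _ 0])

lemma unipotent_nonzero: "unipotent f \<Longrightarrow> f \<noteq> 0"
  using unipotent_nth_0[of f] by auto

lemma unipotent_mult: "unipotent f \<Longrightarrow> unipotent g \<Longrightarrow> unipotent (f * g)"
  using vanishes_below_diff_mult[of 1 f 1 g 1] unipotent_imp_integral[of g] by (simp add: unipotent_def)

lemma unipotent_power: "unipotent f \<Longrightarrow> unipotent (f ^ n)"
  by (induction n) (auto intro: unipotent_mult)

lemma unipotent_prod: "(\<And>i. i \<in> A \<Longrightarrow> unipotent (f i)) \<Longrightarrow> unipotent (\<Prod>i\<in>A. f i)"
  by (induction A rule: infinite_finite_induct) (auto intro: unipotent_mult)

lemma unipotent_subdegree: "unipotent f \<Longrightarrow> fls_subdegree f = 0"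
  using unipotent_imp_integral[of f] unipotent_nth_0[of f]
  by (intro fls_subdegree_eqI) (auto simp: vanishes_below_def)

lemma vanishes_below_inverse_unipotent: "unipotent f \<Longrightarrow> vanishes_below 0 (inverse f)"
  by (simp add: vanishes_below_iff_subdegree unipotent_nonzero unipotent_subdegree)

lemma vanishes_below_inverse_diff:
  assumes "vanishes_below n (f - g)" "unipotent f" "unipotent g"
  shows "vanishes_below n (inverse f - inverse g)"
proof -
  have "inverse f - inverse g = (g - f) * (inverse f * inverse g)"
    using assms by (simp add: unipotent_nonzero field_simps)
  moreover have "vanishes_below 0 (inverse f * inverse g)"
    using assms by (intro vanishes_below_int_mult vanishes_below_inverse_unipotent)
  ultimately show ?thesis
    using assms(1) by (metis vanishes_below_minus_commute vanishes_below_mult_int)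
qed

lemma unipotent_inverse: "unipotent f \<Longrightarrow> unipotent (inverse f)"
  using vanishes_below_inverse_diff[of 1 f 1] by (simp add: unipotent_def)

lemma unipotent_one_plus: "vanishes_below 1 f \<Longrightarrow> unipotent (1 + f)"
  by (simp add: unipotent_def)

lemma unipotent_one_minus: "vanishes_below 1 f \<Longrightarrow> unipotent (1 - f)"
  by (simp add: unipotent_def)

section \<open>Summable families over arbitrary index sets\<close>

definition fsummable :: "('i \<Rightarrow> 'a::zero fls) \<Rightarrow> 'i set \<Rightarrow> bool" where
  "fsummable F A \<longleftrightarrow> (\<forall>n. finite {i\<in>A. \<not> vanishes_below n (F i)})"

text \<open>Each coefficient is summed over its support only, which is finite for a summable family;
  \<open>sum\<close> over an infinite set would be 0.\<close>

definition fsum :: "('i \<Rightarrow> 'a::comm_monoid_add fls) \<Rightarrow> 'i set \<Rightarrow> 'a fls" where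
  "fsum F A = Abs_fls (\<lambda>m. \<Sum>i\<in>{i\<in>A. F i $$ m \<noteq> 0}. F i $$ m)"

text \<open>Only finitely many members fail to be O(1), and the least of 0 and their subdegrees is a
  bound. It supplies the lower bound on exponents that \<open>Abs_fls\<close> requires.\<close>

lemma fsummable_bounded_below:
  assumes "fsummable F A"
  shows "\<exists>N. \<forall>i\<in>A. vanishes_below N (F i)"
proof -
  let ?B = "{i\<in>A. \<not> vanishes_below 0 (F i)}"
  let ?N = "Min (insert 0 ((\<lambda>i. fls_subdegree (F i)) ` ?B))"
  have fin: "finite ?B" using assms by (auto simp: fsummable_def)
  have "vanishes_below ?N (F i)" if "i \<in> A" for i
  proof (cases "i \<in> ?B")
    case True
    then have "F i \<noteq> 0" by auto
    moreover have "?N \<le> fls_subdegree (F i)" using True fin by (intro Min_le) auto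
    ultimately show ?thesis
      by (auto simp: vanishes_below_def)
  next
    case False
    then have "vanishes_below 0 (F i)" using that by auto
    moreover have "?N \<le> 0" using fin by (intro Min_le) auto
    ultimately show ?thesis by (rule vanishes_below_mono)
  qed
  then show ?thesis by blast
qed

lemma fsum_nth:
  assumes "fsummable F A"
  shows "fsum F A $$ m = (\<Sum>i\<in>{i\<in>A. F i $$ m \<noteq> 0}. F i $$ m)"
proof -
  obtain N where "\<forall>i\<in>A. vanishes_below N (F i)" using fsummable_bounded_below[OF assms] by blast
  then have "\<forall>m<N. (\<Sum>i\<in>{i\<in>A. F i $$ m \<noteq> 0}. F i $$ m) = 0"
    by (auto simp: vanishes_below_def intro!: sum.neutral)
  then show ?thesis
    unfolding fsum_def by (subst nth_Abs_fls_lower_bound) auto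
qed

lemma fsum_approx:
  fixes F :: "'i \<Rightarrow> 'a::ab_group_add fls"
  assumes "fsummable F A" "finite B" "B \<subseteq> A" "\<And>i. i \<in> A - B \<Longrightarrow> vanishes_below n (F i)"
  shows "vanishes_below n (fsum F A - sum F B)"
  unfolding vanishes_below_def
proof (intro allI impI)
  fix m assume "m < n"
  have "(\<Sum>i\<in>{i\<in>A. F i $$ m \<noteq> 0}. F i $$ m) = (\<Sum>i\<in>B. F i $$ m)"
  proof (rule sum.mono_neutral_left)
    show "{i \<in> A. F i $$ m \<noteq> 0} \<subseteq> B"
      using assms(4) \<open>m < n\<close> by (force simp: vanishes_below_def)
  qed (use assms in auto)
  then show "(fsum F A - sum F B) $$ m = 0"
    using assms(1) by (simp add: fsum_nth fls_nth_sum)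
qed

lemma fsum_eqI:
  fixes F :: "'i \<Rightarrow> 'a::ab_group_add fls"
  assumes "fsummable F A"
    and "\<And>n :: nat. \<exists>B. finite B \<and> B \<subseteq> A \<and> (\<forall>i\<in>A-B. vanishes_below (int n - c) (F i)) \<and> vanishes_below (int n - c) (S - sum F B)"
  shows "fsum F A = S"
proof (rule vanishes_below_eqI)
  fix n :: nat
  obtain B where "finite B" "B \<subseteq> A" "\<forall>i\<in>A-B. vanishes_below (int n - c) (F i)" "vanishes_below (int n - c) (S - sum F B)"
    using assms(2) by blast
  then show "vanishes_below (int n - c) (fsum F A - S)"
    using fsum_approx[OF assms(1), of B "int n - c"]
    by (metis vanishes_below_minus_commute vanishes_below_trans)
qed

lemma fsummable_cong:
  "A = B \<Longrightarrow> (\<And>i. i \<in> B \<Longrightarrow> F i = G i) \<Longrightarrow> fsummable F A \<longleftrightarrow> fsummable G B"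
  unfolding fsummable_def by (metis (mono_tags, lifting) Collect_cong)

lemma fsum_cong: "A = B \<Longrightarrow> (\<And>i. i \<in> B \<Longrightarrow> F i = G i) \<Longrightarrow> fsum F A = fsum G B"
  unfolding fsum_def by (intro arg_cong[of _ _ Abs_fls] ext sum.cong) auto

lemma fsummable_finite [simp]: "finite A \<Longrightarrow> fsummable F A"
  by (simp add: fsummable_def)

lemma fsum_finite: "finite A \<Longrightarrow> fsum F A = (sum F A :: 'a::ab_group_add fls)"
  by (rule fsum_eqI[where c = 0]) (auto intro!: exI[of _ A])

lemma fsummable_subset:
  assumes "fsummable F A" "B \<subseteq> A"
  shows "fsummable F B"
  unfolding fsummable_def
proof
  fix n
  have "{i\<in>B. \<not> vanishes_below n (F i)} \<subseteq> {i\<in>A. \<not> vanishes_below n (F i)}" using assms(2) by blast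
  then show "finite {i\<in>B. \<not> vanishes_below n (F i)}"
    using assms(1) unfolding fsummable_def by (meson finite_subset)
qed

lemma fsummable_add:
  fixes F :: "'i \<Rightarrow> 'a::ab_group_add fls"
  assumes "fsummable F A" "fsummable G A"
  shows "fsummable (\<lambda>i. F i + G i) A"
  unfolding fsummable_def
proof
  fix n
  have "{i\<in>A. \<not> vanishes_below n (F i + G i)} \<subseteq> {i\<in>A. \<not> vanishes_below n (F i)} \<union> {i\<in>A. \<not> vanishes_below n (G i)}"
    using vanishes_below_add by blast
  then show "finite {i\<in>A. \<not> vanishes_below n (F i + G i)}"
    using assms unfolding fsummable_def by (meson finite_UnI finite_subset)
qed

lemma fsum_add:
  fixes F :: "'i \<Rightarrow> 'a::ab_group_add fls"
  assumes "fsummable F A" "fsummable G A"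
  shows "fsum (\<lambda>i. F i + G i) A = fsum F A + fsum G A"
proof (rule fsum_eqI[where c = 0])
  fix n :: nat
  let ?B = "{i\<in>A. \<not> vanishes_below (int n) (F i)} \<union> {i\<in>A. \<not> vanishes_below (int n) (G i)}"
  have fin: "finite ?B" using assms by (auto simp: fsummable_def)
  have "vanishes_below (int n) ((fsum F A - sum F ?B) + (fsum G A - sum G ?B))"
    using assms fin by (intro vanishes_below_add fsum_approx) auto
  also have "(fsum F A - sum F ?B) + (fsum G A - sum G ?B) = fsum F A + fsum G A - (\<Sum>i\<in>?B. F i + G i)"
    by (simp add: sum.distrib)
  finally show "\<exists>B. finite B \<and> B \<subseteq> A \<and> (\<forall>i\<in>A-B. vanishes_below (int n - 0) (F i + G i)) \<and> vanishes_below (int n - 0) (fsum F A + fsum G A - (\<Sum>i\<in>B. F i + G i))"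
    using fin by (intro exI[of _ ?B]) (auto intro: vanishes_below_add)
qed (use assms fsummable_add in blast)

lemma fsummable_cmult:
  fixes F :: "'i \<Rightarrow> 'a::field fls"
  assumes "fsummable F A"
  shows "fsummable (\<lambda>i. c * F i) A"
proof (cases "c = 0")
  case False
  have "vanishes_below n (c * F i)" if "vanishes_below (n - fls_subdegree c) (F i)" for n i
    using vanishes_below_mult[of "fls_subdegree c" c "n - fls_subdegree c" "F i"] that False
    by (simp add: vanishes_below_iff_subdegree)
  then have "{i\<in>A. \<not> vanishes_below n (c * F i)} \<subseteq> {i\<in>A. \<not> vanishes_below (n - fls_subdegree c) (F i)}" for n
    by blast
  then show ?thesis
    using assms unfolding fsummable_def by (meson finite_subset)
qed (auto simp: fsummable_def)

lemma fsum_cmult: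
  fixes F :: "'i \<Rightarrow> 'a::field fls"
  assumes "fsummable F A"
  shows "fsum (\<lambda>i. c * F i) A = c * fsum F A"
proof (cases "c = 0")
  case True
  have "fsum (\<lambda>i. 0 * F i) A = 0" by (rule fls_eqI) (simp add: fsum_nth fsummable_def)
  with True show ?thesis by simp
next
  case False
  define s where "s = fls_subdegree c"
  have c: "vanishes_below s c" using False by (simp add: s_def vanishes_below_iff_subdegree)
  show ?thesis
  proof (rule fsum_eqI[where c = "- s"])
    fix n :: nat
    let ?B = "{i\<in>A. \<not> vanishes_below (int n) (F i)}"
    have fin: "finite ?B" using assms by (auto simp: fsummable_def)
    have "vanishes_below (s + int n) (c * (fsum F A - sum F ?B))"
      using assms fin c by (intro vanishes_below_mult fsum_approx) auto
    moreover have "vanishes_below (s + int n) (c * F i)" if "i \<in> A - ?B" for i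
      using that c by (intro vanishes_below_mult) auto
    ultimately show "\<exists>B. finite B \<and> B \<subseteq> A \<and> (\<forall>i\<in>A-B. vanishes_below (int n - (- s)) (c * F i)) \<and> vanishes_below (int n - (- s)) (c * fsum F A - (\<Sum>i\<in>B. c * F i))"
      using fin by (intro exI[of _ ?B]) (auto simp: algebra_simps sum_distrib_left)
  qed (use assms fsummable_cmult in blast)
qed

lemma fsummable_uminus: "fsummable F A \<Longrightarrow> fsummable (\<lambda>i. - F i :: 'a::ab_group_add fls) A"
  by (simp add: fsummable_def)

lemma fsum_uminus: "fsummable F A \<Longrightarrow> fsum (\<lambda>i. - F i :: 'a::field fls) A = - fsum F A"
  using fsum_cmult[of F A "- 1"] by simp

lemma fsummable_diff:
  "fsummable F A \<Longrightarrow> fsummable G A \<Longrightarrow> fsummable (\<lambda>i. F i - G i :: 'a::ab_group_add fls) A"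
  using fsummable_add[of F A "\<lambda>i. - G i"] by (simp add: fsummable_uminus)

lemma fsum_diff:
  "fsummable F A \<Longrightarrow> fsummable G A \<Longrightarrow> fsum (\<lambda>i. F i - G i :: 'a::field fls) A = fsum F A - fsum G A"
  using fsum_add[of F A "\<lambda>i. - G i"] by (simp add: fsummable_uminus fsum_uminus)

lemma fsummable_reindex:
  assumes "inj_on h A"
  shows "fsummable F (h ` A) \<longleftrightarrow> fsummable (F \<circ> h) A"
proof -
  have "{i \<in> h ` A. \<not> vanishes_below n (F i)} = h ` {i\<in>A. \<not> vanishes_below n (F (h i))}" for n by auto
  moreover have "finite (h ` {i\<in>A. \<not> vanishes_below n (F (h i))}) \<longleftrightarrow> finite {i\<in>A. \<not> vanishes_below n (F (h i))}" for n
    by (rule finite_image_iff) (use assms in \<open>auto simp: inj_on_def\<close>)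
  ultimately show ?thesis
    by (simp add: fsummable_def)
qed

lemma fsum_reindex:
  assumes "inj_on h A"
  shows "fsum F (h ` A) = fsum (F \<circ> h) A"
proof -
  have "(\<Sum>i\<in>{i \<in> h ` A. F i $$ m \<noteq> 0}. F i $$ m) = (\<Sum>i\<in>{i \<in> A. F (h i) $$ m \<noteq> 0}. F (h i) $$ m)" for m
    by (rule sum.reindex_cong[of h]) (use assms in \<open>auto simp: inj_on_def\<close>)
  then show ?thesis by (simp add: fsum_def)
qed

lemma fsummable_reindex_bij: "bij_betw h A B \<Longrightarrow> fsummable F B \<longleftrightarrow> fsummable (\<lambda>i. F (h i)) A"
  using fsummable_reindex[of h A F] by (auto simp: bij_betw_def comp_def)

lemma fsum_reindex_bij: "bij_betw h A B \<Longrightarrow> fsum F B = fsum (\<lambda>i. F (h i)) A"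
  using fsum_reindex[of h A F] by (auto simp: bij_betw_def comp_def)

text \<open>Fubini without estimates: modulo q^n only the finite set \<open>C n\<close> of pairs
  matters, and its projection contains every i whose inner sum is not O(q^n).\<close>

lemma fsum_Sigma:
  fixes F :: "'i \<Rightarrow> 'j \<Rightarrow> 'a::ab_group_add fls"
  assumes "fsummable (\<lambda>(i, j). F i j) (Sigma A B)"
  shows "fsummable (\<lambda>i. fsum (F i) (B i)) A"
    and "fsum (\<lambda>i. fsum (F i) (B i)) A = fsum (\<lambda>(i, j). F i j) (Sigma A B)"
    and "i \<in> A \<Longrightarrow> fsummable (F i) (B i)"
proof -
  define C where "C n = {p \<in> Sigma A B. \<not> vanishes_below n (case p of (i, j) \<Rightarrow> F i j)}" for n
  have finC: "finite (C n)" for n using assms by (auto simp: fsummable_def C_def)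
  have inner: "fsummable (F i) (B i)" if "i \<in> A" for i
    unfolding fsummable_def
  proof
    fix n
    have "{j\<in>B i. \<not> vanishes_below n (F i j)} \<subseteq> snd ` C n"
      using that by (force simp: C_def)
    then show "finite {j\<in>B i. \<not> vanishes_below n (F i j)}"
      using finC finite_subset by blast
  qed
  then show "i \<in> A \<Longrightarrow> fsummable (F i) (B i)" .
  have small: "vanishes_below n (fsum (F i) (B i))" if "i \<in> A - fst ` C n" for i n
  proof -
    have "vanishes_below n (fsum (F i) (B i) - sum (F i) {})"
    proof (rule fsum_approx)
      show "vanishes_below n (F i j)" if "j \<in> B i - {}" for j
      proof (rule ccontr)
        assume "\<not> vanishes_below n (F i j)"
        then have "(i, j) \<in> C n" using that \<open>i \<in> _\<close> by (auto simp: C_def)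
        then show False using \<open>i \<in> _\<close> by force
      qed
    qed (use that inner in auto)
    then show ?thesis by simp
  qed
  show summ: "fsummable (\<lambda>i. fsum (F i) (B i)) A"
    unfolding fsummable_def
  proof
    fix n
    have "{i \<in> A. \<not> vanishes_below n (fsum (F i) (B i))} \<subseteq> fst ` C n" using small by blast
    then show "finite {i \<in> A. \<not> vanishes_below n (fsum (F i) (B i))}"
      using finC finite_subset by blast
  qed
  show "fsum (\<lambda>i. fsum (F i) (B i)) A = fsum (\<lambda>(i, j). F i j) (Sigma A B)"
  proof (rule fsum_eqI[where c = 0, OF summ])
    fix n :: nat
    define D where "D i = {j \<in> B i. \<not> vanishes_below (int n) (F i j)}" for i
    let ?A = "fst ` C (int n)"
    have C: "C (int n) = Sigma ?A D"
      by (force simp: C_def D_def)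
    have sub: "?A \<subseteq> A" by (auto simp: C_def)
    have finD: "finite (D i)" if "i \<in> A" for i using inner[OF that] by (simp add: D_def fsummable_def)
    have "vanishes_below (int n) (fsum (\<lambda>(i, j). F i j) (Sigma A B) - (\<Sum>(i, j)\<in>C (int n). F i j))"
      using assms finC by (intro fsum_approx) (auto simp: C_def)
    also have "(\<Sum>(i, j)\<in>C (int n). F i j) = (\<Sum>i\<in>?A. sum (F i) (D i))"
      by (subst C, subst sum.Sigma) (use finC sub finD in auto)
    finally have 1: "vanishes_below (int n) (fsum (\<lambda>(i, j). F i j) (Sigma A B) - (\<Sum>i\<in>?A. sum (F i) (D i)))" .
    have "vanishes_below (int n) (\<Sum>i\<in>?A. fsum (F i) (B i) - sum (F i) (D i))"
      using sub finD inner by (intro vanishes_below_sum fsum_approx) (auto simp: D_def)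
    then have 2: "vanishes_below (int n) ((\<Sum>i\<in>?A. sum (F i) (D i)) - (\<Sum>i\<in>?A. fsum (F i) (B i)))"
      by (simp add: sum_subtractf vanishes_below_minus_commute)
    show "\<exists>B'. finite B' \<and> B' \<subseteq> A \<and> (\<forall>i\<in>A-B'. vanishes_below (int n - 0) (fsum (F i) (B i))) \<and>
       vanishes_below (int n - 0) (fsum (\<lambda>(i, j). F i j) (Sigma A B) - (\<Sum>i\<in>B'. fsum (F i) (B i)))"
      using vanishes_below_trans[OF 1 2] small finC sub by (intro exI[of _ ?A]) auto
  qed
qed

text \<open>The relation \<open>R\<close> admits triangular domains such as |r| <= n, which occur in
  Bailey's lemma.\<close>

lemma fsum_swap:
  fixes F :: "'i \<Rightarrow> 'j \<Rightarrow> 'a::ab_group_add fls"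
  assumes "fsummable (\<lambda>(i, j). F i j) {(i, j). i \<in> A \<and> j \<in> B \<and> R i j}"
  shows "fsum (\<lambda>i. fsum (F i) {j\<in>B. R i j}) A = fsum (\<lambda>j. fsum (\<lambda>i. F i j) {i\<in>A. R i j}) B"
proof -
  let ?S = "Sigma A (\<lambda>i. {j\<in>B. R i j})" and ?T = "Sigma B (\<lambda>j. {i\<in>A. R i j})"
  have S: "{(i, j). i \<in> A \<and> j \<in> B \<and> R i j} = ?S" by auto
  have bij: "bij_betw (\<lambda>(j, i). (i, j)) ?T ?S"
    by (rule bij_betwI[where g = "\<lambda>(i, j). (j, i)"]) auto
  have 1: "fsummable (\<lambda>(i, j). F i j) ?S" using assms by (simp add: S)
  have 2: "fsummable (\<lambda>(j, i). F i j) ?T"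
    using 1 fsummable_reindex_bij[OF bij, of "\<lambda>(i, j). F i j"] by (simp add: case_prod_unfold)
  have "fsum (\<lambda>i. fsum (F i) {j\<in>B. R i j}) A = fsum (\<lambda>(i, j). F i j) ?S"
    by (rule fsum_Sigma(2)[OF 1])
  also have "\<dots> = fsum (\<lambda>(j, i). F i j) ?T"
    using fsum_reindex_bij[OF bij, of "\<lambda>(i, j). F i j"] by (simp add: case_prod_unfold)
  also have "\<dots> = fsum (\<lambda>j. fsum (\<lambda>i. F i j) {i\<in>A. R i j}) B"
    by (rule fsum_Sigma(2)[OF 2, symmetric])
  finally show ?thesis .
qed

lemma fsummable_UN:
  assumes "finite I" "\<And>i. i \<in> I \<Longrightarrow> fsummable F (A i)"
  shows "fsummable F (\<Union>i\<in>I. A i)"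
proof -
  have "{x \<in> \<Union>i\<in>I. A i. \<not> vanishes_below n (F x)} = (\<Union>i\<in>I. {x \<in> A i. \<not> vanishes_below n (F x)})" for n
    by auto
  then show ?thesis using assms by (simp add: fsummable_def)
qed

lemma fsum_UN_disjoint:
  fixes F :: "'i \<Rightarrow> 'a::ab_group_add fls"
  assumes "finite I" "fsummable F (\<Union>i\<in>I. A i)" "disjoint_family_on A I"
  shows "fsum F (\<Union>i\<in>I. A i) = (\<Sum>i\<in>I. fsum F (A i))"
proof -
  have bij: "bij_betw snd (Sigma I A) (\<Union>i\<in>I. A i)"
    unfolding bij_betw_def
  proof
    show "inj_on snd (Sigma I A)"
    proof (rule inj_onI)
      fix x y assume xy: "x \<in> Sigma I A" "y \<in> Sigma I A" "snd x = snd y"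
      then have "snd x \<in> A (fst x) \<inter> A (fst y)" "fst x \<in> I" "fst y \<in> I" by auto
      then have "fst x = fst y" using assms(3) unfolding disjoint_family_on_def by blast
      with xy show "x = y" by (simp add: prod_eq_iff)
    qed
  qed force
  have 1: "fsummable (\<lambda>(i, x). F x) (Sigma I A)"
    using assms(2) fsummable_reindex_bij[OF bij, of F] by (simp add: case_prod_unfold)
  have "fsum F (\<Union>i\<in>I. A i) = fsum (\<lambda>(i, x). F x) (Sigma I A)"
    using fsum_reindex_bij[OF bij] by (simp add: case_prod_unfold)
  also have "\<dots> = fsum (\<lambda>i. fsum F (A i)) I"
    by (rule fsum_Sigma(2)[OF 1, symmetric])
  finally show ?thesis using assms(1) by (simp add: fsum_finite)
qed

lemma fsummable_times:
  fixes F :: "'i \<Rightarrow> 'a::field fls"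
  assumes "fsummable F A" "fsummable G B"
  shows "fsummable (\<lambda>(i, j). F i * G j) (A \<times> B)"
  unfolding fsummable_def
proof
  fix n
  obtain M N where M: "\<forall>i\<in>A. vanishes_below M (F i)" and N: "\<forall>j\<in>B. vanishes_below N (G j)"
    using fsummable_bounded_below[OF assms(1)] fsummable_bounded_below[OF assms(2)] by blast
  have "{p \<in> A \<times> B. \<not> vanishes_below n (case p of (i, j) \<Rightarrow> F i * G j)}
      \<subseteq> {i\<in>A. \<not> vanishes_below (n - N) (F i)} \<times> {j\<in>B. \<not> vanishes_below (n - M) (G j)}"
  proof clarsimp
    fix i j assume *: "i \<in> A" "j \<in> B" "\<not> vanishes_below n (F i * G j)"
    show "\<not> vanishes_below (n - N) (F i) \<and> \<not> vanishes_below (n - M) (G j)"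
      using vanishes_below_mult[of "n - N" "F i" N "G j"] vanishes_below_mult[of M "F i" "n - M" "G j"] M N * by auto
  qed
  then show "finite {p \<in> A \<times> B. \<not> vanishes_below n (case p of (i, j) \<Rightarrow> F i * G j)}"
    using assms unfolding fsummable_def by (meson finite_SigmaI finite_subset)
qed

lemma fsum_times:
  fixes F :: "'i \<Rightarrow> 'a::field fls"
  assumes "fsummable F A" "fsummable G B"
  shows "fsum F A * fsum G B = fsum (\<lambda>(i, j). F i * G j) (A \<times> B)"
proof -
  have "fsum (\<lambda>(i, j). F i * G j) (A \<times> B) = fsum (\<lambda>i. fsum (\<lambda>j. F i * G j) B) A"
    by (rule fsum_Sigma(2)[symmetric, OF fsummable_times[OF assms]])
  also have "\<dots> = fsum (\<lambda>i. fsum G B * F i) A"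
    by (intro fsum_cong) (simp_all add: fsum_cmult[OF assms(2)] mult.commute)
  also have "\<dots> = fsum F A * fsum G B"
    by (subst fsum_cmult[OF assms(1)]) (rule mult.commute)
  finally show ?thesis ..
qed

lemma fsummableI_int:
  assumes "\<And>k. k \<in> A \<Longrightarrow> vanishes_below (\<bar>k\<bar> - c) (F k)"
  shows "fsummable F (A :: int set)"
  unfolding fsummable_def
proof
  fix n
  have "{k\<in>A. \<not> vanishes_below n (F k)} \<subseteq> {- \<bar>n + c\<bar>..\<bar>n + c\<bar>}"
  proof
    fix k assume k: "k \<in> {k\<in>A. \<not> vanishes_below n (F k)}"
    then have "\<not> n \<le> \<bar>k\<bar> - c" using assms[of k] vanishes_below_mono by blast
    then show "k \<in> {- \<bar>n + c\<bar>..\<bar>n + c\<bar>}" by auto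
  qed
  then show "finite {k\<in>A. \<not> vanishes_below n (F k)}" by (rule finite_subset) simp
qed

lemma fsummableI_nat:
  assumes "\<And>k. k \<in> A \<Longrightarrow> vanishes_below (int k) (F k)"
  shows "fsummable F (A :: nat set)"
  unfolding fsummable_def
proof
  fix n
  have "{k\<in>A. \<not> vanishes_below n (F k)} \<subseteq> {..nat n}"
  proof
    fix k assume k: "k \<in> {k\<in>A. \<not> vanishes_below n (F k)}"
    then have "\<not> n \<le> int k" using assms[of k] vanishes_below_mono by blast
    then show "k \<in> {..nat n}" by auto
  qed
  then show "finite {k\<in>A. \<not> vanishes_below n (F k)}" by (rule finite_subset) simp
qed

text \<open>Tannery's argument. The factor \<open>T k\<close> has order at least |k| - c, and the
  N-th finite identity knows the other factor \<open>U k\<close> to precision N - |k|; the two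
  orders add up to N - c, uniformly in k.\<close>

lemma fsum_limit:
  fixes T :: "int \<Rightarrow> 'a::field fls"
  assumes T: "\<And>k. k \<in> A \<Longrightarrow> vanishes_below (\<bar>k\<bar> - c) (T k)"
    and U: "\<And>k N. k \<in> A \<Longrightarrow> \<bar>k\<bar> \<le> int N \<Longrightarrow> vanishes_below (int N - \<bar>k\<bar>) (U k - V N k)"
    and U0: "\<And>k. k \<in> A \<Longrightarrow> vanishes_below 0 (U k)"
    and R: "\<And>N. N \<ge> N0 \<Longrightarrow> vanishes_below (int N - c) (R - (\<Sum>k\<in>A \<inter> {-int N..int N}. T k * V N k))"
  shows "fsummable (\<lambda>k. T k * U k) A" and "fsum (\<lambda>k. T k * U k) A = R"
proof -
  have TU: "vanishes_below (\<bar>k\<bar> - c) (T k * U k)" if "k \<in> A" for k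
    using T U0 that by (intro vanishes_below_mult_int) auto
  then show summ: "fsummable (\<lambda>k. T k * U k) A"
    by (rule fsummableI_int)
  show "fsum (\<lambda>k. T k * U k) A = R"
  proof (rule fsum_eqI[where c = c, OF summ])
    fix n :: nat
    define N where "N = max n N0"
    let ?B = "A \<inter> {-int N..int N}"
    have "vanishes_below (int N - c) (\<Sum>k\<in>?B. T k * V N k - T k * U k)"
    proof (rule vanishes_below_sum)
      fix k assume k: "k \<in> ?B"
      then have "vanishes_below (int N - \<bar>k\<bar>) (U k - V N k)" by (intro U) auto
      then have "vanishes_below ((\<bar>k\<bar> - c) + (int N - \<bar>k\<bar>)) (T k * (U k - V N k))"
        using k T by (intro vanishes_below_mult) auto
      then show "vanishes_below (int N - c) (T k * V N k - T k * U k)"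
        by (subst vanishes_below_minus_commute) (simp add: algebra_simps)
    qed
    then have "vanishes_below (int N - c) ((\<Sum>k\<in>?B. T k * V N k) - (\<Sum>k\<in>?B. T k * U k))"
      by (simp add: sum_subtractf)
    then have 1: "vanishes_below (int N - c) (R - (\<Sum>k\<in>?B. T k * U k))"
      using vanishes_below_trans[OF R[of N]] by (simp add: N_def)
    have 2: "vanishes_below (int N - c) (T k * U k)" if "k \<in> A - ?B" for k
      using that by (intro vanishes_below_mono[OF TU]) auto
    have "int n - c \<le> int N - c" by (simp add: N_def)
    then show "\<exists>B. finite B \<and> B \<subseteq> A \<and> (\<forall>k\<in>A-B. vanishes_below (int n - c) (T k * U k)) \<and> vanishes_below (int n - c) (R - (\<Sum>k\<in>B. T k * U k))"
      using vanishes_below_mono[OF 1] vanishes_below_mono[OF 2] by (intro exI[of _ ?B]) simp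
  qed
qed

section \<open>Substitution of q^d for q\<close>

lemma fls_compose_power_vanishes_below:
  assumes "d > 0" "vanishes_below n f"
  shows "vanishes_below (int d * n) (fls_compose_power f d)"
  unfolding vanishes_below_def
proof (intro allI impI)
  fix m assume m: "m < int d * n"
  show "fls_compose_power f d $$ m = 0"
  proof (cases "int d dvd m")
    case True
    then obtain l where l: "m = int d * l" by auto
    with m assms have "l < n" by simp
    then show ?thesis using assms by (simp add: fls_nth_compose_power l vanishes_below_def)
  qed (use assms in \<open>simp add: fls_nth_compose_power\<close>)
qed

lemma fls_compose_power_sum: "fls_compose_power (\<Sum>i\<in>A. f i) d = (\<Sum>i\<in>A. fls_compose_power (f i :: 'a::comm_monoid_add fls) d)"
  by (induction A rule: infinite_finite_induct) auto

lemma fls_compose_power_prod: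
  "d > 0 \<Longrightarrow> fls_compose_power (\<Prod>i\<in>A. f i) d = (\<Prod>i\<in>A. fls_compose_power (f i :: 'a::idom fls) d)"
  by (induction A rule: infinite_finite_induct) auto

lemma fls_compose_power_inverse:
  assumes "d > 0"
  shows "fls_compose_power (inverse f) d = inverse (fls_compose_power (f :: 'a::field fls) d)"
proof (cases "f = 0")
  case False
  have "fls_compose_power (inverse f) d * fls_compose_power f d = 1"
    using False assms by (simp flip: fls_compose_power_mult)
  then show ?thesis by (metis inverse_unique mult.commute)
qed auto

lemma fls_compose_power_divide:
  "d > 0 \<Longrightarrow> fls_compose_power (f / g) d = fls_compose_power f d / fls_compose_power (g :: 'a::field fls) d"
  by (simp add: divide_inverse fls_compose_power_inverse)

lemma fls_compose_power_X_powi [simp]: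
  "d > 0 \<Longrightarrow> fls_compose_power (fls_X powi n :: 'a::field fls) d = fls_X powi (int d * n)"
  by (simp add: fls_X_power_int)

lemma fls_compose_power_X_power [simp]:
  "d > 0 \<Longrightarrow> fls_compose_power (fls_X ^ n :: 'a::field fls) d = fls_X ^ (d * n)"
  using fls_compose_power_X_powi[of d "int n"] by (simp flip: power_int_of_nat)

lemma fls_compose_power_numeral [simp]: "d > 0 \<Longrightarrow> fls_compose_power (numeral k :: 'a::idom fls) d = numeral k"
  by (metis fls_compose_power_const_left fls_const_numeral)

lemma fsum_compose_power:
  fixes F :: "'i \<Rightarrow> 'a::field fls"
  assumes "d > 0" "fsummable F A"
  shows "fsummable (\<lambda>i. fls_compose_power (F i) d) A"
    and "fsum (\<lambda>i. fls_compose_power (F i) d) A = fls_compose_power (fsum F A) d"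
proof -
  have *: "vanishes_below (int n) (fls_compose_power f d)" if "vanishes_below (int n) f" for n and f :: "'a fls"
  proof -
    have "int n \<le> int d * int n" using assms(1) by (intro mult_right_mono[of 1 "int d" "int n", simplified]) auto
    then show ?thesis using fls_compose_power_vanishes_below[OF assms(1) that] vanishes_below_mono by blast
  qed
  show summ: "fsummable (\<lambda>i. fls_compose_power (F i) d) A"
    unfolding fsummable_def
  proof
    fix n
    have "vanishes_below n (fls_compose_power (F i) d)" if "vanishes_below (int (nat n)) (F i)" for i
      using *[OF that] by (rule vanishes_below_mono) simp
    then have "{i \<in> A. \<not> vanishes_below n (fls_compose_power (F i) d)} \<subseteq> {i\<in>A. \<not> vanishes_below (int (nat n)) (F i)}"
      by blast
    then show "finite {i \<in> A. \<not> vanishes_below n (fls_compose_power (F i) d)}"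
      using assms(2) unfolding fsummable_def by (meson finite_subset)
  qed
  show "fsum (\<lambda>i. fls_compose_power (F i) d) A = fls_compose_power (fsum F A) d"
  proof (rule fsum_eqI[where c = 0, OF summ])
    fix n :: nat
    let ?B = "{i\<in>A. \<not> vanishes_below (int n) (F i)}"
    have fin: "finite ?B" using assms by (auto simp: fsummable_def)
    have "vanishes_below (int n) (fls_compose_power (fsum F A - sum F ?B) d)"
      using assms fin by (intro * fsum_approx) auto
    then show "\<exists>B. finite B \<and> B \<subseteq> A \<and> (\<forall>i\<in>A-B. vanishes_below (int n - 0) (fls_compose_power (F i) d)) \<and>
       vanishes_below (int n - 0) (fls_compose_power (fsum F A) d - (\<Sum>i\<in>B. fls_compose_power (F i) d))"
      using fin * by (intro exI[of _ ?B]) (auto simp: fls_compose_power_sum)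
  qed
qed

section \<open>Infinite products whose j-th factor is 1 + O(q^j)\<close>

definition multipliable :: "(nat \<Rightarrow> 'a::field fls) \<Rightarrow> nat set \<Rightarrow> bool" where
  "multipliable f S \<longleftrightarrow> (\<forall>j\<in>S. j > 0 \<and> vanishes_below (int j) (f j - 1))"

text \<open>Factors with index above m do not affect the coefficient of q^m, so that coefficient can
  be read off from a finite product.\<close>

definition iprod :: "(nat \<Rightarrow> 'a::field fls) \<Rightarrow> nat set \<Rightarrow> 'a fls" where
  "iprod f S = Abs_fls (\<lambda>m. if m < 0 then 0 else (\<Prod>j\<in>S \<inter> {..nat m}. f j) $$ m)"

lemma multipliable_unipotent: "multipliable f S \<Longrightarrow> j \<in> S \<Longrightarrow> unipotent (f j)"
  unfolding multipliable_def unipotent_def using vanishes_below_mono[of "int j" "f j - 1" 1] by force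

lemma multipliable_subset: "multipliable f S \<Longrightarrow> T \<subseteq> S \<Longrightarrow> multipliable f T"
  by (auto simp: multipliable_def)

lemma vanishes_below_prod_tail:
  assumes "multipliable f S" "finite B" "B \<subseteq> S" "\<And>j. j \<in> B \<Longrightarrow> N < j"
  shows "vanishes_below (int N + 1) (prod f B - 1)"
  using assms(2-4)
proof (induction B rule: finite_induct)
  case (insert x B)
  have "vanishes_below (int N + 1) (f x - 1)"
    using insert.prems(1) insert.prems(2)[of x] assms(1) vanishes_below_mono[of "int x" "f x - 1" "int N + 1"]
    by (auto simp: multipliable_def)
  moreover have "vanishes_below (int N + 1) (prod f B - 1)"
    using insert by auto
  moreover have "vanishes_below 0 (prod f B)"
    using insert.prems by (intro unipotent_imp_integral unipotent_prod multipliable_unipotent[OF assms(1)]) auto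
  ultimately show ?case
    using insert vanishes_below_diff_mult[of "int N + 1" "f x" 1 "prod f B" 1] by simp
qed auto

lemma vanishes_below_prod_diff:
  assumes "multipliable f S" "finite B" "B \<subseteq> S" "finite B'" "B' \<subseteq> S" "S \<inter> {..N} \<subseteq> B" "S \<inter> {..N} \<subseteq> B'"
  shows "vanishes_below (int N + 1) (prod f B - prod f B')"
proof -
  let ?S = "S \<inter> {..N}"
  have *: "vanishes_below (int N + 1) (prod f B - prod f ?S)" if "finite B" "B \<subseteq> S" "?S \<subseteq> B" for B
  proof -
    have "prod f B - prod f ?S = prod f ?S * (prod f (B - ?S) - 1)"
      using that by (subst prod.subset_diff[of ?S B]) (auto simp: algebra_simps)
    moreover have "vanishes_below (int N + 1) (prod f (B - ?S) - 1)"
      using that by (intro vanishes_below_prod_tail[OF assms(1)]) auto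
    moreover have "vanishes_below 0 (prod f ?S)"
      by (intro unipotent_imp_integral unipotent_prod multipliable_unipotent[OF assms(1)]) auto
    ultimately show ?thesis by (simp add: vanishes_below_int_mult)
  qed
  have "vanishes_below (int N + 1) (prod f B - prod f ?S)" by (rule *) (use assms in auto)
  moreover have "vanishes_below (int N + 1) (prod f ?S - prod f B')"
    by (subst vanishes_below_minus_commute, rule *) (use assms in auto)
  ultimately show ?thesis by (rule vanishes_below_trans)
qed

lemma iprod_nth: "iprod f S $$ m = (if m < 0 then 0 else (\<Prod>j\<in>S \<inter> {..nat m}. f j) $$ m)"
  unfolding iprod_def by (subst nth_Abs_fls_lower_bound[of 0]) auto

lemma iprod_approx:
  assumes "multipliable f S" "finite B" "B \<subseteq> S" "S \<inter> {..N} \<subseteq> B"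
  shows "vanishes_below (int N + 1) (iprod f S - prod f B)"
  unfolding vanishes_below_def
proof (intro allI impI)
  fix m assume m: "m < int N + 1"
  have "vanishes_below 0 (prod f B)"
    using assms by (intro unipotent_imp_integral unipotent_prod multipliable_unipotent[OF assms(1)]) auto
  then have neg: "prod f B $$ m = 0" if "m < 0" using that by (auto simp: vanishes_below_def)
  have "vanishes_below (int (nat m) + 1) ((\<Prod>j\<in>S \<inter> {..nat m}. f j) - prod f B)"
    using assms m by (intro vanishes_below_prod_diff[OF assms(1)]) auto
  then have "((\<Prod>j\<in>S \<inter> {..nat m}. f j) - prod f B) $$ m = 0" if "m \<ge> 0"
    using that by (simp add: vanishes_below_def)
  then show "(iprod f S - prod f B) $$ m = 0"
    using neg by (auto simp: iprod_nth)
qed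

lemma iprod_eqI:
  assumes "multipliable f S"
    and "\<And>N :: nat. \<exists>B. finite B \<and> B \<subseteq> S \<and> S \<inter> {..N} \<subseteq> B \<and> vanishes_below (int N) (L - prod f B)"
  shows "iprod f S = L"
proof (rule vanishes_below_eqI[where c = 0])
  fix N :: nat
  obtain B where B: "finite B" "B \<subseteq> S" "S \<inter> {..N} \<subseteq> B" "vanishes_below (int N) (L - prod f B)"
    using assms(2)[of N] by (elim exE conjE)
  have "vanishes_below (int N) (iprod f S - prod f B)"
    using iprod_approx[OF assms(1) B(1-3)] by (rule vanishes_below_mono) simp
  then show "vanishes_below (int N - 0) (iprod f S - L)"
    using B(4) by (metis diff_zero vanishes_below_minus_commute vanishes_below_trans)
qed

lemma iprod_unipotent:
  assumes "multipliable f S"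
  shows "unipotent (iprod f S)"
proof -
  have "S \<inter> {..0} = {}" using assms by (auto simp: multipliable_def)
  then show ?thesis
    using iprod_approx[OF assms, of "{}" 0] by (simp add: unipotent_def)
qed

lemma multipliable_mult:
  "multipliable f S \<Longrightarrow> multipliable g S \<Longrightarrow> multipliable (\<lambda>j. f j * g j) S"
  unfolding multipliable_def
  using vanishes_below_diff_mult[of _ _ 1 _ 1]
  by (metis mult.right_neutral multipliable_def multipliable_unipotent order_refl unipotent_imp_integral vanishes_below_one)

lemma iprod_mult:
  assumes "multipliable f S" "multipliable g S"
  shows "iprod (\<lambda>j. f j * g j) S = iprod f S * iprod g S"
proof (rule iprod_eqI)
  fix N :: nat
  let ?B = "S \<inter> {..N}"
  have "vanishes_below (int N + 1) (iprod f S * iprod g S - prod f ?B * prod g ?B)"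
    using assms by (intro vanishes_below_diff_mult iprod_approx unipotent_imp_integral iprod_unipotent unipotent_prod)
       (auto intro: multipliable_unipotent)
  then have "vanishes_below (int N) (iprod f S * iprod g S - (\<Prod>j\<in>?B. f j * g j))"
    by (simp add: prod.distrib vanishes_below_mono)
  then show "\<exists>B. finite B \<and> B \<subseteq> S \<and> S \<inter> {..N} \<subseteq> B \<and> vanishes_below (int N) (iprod f S * iprod g S - (\<Prod>j\<in>B. f j * g j))"
    by (intro exI[of _ ?B]) auto
qed (intro multipliable_mult assms)

lemma iprod_Un_disjoint:
  assumes "multipliable f (S \<union> T)" "S \<inter> T = {}"
  shows "iprod f (S \<union> T) = iprod f S * iprod f T"
proof (rule iprod_eqI[OF assms(1)])
  fix N :: nat
  let ?B = "(S \<union> T) \<inter> {..N}"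
  have S: "multipliable f S" and T: "multipliable f T" using assms by (auto intro: multipliable_subset)
  have "vanishes_below (int N + 1) (iprod f S * iprod f T - prod f (S \<inter> {..N}) * prod f (T \<inter> {..N}))"
    using S T by (intro vanishes_below_diff_mult iprod_approx unipotent_imp_integral iprod_unipotent unipotent_prod)
       (auto intro: multipliable_unipotent)
  moreover have "prod f (S \<inter> {..N}) * prod f (T \<inter> {..N}) = prod f ?B"
    using assms(2) by (subst prod.union_disjoint[symmetric]) (auto simp: Int_Un_distrib2)
  ultimately have "vanishes_below (int N) (iprod f S * iprod f T - prod f ?B)"
    by (simp add: vanishes_below_mono)
  then show "\<exists>B. finite B \<and> B \<subseteq> S \<union> T \<and> (S \<union> T) \<inter> {..N} \<subseteq> B \<and> vanishes_below (int N) (iprod f S * iprod f T - prod f B)"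
    by (intro exI[of _ ?B]) auto
qed

text \<open>The condition \<open>t \<le> h t\<close> keeps the factor with new index t of the form 1
  + O(q^t), so the reindexed family still has the decay that \<open>multipliable\<close> asks
  for.\<close>

lemma iprod_reindex:
  assumes "multipliable f (h ` T)" "inj_on h T" "\<And>t. t \<in> T \<Longrightarrow> 0 < t \<and> t \<le> h t"
  shows "iprod f (h ` T) = iprod (\<lambda>t. f (h t)) T"
proof (rule iprod_eqI[OF assms(1)])
  fix N :: nat
  let ?B = "h ` (T \<inter> {..N})"
  have T: "multipliable (\<lambda>t. f (h t)) T"
    using assms(1,3) unfolding multipliable_def by (force intro: vanishes_below_mono)
  have "prod f ?B = (\<Prod>t\<in>T \<inter> {..N}. f (h t))"
    using assms(2) by (subst prod.reindex) (auto simp: inj_on_def)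
  then have "vanishes_below (int N + 1) (iprod (\<lambda>t. f (h t)) T - prod f ?B)"
    using iprod_approx[OF T, of "T \<inter> {..N}" N] by simp
  then have "vanishes_below (int N) (iprod (\<lambda>t. f (h t)) T - prod f ?B)"
    by (rule vanishes_below_mono) simp
  moreover have "h ` T \<inter> {..N} \<subseteq> ?B"
    using assms(3) by force
  ultimately show "\<exists>B. finite B \<and> B \<subseteq> h ` T \<and> h ` T \<inter> {..N} \<subseteq> B \<and> vanishes_below (int N) (iprod (\<lambda>t. f (h t)) T - prod f B)"
    by (intro exI[of _ ?B]) auto
qed

section \<open>Products over sets of exponents\<close>

definition qprod :: "'a::field fls \<Rightarrow> nat set \<Rightarrow> 'a fls" where
  "qprod e S = iprod (\<lambda>j. 1 - e * fls_X ^ j) S"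

lemma multipliable_qprod:
  assumes "vanishes_below 0 e" "0 \<notin> S"
  shows "multipliable (\<lambda>j. 1 - e * fls_X ^ j) S"
proof -
  have "vanishes_below (int j) (e * fls_X ^ j)" for j
    using assms(1) by (intro vanishes_below_int_mult) auto
  then show ?thesis using assms(2) by (auto simp: multipliable_def intro: gr0I)
qed

lemma qprod_unipotent: "vanishes_below 0 e \<Longrightarrow> 0 \<notin> S \<Longrightarrow> unipotent (qprod e S)"
  unfolding qprod_def by (intro iprod_unipotent multipliable_qprod)

lemma qprod_approx:
  "vanishes_below 0 e \<Longrightarrow> 0 \<notin> S \<Longrightarrow> finite B \<Longrightarrow> B \<subseteq> S \<Longrightarrow> S \<inter> {..N} \<subseteq> B \<Longrightarrow>
     vanishes_below (int N + 1) (qprod e S - (\<Prod>j\<in>B. 1 - e * fls_X ^ j))"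
  unfolding qprod_def by (intro iprod_approx multipliable_qprod)

lemma qprod_Un_disjoint:
  "vanishes_below 0 e \<Longrightarrow> 0 \<notin> S \<union> T \<Longrightarrow> S \<inter> T = {} \<Longrightarrow> qprod e (S \<union> T) = qprod e S * qprod e T"
  unfolding qprod_def by (intro iprod_Un_disjoint multipliable_qprod)

text \<open>Factorwise (1 - q^j)(1 + q^j) = 1 - q^(2j). This is how products with plus signs are
  later turned into quotients of products with minus signs.\<close>

lemma qprod_minus_plus:
  assumes "0 \<notin> S"
  shows "qprod 1 S * qprod (- 1) S = qprod 1 ((*) 2 ` S)"
proof -
  have "qprod 1 ((*) 2 ` S) = iprod (\<lambda>j. 1 - 1 * fls_X ^ (2 * j) :: 'a fls) S"
    unfolding qprod_def using assms
    by (intro iprod_reindex multipliable_qprod) (auto simp: inj_on_def intro: gr0I)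
  also have "\<dots> = iprod (\<lambda>j. (1 - 1 * fls_X ^ j) * (1 - (- 1) * fls_X ^ j)) S"
  proof -
    have "1 - 1 * (y * y) = (1 - 1 * y) * (1 - (- 1) * y)" for y :: "'a fls" by (simp add: algebra_simps)
    then show ?thesis by (simp only: mult_2 power_add)
  qed
  also have "\<dots> = qprod 1 S * qprod (- 1) S"
    unfolding qprod_def using assms by (intro iprod_mult multipliable_qprod) auto
  finally show ?thesis ..
qed

lemma fls_compose_power_qprod:
  assumes "d > 0" "0 \<notin> S" "vanishes_below 0 e"
  shows "fls_compose_power (qprod e S) d = qprod (fls_compose_power e d) ((*) d ` S)"
proof -
  have e': "vanishes_below 0 (fls_compose_power e d)"
    using fls_compose_power_vanishes_below[OF assms(1,3)] by simp
  have S': "0 \<notin> (*) d ` S" using assms by auto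
  have "iprod (\<lambda>j. 1 - fls_compose_power e d * fls_X ^ j) ((*) d ` S) = fls_compose_power (qprod e S) d"
  proof (rule iprod_eqI[OF multipliable_qprod[OF e' S']])
    fix N :: nat
    let ?B = "S \<inter> {..N}"
    have "vanishes_below (int d * (int N + 1)) (fls_compose_power (qprod e S - (\<Prod>j\<in>?B. 1 - e * fls_X ^ j)) d)"
      using assms by (intro fls_compose_power_vanishes_below qprod_approx) auto
    then have "vanishes_below (int d * (int N + 1)) (fls_compose_power (qprod e S) d - (\<Prod>j\<in>(*) d ` ?B. 1 - fls_compose_power e d * fls_X ^ j))"
      using assms(1) by (subst prod.reindex) (auto simp: inj_on_def fls_compose_power_prod simp del: fls_compose_power_power)
    moreover have "int N \<le> int d * (int N + 1)"
    proof -
      have "1 * (int N + 1) \<le> int d * (int N + 1)" using assms(1) by (intro mult_right_mono) linarith+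
      moreover have "int N \<le> 1 * (int N + 1)" by simp
      ultimately show ?thesis by (rule order_trans[rotated])
    qed
    ultimately have "vanishes_below (int N) (fls_compose_power (qprod e S) d - (\<Prod>j\<in>(*) d ` ?B. 1 - fls_compose_power e d * fls_X ^ j))"
      by (rule vanishes_below_mono)
    moreover have "(*) d ` S \<inter> {..N} \<subseteq> (*) d ` ?B"
    proof clarsimp
      fix x assume *: "d * x \<le> N" "x \<in> S"
      have "x \<le> d * x" using assms(1) by simp
      with * have "x \<le> N" by linarith
      with * show "d * x \<in> (*) d ` (S \<inter> {..N})" by blast
    qed
    ultimately show "\<exists>B. finite B \<and> B \<subseteq> (*) d ` S \<and> (*) d ` S \<inter> {..N} \<subseteq> B \<and>
       vanishes_below (int N) (fls_compose_power (qprod e S) d - (\<Prod>j\<in>B. 1 - fls_compose_power e d * fls_X ^ j))"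
      by (intro exI[of _ "(*) d ` ?B"]) auto
  qed
  then show ?thesis by (simp add: qprod_def)
qed

lemma fps_to_fls_prod: "fps_to_fls (\<Prod>i\<in>A. f i) = (\<Prod>i\<in>A. fps_to_fls (f i :: 'a::{comm_ring_1} fps))"
  by (induction A rule: infinite_finite_induct) (auto simp: fls_times_fps_to_fls)

lemma fps_to_fls_J:
  assumes "k \<ge> 1"
  shows "fps_to_fls (J k) = qprod 1 {j. 0 < j \<and> k dvd j}"
proof -
  let ?S = "{j. 0 < j \<and> k dvd j}"
  let ?P = "\<lambda>n. \<Prod>i\<le>n. 1 - fps_X ^ (k * Suc i) :: rat fps"
  have lim: "?P \<longlonglongrightarrow> J k"
  proof -
    \<comment> \<open>\<open>has_prod\<close> has a separate case for products with a vanishing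
      factor. No factor vanishes here, so the limit is that of the full partial products.\<close>
    have "1 - fps_X ^ (k * Suc i) \<noteq> (0 :: rat fps)" for i
    proof
      assume "1 - fps_X ^ (k * Suc i) = (0 :: rat fps)"
      then have "(1 - fps_X ^ (k * Suc i)) $ 0 = (0 :: rat)" by (simp only: fps_zero_nth)
      then show False using assms by simp
    qed
    then have "raw_has_prod (\<lambda>m. 1 - fps_X ^ (k * Suc m)) 0 (J k)"
      using has_prod_J[OF assms] unfolding has_prod_def by blast
    then show ?thesis by (simp add: raw_has_prod_def)
  qed
  have "iprod (\<lambda>j. 1 - 1 * fls_X ^ j) ?S = fps_to_fls (J k)"
  proof (rule iprod_eqI[OF multipliable_qprod])
    fix N :: nat
    \<comment> \<open>Convergence in the q-adic topology is eventual constancy of every coefficient;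
      one partial product then serves the finitely many coefficients up to N.\<close>
    have "\<forall>m\<in>{..N}. eventually (\<lambda>n. ?P n $ m = J k $ m) sequentially"
      using lim by (simp add: tendsto_fps_iff)
    then have "eventually (\<lambda>n. \<forall>m\<in>{..N}. ?P n $ m = J k $ m) sequentially"
      by (subst eventually_ball_finite_distrib) auto
    moreover have "eventually (\<lambda>n. n \<ge> N) sequentially" by (rule eventually_ge_at_top)
    ultimately have "eventually (\<lambda>n. n \<ge> N \<and> (\<forall>m\<in>{..N}. ?P n $ m = J k $ m)) sequentially"
      by eventually_elim auto
    then obtain n where n: "n \<ge> N" "\<forall>m\<in>{..N}. ?P n $ m = J k $ m"
      by (auto simp: eventually_sequentially)
    let ?B = "(\<lambda>i. k * Suc i) ` {..n}"
    have "(\<Prod>j\<in>?B. 1 - 1 * fls_X ^ j) = fps_to_fls (?P n)"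
      unfolding fps_to_fls_prod using assms
      by (subst prod.reindex) (auto simp: inj_on_def fps_to_fls_power simp del: power_Suc intro!: prod.cong)
    then have "vanishes_below (int N) (fps_to_fls (J k) - (\<Prod>j\<in>?B. 1 - 1 * fls_X ^ j))"
      using n(2) by (auto simp: vanishes_below_def)
    moreover have "?S \<inter> {..N} \<subseteq> ?B"
    proof
      fix j assume "j \<in> ?S \<inter> {..N}"
      then obtain i where i: "j = k * i" "i > 0" "j \<le> N" by auto
      moreover have "i \<le> k * i" using assms by simp
      ultimately have "i - 1 \<le> n" using n(1) by linarith
      moreover have "j = k * Suc (i - 1)" using i by simp
      ultimately have "j = k * Suc (i - 1)" "i - 1 \<le> n" by blast+
      then show "j \<in> ?B" by blast
    qed
    ultimately show "\<exists>B. finite B \<and> B \<subseteq> ?S \<and> ?S \<inter> {..N} \<subseteq> B \<and> vanishes_below (int N) (fps_to_fls (J k) - (\<Prod>j\<in>B. 1 - 1 * fls_X ^ j))"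
      using assms by (intro exI[of _ ?B]) (auto simp del: mult_Suc_right)
  qed auto
  then show ?thesis by (simp add: qprod_def)
qed

section \<open>Partial fractions at the nodes $q^k$\<close>

text \<open>\<open>P\<close> is the Lagrange interpolant of \<open>p\<close>. The difference has
  degree below the number of nodes and vanishes at all of them, so P = p; dividing the value at z by
  the node polynomial gives the partial fractions.\<close>

lemma lagrange_partial_fractions:
  fixes x :: "'i \<Rightarrow> 'a::field"
  assumes "finite I" "inj_on x I" "degree p < card I" "\<And>i. i \<in> I \<Longrightarrow> z \<noteq> x i"
  shows "(\<Sum>i\<in>I. poly p (x i) / ((z - x i) * (\<Prod>j\<in>I-{i}. x i - x j))) = poly p z / (\<Prod>j\<in>I. z - x j)"
proof -
  define c where "c i = poly p (x i) / (\<Prod>j\<in>I-{i}. x i - x j)" for i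
  define P where "P = (\<Sum>i\<in>I. smult (c i) (\<Prod>j\<in>I-{i}. [:- x j, 1:]))"
  have nz: "(\<Prod>j\<in>I-{i}. x i - x j) \<noteq> 0" if "i \<in> I" for i
    using assms that by (auto simp: inj_on_def)
  have polyP: "poly P y = (\<Sum>i\<in>I. c i * (\<Prod>j\<in>I-{i}. y - x j))" for y
    by (simp add: P_def poly_sum poly_prod)
  have root: "poly (p - P) (x k) = 0" if "k \<in> I" for k
  proof -
    have "poly P (x k) = (\<Sum>i\<in>{k}. c i * (\<Prod>j\<in>I-{i}. x k - x j))"
      unfolding polyP using assms that by (intro sum.mono_neutral_right) auto
    then show ?thesis using nz[OF that] by (simp add: c_def)
  qed
  have "degree (p - P) < card I"
  proof -
    have "degree (smult (c i) (\<Prod>j\<in>I-{i}. [:- x j, 1:])) < card I" if "i \<in> I" for i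
    proof -
      have "degree (smult (c i) (\<Prod>j\<in>I-{i}. [:- x j, 1:])) \<le> degree (\<Prod>j\<in>I-{i}. [:- x j, 1:])"
        by (rule degree_smult_le)
      also have "\<dots> \<le> (\<Sum>j\<in>I-{i}. degree [:- x j, 1:])"
        using degree_prod_sum_le[of "I - {i}" "\<lambda>j. [:- x j, 1:]"] assms(1) by (simp add: o_def)
      also have "\<dots> = card I - 1" using that assms(1) by simp
      finally show ?thesis using that assms(1,3) by linarith
    qed
    then have "degree P < card I"
      unfolding P_def using assms(1,3) by (intro degree_sum_less) auto
    then show ?thesis using assms(3) degree_diff_less by blast
  qed
  moreover have "card (x ` I) = card I" using assms(2) by (rule card_image)
  moreover have "card (x ` I) \<le> card {y. poly (p - P) y = 0}" if "p - P \<noteq> 0"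
    using root poly_roots_finite[OF that] by (intro card_mono) auto
  ultimately have "p - P = 0"
    using card_poly_roots_bound[of "p - P"] by linarith
  then have "poly p z = poly P z" by simp
  also have "\<dots> = (\<Sum>i\<in>I. c i * ((\<Prod>j\<in>I. z - x j) / (z - x i)))"
    unfolding polyP using assms by (intro sum.cong refl) (subst prod.remove[of I], auto)
  finally have "poly p z / (\<Prod>j\<in>I. z - x j) = (\<Sum>i\<in>I. c i * ((\<Prod>j\<in>I. z - x j) / (z - x i)) / (\<Prod>j\<in>I. z - x j))"
    by (simp only: sum_divide_distrib)
  moreover have "(\<Prod>j\<in>I. z - x j) \<noteq> 0" using assms by auto
  ultimately show ?thesis by (simp add: c_def mult.commute)
qed

text \<open>The constant coefficient is 1, or 2 when k = 0; characteristic 0 excludes 2 = 0.\<close>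

lemma one_plus_X_powi_nonzero [simp]: "1 + fls_X powi k \<noteq> (0 :: 'a::field_char_0 fls)"
proof
  assume "1 + fls_X powi k = (0 :: 'a fls)"
  then have "(1 + fls_X powi k :: 'a fls) $$ 0 = 0" by simp
  then show False by (auto simp: fls_X_power_int split: if_splits)
qed

lemma fls_X_powi_eq_iff [simp]: "fls_X powi k = (fls_X powi l :: 'a::field fls) \<longleftrightarrow> k = l"
  by (metis fls_subdegree_power_int fls_X_subdegree mult.right_neutral mult_1)

text \<open>The sign and the power of \<open>q\<close> that remain of the Lagrange weight at the node \<open>q\<^sup>k\<close> when each difference
  of nodes is replaced by \<open>1 - q\<^bsup>|k-j|\<^esup>\<close>.\<close>

definition node_weight :: "int set \<Rightarrow> int \<Rightarrow> 'a::field fls" where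
  "node_weight A k = (if k < 0 then - 1 else 1) *
     (\<Prod>j\<in>{j\<in>A. 0 \<le> j \<and> j < k \<or> k < j \<and> j < 0}. - (fls_X powi \<bar>k - j\<bar>))"

text \<open>From q^k - q^j take out q^k when j >= 0 and -q^j when j < 0. What remains is 1 -
  q^|k-j|, divided by -q^|k-j| when 0 <= j < k or k < j < 0; these divisors form the weight. The
  factor q^k occurs once per nonnegative node, hence the power on the left, and the factors of the
  negative nodes form \<open>V\<close>, which does not depend on k.\<close>

lemma node_product:
  fixes k :: int
  assumes A: "finite A" "k \<in> A"
  defines "V \<equiv> (\<Prod>j\<in>{j\<in>A. j < 0}. - (fls_X powi j)) :: 'a::field fls"
  shows "(fls_X powi k) ^ card {j\<in>A. j \<ge> 0} / (\<Prod>j\<in>A-{k}. fls_X powi k - fls_X powi j) =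
     fls_X powi k * node_weight A k / (V * (\<Prod>j\<in>A-{k}. 1 - fls_X powi \<bar>k - j\<bar>))"
proof -
  let ?X = "\<lambda>j. fls_X powi j :: 'a fls"
  define u where "u j = (if j \<ge> 0 then ?X k else - ?X j)" for j
  define g where "g j = (if 0 \<le> j \<and> j < k \<or> k < j \<and> j < 0 then - ?X \<bar>k - j\<bar> else 1)" for j
  have "(?X k - ?X j) * g j = u j * (1 - ?X \<bar>k - j\<bar>)" if "j \<noteq> k" for j
  proof -
    have "?X k * ?X (j - k) = ?X j" "?X k * ?X (k - j) * ?X j = ?X k * ?X k" "?X j * ?X (k - j) = ?X k"
      by (simp_all flip: power_int_add)
    moreover have "?X j * ?X (j - k) * ?X k = ?X j * ?X j" by (simp flip: power_int_add)
    ultimately show ?thesis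
      using that by (auto simp: u_def g_def abs_if algebra_simps)
  qed
  then have "(\<Prod>j\<in>A-{k}. (?X k - ?X j) * g j) = (\<Prod>j\<in>A-{k}. u j * (1 - ?X \<bar>k - j\<bar>))"
    by (intro prod.cong) auto
  then have 1: "(\<Prod>j\<in>A-{k}. ?X k - ?X j) * prod g (A - {k}) = prod u (A - {k}) * (\<Prod>j\<in>A-{k}. 1 - ?X \<bar>k - j\<bar>)"
    by (simp add: prod.distrib)
  have "prod g (A - {k}) = (\<Prod>j\<in>{j\<in>A. 0 \<le> j \<and> j < k \<or> k < j \<and> j < 0}. - ?X \<bar>k - j\<bar>)"
    using A by (intro prod.mono_neutral_cong_right) (auto simp: g_def)
  then have 2: "node_weight A k = (if k < 0 then - 1 else 1) * prod g (A - {k})"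
    by (simp add: node_weight_def)
  have "prod u A = prod u {j\<in>A. j \<ge> 0} * prod u {j\<in>A. j < 0}"
    using A by (subst prod.union_disjoint[symmetric]) (auto intro!: prod.cong)
  also have "prod u {j\<in>A. j \<ge> 0} = ?X k ^ card {j\<in>A. j \<ge> 0}"
    by (simp add: u_def)
  also have "prod u {j\<in>A. j < 0} = V"
    unfolding V_def by (intro prod.cong) (auto simp: u_def)
  finally have 3: "u k * prod u (A - {k}) = ?X k ^ card {j\<in>A. j \<ge> 0} * V"
    using A by (subst prod.remove[symmetric]) auto
  have uk: "u k = (if k < 0 then - 1 else 1) * ?X k" by (simp add: u_def)
  have nz: "V \<noteq> 0" "(\<Prod>j\<in>A-{k}. ?X k - ?X j) \<noteq> 0" using A by (auto simp: V_def)
  have "(1 :: 'a fls) - ?X \<bar>k - j\<bar> \<noteq> 0" if "j \<noteq> k" for j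
    using fls_X_powi_eq_iff[of 0 "\<bar>k - j\<bar>"] that by auto
  then have nz': "(\<Prod>j\<in>A-{k}. 1 - ?X \<bar>k - j\<bar>) \<noteq> 0" using A by auto
  have "?X k * node_weight A k * (\<Prod>j\<in>A-{k}. ?X k - ?X j) =
      u k * ((\<Prod>j\<in>A-{k}. ?X k - ?X j) * prod g (A - {k}))"
    by (simp add: uk 2 mult_ac)
  also have "\<dots> = u k * prod u (A - {k}) * (\<Prod>j\<in>A-{k}. 1 - ?X \<bar>k - j\<bar>)"
    by (simp add: 1 mult.assoc)
  also have "\<dots> = ?X k ^ card {j\<in>A. j \<ge> 0} * (V * (\<Prod>j\<in>A-{k}. 1 - ?X \<bar>k - j\<bar>))"
    by (simp add: 3 mult.assoc)
  finally show ?thesis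
    using nz nz' by (subst frac_eq_eq) auto
qed

lemma prod_minus_one_minus_nodes:
  assumes "finite A"
  shows "(\<Prod>j\<in>A. - 1 - fls_X powi j) =
    (- 1) ^ card {j\<in>A. j \<ge> 0} * (\<Prod>j\<in>{j\<in>A. j < 0}. - (fls_X powi j)) * (\<Prod>j\<in>A. 1 + (fls_X powi \<bar>j\<bar> :: 'a::field fls))"
proof -
  let ?X = "\<lambda>j. fls_X powi j :: 'a fls"
  have "(\<Prod>j\<in>A. - 1 - ?X j) = (\<Prod>j\<in>A. (if j \<ge> 0 then - 1 else 1) * (if j < 0 then - ?X j else 1) * (1 + ?X \<bar>j\<bar>))"
    by (intro prod.cong refl) (auto simp: algebra_simps simp flip: power_int_add)
  also have "\<dots> = (\<Prod>j\<in>A. if j \<ge> 0 then - 1 else 1) * (\<Prod>j\<in>A. if j < 0 then - ?X j else 1) * (\<Prod>j\<in>A. 1 + ?X \<bar>j\<bar>)"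
    by (simp add: prod.distrib)
  also have "(\<Prod>j\<in>A. if j \<ge> 0 then - 1 else 1) = (\<Prod>j\<in>{j\<in>A. j \<ge> 0}. - 1 :: 'a fls)"
    using assms by (intro prod.mono_neutral_cong_right) auto
  also have "(\<Prod>j\<in>A. if j < 0 then - ?X j else 1) = (\<Prod>j\<in>{j\<in>A. j < 0}. - ?X j)"
    using assms by (intro prod.mono_neutral_cong_right) auto
  finally show ?thesis by simp
qed

text \<open>Interpolate the monomial x^(a-1) at -1, with a the number of nonnegative nodes: the
  powers of q^k from \<open>node_product\<close> cancel, and the remaining weight sees only the
  nodes between 0 and k. This is what makes infinite node sets possible. The monomial x^a gives the
  same sum with an extra q^k and the value -1/Q; adding the two removes the denominator 1 + q^k. Its
  degree is admissible as soon as some node is negative.\<close>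

lemma finite_node_sum:
  fixes A :: "int set"
  assumes "finite A" "\<exists>j\<in>A. j \<ge> 0"
  shows "(\<Sum>k\<in>A. node_weight A k / ((1 + fls_X powi k) * (\<Prod>j\<in>A-{k}. 1 - fls_X powi \<bar>k - j\<bar>))) =
     1 / (\<Prod>j\<in>A. 1 + (fls_X powi \<bar>j\<bar> :: 'a::field_char_0 fls))"
    and "\<exists>j\<in>A. j < 0 \<Longrightarrow>
      (\<Sum>k\<in>A. node_weight A k / (\<Prod>j\<in>A-{k}. 1 - fls_X powi \<bar>k - j\<bar>)) = (0 :: 'a fls)"
proof -
  let ?X = "\<lambda>j. fls_X powi j :: 'a fls"
  define a where "a = card {j\<in>A. j \<ge> 0}"
  define V where "V = (\<Prod>j\<in>{j\<in>A. j < 0}. - ?X j)"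
  define Q where "Q = (\<Prod>j\<in>A. 1 + ?X \<bar>j\<bar>)"
  define P where "P k = (\<Prod>j\<in>A-{k}. 1 - ?X \<bar>k - j\<bar>)" for k
  have a0: "a > 0" using assms by (auto simp: a_def card_gt_0_iff)
  have V0: "V \<noteq> 0" using assms by (simp add: V_def)
  have inj: "inj_on ?X A" by (auto simp: inj_on_def)
  have z: "- 1 \<noteq> ?X j" for j
    using one_plus_X_powi_nonzero[of j, where 'a = 'a] by (metis add.right_inverse)
  have node: "?X k ^ a / (\<Prod>j\<in>A-{k}. ?X k - ?X j) = ?X k * node_weight A k / (V * P k)" if "k \<in> A" for k
    unfolding a_def V_def P_def by (rule node_product) (use assms that in auto)
  have neg: "- 1 - ?X k = - (1 + ?X k)" for k by simp
  have sgn: "- V * (x / (- c * d)) = V / c * (x / d)" for x c d by simp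
  have lag: "(\<Sum>k\<in>A. ?X k ^ L / ((- 1 - ?X k) * (\<Prod>j\<in>A-{k}. ?X k - ?X j))) = (- 1) ^ L / ((- 1) ^ a * V * Q)" if "L < card A" for L
    using lagrange_partial_fractions[OF assms(1) inj, of "monom 1 L" "- 1"] that z
    by (simp add: degree_monom_eq poly_monom prod_minus_one_minus_nodes[OF assms(1)] a_def V_def Q_def)
  have "(\<Sum>k\<in>A. node_weight A k / ((1 + ?X k) * P k)) = - V * (\<Sum>k\<in>A. ?X k ^ (a - 1) / ((- 1 - ?X k) * (\<Prod>j\<in>A-{k}. ?X k - ?X j)))"
    unfolding sum_distrib_left
  proof (intro sum.cong refl)
    fix k assume "k \<in> A"
    have "?X k * (?X k ^ (a - 1) / (\<Prod>j\<in>A-{k}. ?X k - ?X j)) = ?X k * (node_weight A k / (V * P k))"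
      using node[OF \<open>k \<in> A\<close>] a0 by (simp add: power_eq_if)
    then have *: "?X k ^ (a - 1) / (\<Prod>j\<in>A-{k}. ?X k - ?X j) = node_weight A k / (V * P k)"
      by (rule mult_left_cancel[THEN iffD1, rotated]) simp
    have "- V * (?X k ^ (a - 1) / ((- 1 - ?X k) * (\<Prod>j\<in>A-{k}. ?X k - ?X j))) =
       V / (1 + ?X k) * (?X k ^ (a - 1) / (\<Prod>j\<in>A-{k}. ?X k - ?X j))"
      unfolding neg by (rule sgn)
    also have "\<dots> = node_weight A k / ((1 + ?X k) * P k)"
      unfolding * using V0 by simp
    finally show "node_weight A k / ((1 + ?X k) * P k) = - V * (?X k ^ (a - 1) / ((- 1 - ?X k) * (\<Prod>j\<in>A-{k}. ?X k - ?X j)))" ..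
  qed
  also have "\<dots> = - V * ((- 1) ^ (a - 1) / ((- 1) ^ a * V * Q))"
  proof (subst lag)
    have "a \<le> card A" unfolding a_def using assms by (intro card_mono) auto
    then show "a - 1 < card A" using a0 by linarith
  qed (rule refl)
  also have "\<dots> = 1 / Q"
  proof -
    have "(- 1) ^ a = - ((- 1) ^ (a - 1) :: 'a fls)" using a0 by (cases a) auto
    then show ?thesis using V0 by (cases "even (a - 1)") auto
  qed
  finally have den: "(\<Sum>k\<in>A. node_weight A k / ((1 + ?X k) * P k)) = 1 / Q" .
  then show "(\<Sum>k\<in>A. node_weight A k / ((1 + ?X k) * (\<Prod>j\<in>A-{k}. 1 - ?X \<bar>k - j\<bar>))) = 1 / (\<Prod>j\<in>A. 1 + ?X \<bar>j\<bar>)"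
    by (simp add: P_def Q_def)
  assume "\<exists>j\<in>A. j < 0"
  then obtain j where "j \<in> A" "j < 0" by blast
  then have "{j\<in>A. j \<ge> 0} \<subset> A" by force
  then have "a < card A" unfolding a_def using assms(1) by (intro psubset_card_mono)
  have "(\<Sum>k\<in>A. ?X k * node_weight A k / ((1 + ?X k) * P k)) = - V * (\<Sum>k\<in>A. ?X k ^ a / ((- 1 - ?X k) * (\<Prod>j\<in>A-{k}. ?X k - ?X j)))"
    unfolding sum_distrib_left
  proof (intro sum.cong refl)
    fix k assume "k \<in> A"
    have "- V * (?X k ^ a / ((- 1 - ?X k) * (\<Prod>j\<in>A-{k}. ?X k - ?X j))) =
       V / (1 + ?X k) * (?X k ^ a / (\<Prod>j\<in>A-{k}. ?X k - ?X j))"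
      unfolding neg by (rule sgn)
    also have "\<dots> = ?X k * node_weight A k / ((1 + ?X k) * P k)"
      unfolding node[OF \<open>k \<in> A\<close>] using V0 by simp
    finally show "?X k * node_weight A k / ((1 + ?X k) * P k) = - V * (?X k ^ a / ((- 1 - ?X k) * (\<Prod>j\<in>A-{k}. ?X k - ?X j)))" ..
  qed
  also have "\<dots> = - V * ((- 1) ^ a / ((- 1) ^ a * V * Q))"
    by (subst lag[OF \<open>a < card A\<close>]) (rule refl)
  also have "\<dots> = - 1 / Q" using V0 by simp
  finally have "(\<Sum>k\<in>A. node_weight A k / ((1 + ?X k) * P k)) + (\<Sum>k\<in>A. ?X k * node_weight A k / ((1 + ?X k) * P k)) = 0"
    using den by simp
  moreover have "node_weight A k / ((1 + ?X k) * P k) + ?X k * node_weight A k / ((1 + ?X k) * P k) = node_weight A k / P k" for k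
  proof -
    have "node_weight A k / ((1 + ?X k) * P k) + ?X k * node_weight A k / ((1 + ?X k) * P k) = (1 + ?X k) * node_weight A k / ((1 + ?X k) * P k)"
      by (simp only: add_divide_distrib[symmetric]) (simp add: algebra_simps)
    then show ?thesis by simp
  qed
  ultimately show "(\<Sum>k\<in>A. node_weight A k / (\<Prod>j\<in>A-{k}. 1 - ?X \<bar>k - j\<bar>)) = 0"
    by (simp add: P_def flip: sum.distrib)
qed

section \<open>Passage to infinite sets of nodes\<close>

definition gaps_above :: "int set \<Rightarrow> int \<Rightarrow> nat set" where
  "gaps_above A k = {d. d > 0 \<and> k + int d \<in> A}"

definition gaps_below :: "int set \<Rightarrow> int \<Rightarrow> nat set" where
  "gaps_below A k = {d. d > 0 \<and> k - int d \<in> A}"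

lemma zero_notin_gaps [simp]: "0 \<notin> gaps_above A k" "0 \<notin> gaps_below A k"
  by (simp_all add: gaps_above_def gaps_below_def)

text \<open>Cutting A off at N removes only nodes at distance more than N - |k| from k. With e = 1
  the product is a node denominator; with e = -1 and k = 0 it is the product of the 1 + q^|j| that
  belongs to the evaluation point -1, where 0 may or may not be a node.\<close>

lemma node_product_limit:
  fixes e :: "'a::field fls"
  assumes e: "vanishes_below 0 e" and k: "\<bar>k\<bar> \<le> int N"
  shows "vanishes_below (int N - \<bar>k\<bar> + 1) (qprod e (gaps_above A k) * qprod e (gaps_below A k) -
    (\<Prod>j\<in>A \<inter> {-int N..int N} - {k}. 1 - e * fls_X powi \<bar>k - j\<bar>))"
proof -
  let ?A = "A \<inter> {-int N..int N}"
  let ?B = "{d\<in>gaps_above A k. k + int d \<in> ?A}" and ?C = "{d\<in>gaps_below A k. k - int d \<in> ?A}"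
  define M where "M = nat (int N - \<bar>k\<bar>)"
  have finB: "finite ?B" by (rule finite_subset[of _ "{..nat (int N - k)}"]) auto
  have finC: "finite ?C" by (rule finite_subset[of _ "{..nat (int N + k)}"]) auto
  have "(\<Prod>j\<in>?A - {k}. 1 - e * fls_X powi \<bar>k - j\<bar>) =
    (\<Prod>j\<in>{j\<in>?A. j > k}. 1 - e * fls_X powi \<bar>k - j\<bar>) * (\<Prod>j\<in>{j\<in>?A. j < k}. 1 - e * fls_X powi \<bar>k - j\<bar>)"
    by (subst prod.union_disjoint[symmetric]) (auto intro!: prod.cong finite_subset[of _ "{-int N..int N}"])
  also have "(\<Prod>j\<in>{j\<in>?A. j > k}. 1 - e * fls_X powi \<bar>k - j\<bar>) = (\<Prod>d\<in>?B. 1 - e * fls_X ^ d)"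
    by (rule prod.reindex_bij_witness[of _ "\<lambda>d. k + int d" "\<lambda>j. nat (j - k)"]) (auto simp: gaps_above_def power_int_def)
  also have "(\<Prod>j\<in>{j\<in>?A. j < k}. 1 - e * fls_X powi \<bar>k - j\<bar>) = (\<Prod>d\<in>?C. 1 - e * fls_X ^ d)"
    by (rule prod.reindex_bij_witness[of _ "\<lambda>d. k - int d" "\<lambda>j. nat (k - j)"]) (auto simp: gaps_below_def power_int_def)
  finally have eq: "(\<Prod>j\<in>?A - {k}. 1 - e * fls_X powi \<bar>k - j\<bar>) = (\<Prod>d\<in>?B. 1 - e * fls_X ^ d) * (\<Prod>d\<in>?C. 1 - e * fls_X ^ d)" .
  have 1: "vanishes_below (int M + 1) (qprod e (gaps_above A k) - (\<Prod>d\<in>?B. 1 - e * fls_X ^ d))"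
    using finB k by (intro qprod_approx e) (auto simp: M_def gaps_above_def)
  have 2: "vanishes_below (int M + 1) (qprod e (gaps_below A k) - (\<Prod>d\<in>?C. 1 - e * fls_X ^ d))"
    using finC k by (intro qprod_approx e) (auto simp: M_def gaps_below_def)
  have "vanishes_below (int M + 1) (qprod e (gaps_above A k) * qprod e (gaps_below A k) -
      (\<Prod>d\<in>?B. 1 - e * fls_X ^ d) * (\<Prod>d\<in>?C. 1 - e * fls_X ^ d))"
  proof (rule vanishes_below_diff_mult[OF 1 2])
    show "vanishes_below 0 (\<Prod>d\<in>?B. 1 - e * fls_X ^ d)"
      by (intro unipotent_imp_integral unipotent_prod multipliable_unipotent[OF multipliable_qprod[OF e, of ?B]]) (auto simp: gaps_above_def)
    show "vanishes_below 0 (qprod e (gaps_below A k))"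
      by (intro unipotent_imp_integral qprod_unipotent e) auto
  qed
  then show ?thesis using k by (simp add: eq M_def)
qed

definition node_denominator :: "int set \<Rightarrow> int \<Rightarrow> 'a::field fls" where
  "node_denominator A k = qprod 1 (gaps_above A k) * qprod 1 (gaps_below A k)"

lemma node_denominator_unipotent: "unipotent (node_denominator A k)"
  unfolding node_denominator_def by (intro unipotent_mult qprod_unipotent) auto

lemma node_denominator_nonzero [simp]: "node_denominator A k \<noteq> 0"
  by (intro unipotent_nonzero node_denominator_unipotent)

text \<open>One factor is enough: if k lies beyond \<open>j0\<close> or \<open>j1\<close>, that node
  lies between 0 and k and contributes q to the power of its distance from k. Otherwise |k| <= j0 -
  j1, and only integrality is claimed.\<close>

lemma vanishes_below_node_weight:
  fixes A :: "int set"
  assumes j: "j0 \<in> A" "j0 \<ge> 0" "j1 \<in> A" "j1 < 0"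
  shows "vanishes_below (\<bar>k\<bar> - (j0 - j1)) (node_weight A k :: 'a::field fls)"
proof -
  let ?B = "{j\<in>A. 0 \<le> j \<and> j < k \<or> k < j \<and> j < 0}"
  let ?f = "\<lambda>j. - (fls_X powi \<bar>k - j\<bar>) :: 'a fls"
  have fin: "finite ?B" by (rule finite_subset[of _ "{-\<bar>k\<bar>..\<bar>k\<bar>}"]) auto
  have int: "vanishes_below 0 (prod ?f B)" for B
    by (induction B rule: infinite_finite_induct) (auto intro!: vanishes_below_int_mult)
  have sgn: "vanishes_below n (node_weight A k :: 'a fls) \<longleftrightarrow> vanishes_below n (prod ?f ?B)" for n
    by (simp add: node_weight_def)
  show ?thesis
  proof (cases "\<exists>j\<in>?B. \<bar>k\<bar> - (j0 - j1) \<le> \<bar>k - j\<bar>")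
    case True
    then obtain j where "j \<in> ?B" "\<bar>k\<bar> - (j0 - j1) \<le> \<bar>k - j\<bar>" by blast
    then have "prod ?f ?B = ?f j * prod ?f (?B - {j})" "vanishes_below (\<bar>k\<bar> - (j0 - j1)) (?f j)"
      by (simp_all add: prod.remove[OF fin])
    moreover from this have "vanishes_below (\<bar>k\<bar> - (j0 - j1)) (?f j * prod ?f (?B - {j}))"
      using int by (intro vanishes_below_mult_int)
    ultimately show ?thesis
      unfolding sgn by simp
  next
    case False
    then have "j0 \<notin> ?B" "j1 \<notin> ?B" using j by fastforce+
    then have "\<bar>k\<bar> - (j0 - j1) \<le> 0" using j by auto
    then show ?thesis
      unfolding sgn using int vanishes_below_mono by blast
  qed
qed

lemma node_weight_truncate:
  assumes "k \<in> {-int N..int N}"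
  shows "node_weight (A \<inter> {-int N..int N}) k = node_weight A k"
proof -
  have "{j\<in>A \<inter> {-int N..int N}. 0 \<le> j \<and> j < k \<or> k < j \<and> j < 0} = {j\<in>A. 0 \<le> j \<and> j < k \<or> k < j \<and> j < 0}"
    using assms by auto
  then show ?thesis by (simp add: node_weight_def)
qed

text \<open>For k < 0 no negative power arises because 1/(1 + q^k) = q^(-k)/(1 + q^(-k)); for k = 0
  the denominator is the unit 2.\<close>

lemma vanishes_below_inverse_one_plus_X_powi:
  "vanishes_below 0 (inverse (1 + fls_X powi k) :: 'a::field_char_0 fls)"
proof (cases "k = 0")
  case True
  then have "inverse (1 + fls_X powi k) = (inverse (fls_const 2) :: 'a fls)" by simp
  also have "\<dots> = fls_const (inverse 2)" by (rule fls_inverse_const)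
  finally show ?thesis by (simp add: vanishes_below_def)
next
  case False
  have pos: "vanishes_below 0 (inverse (1 + fls_X powi l) :: 'a fls)" if "l > 0" for l
    using that by (intro vanishes_below_inverse_unipotent unipotent_one_plus) simp
  show ?thesis
  proof (cases "k > 0")
    case False
    have "fls_X powi (- k) * (1 + fls_X powi k) = (1 + fls_X powi (- k) :: 'a fls)"
      by (simp add: algebra_simps flip: power_int_add)
    then have "inverse (1 + fls_X powi k) = fls_X powi (- k) * (inverse (1 + fls_X powi (- k)) :: 'a fls)"
      using one_plus_X_powi_nonzero[of k, where 'a = 'a] one_plus_X_powi_nonzero[of "- k", where 'a = 'a] by (simp add: field_simps)
    moreover have "vanishes_below 0 (fls_X powi (- k) * (inverse (1 + fls_X powi (- k)) :: 'a fls))"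
      using False \<open>k \<noteq> 0\<close> by (intro vanishes_below_int_mult pos) auto
    ultimately show ?thesis by simp
  qed (use pos in auto)
qed

text \<open>The limit of \<open>finite_node_sum\<close> over the truncations of A, which qualify
  once they contain the nonnegative node \<open>j0\<close> and the negative node \<open>j1\<close>.
  The factor 2 is 1 + q^0 for a node at 0, which the gap sets omit.\<close>

theorem node_sum:
  fixes A :: "int set"
  assumes j: "j0 \<in> A" "j0 \<ge> 0" "j1 \<in> A" "j1 < 0"
  shows "fsummable (\<lambda>k. node_weight A k / (1 + fls_X powi k) * inverse (node_denominator A k) :: 'a::field_char_0 fls) A"
      (is "fsummable (\<lambda>k. ?T k * ?U k) A")
    and "fsum (\<lambda>k. node_weight A k / (1 + fls_X powi k) * inverse (node_denominator A k)) A =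
      1 / ((if 0 \<in> A then 2 else 1) * (qprod (- 1) (gaps_above A 0) * qprod (- 1) (gaps_below A 0)) :: 'a fls)"
      (is "_ = ?R")
    and "fsummable (\<lambda>k. node_weight A k * inverse (node_denominator A k) :: 'a fls) A"
    and "fsum (\<lambda>k. node_weight A k * inverse (node_denominator A k)) A = (0 :: 'a fls)"
proof -
  let ?X = "\<lambda>j. fls_X powi j :: 'a fls"
  define V where "V N k = inverse (\<Prod>j\<in>A \<inter> {-int N..int N} - {k}. 1 - ?X \<bar>k - j\<bar>)" for N k
  define N0 where "N0 = nat (j0 - j1)"
  have unip: "unipotent (\<Prod>j\<in>B - {k}. 1 - ?X \<bar>k - j\<bar>)" for B k
    by (intro unipotent_prod unipotent_one_minus) auto
  have UV: "vanishes_below (int N - \<bar>k\<bar>) (?U k - V N k)" if "k \<in> A" "\<bar>k\<bar> \<le> int N" for k N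
  proof -
    have "vanishes_below (int N - \<bar>k\<bar>) (node_denominator A k - (\<Prod>j\<in>A \<inter> {-int N..int N} - {k}. 1 - ?X \<bar>k - j\<bar>))"
      using node_product_limit[of "1 :: 'a fls" k N A] that(2) unfolding node_denominator_def
      by (auto intro: vanishes_below_mono)
    then show ?thesis
      unfolding V_def by (intro vanishes_below_inverse_diff node_denominator_unipotent unip)
  qed
  have U0: "vanishes_below 0 (?U k)" for k
    by (intro vanishes_below_inverse_unipotent node_denominator_unipotent)
  have W: "vanishes_below (\<bar>k\<bar> - (j0 - j1)) (node_weight A k :: 'a fls)" for k
    by (rule vanishes_below_node_weight[OF j])
  have T: "vanishes_below (\<bar>k\<bar> - (j0 - j1)) (?T k)" for k
    unfolding divide_inverse by (intro vanishes_below_mult_int W vanishes_below_inverse_one_plus_X_powi)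
  have R: "vanishes_below (int N - (j0 - j1)) (?R - (\<Sum>k\<in>A \<inter> {-int N..int N}. ?T k * V N k))" if "N \<ge> N0" for N
  proof -
    let ?A = "A \<inter> {-int N..int N}"
    let ?c = "if 0 \<in> A then 2 else 1 :: 'a fls"
    let ?Q = "qprod (- 1) (gaps_above A 0) * qprod (- 1) (gaps_below A 0) :: 'a fls"
    let ?QN = "\<Prod>j\<in>?A - {0}. 1 + ?X \<bar>j\<bar>"
    have j': "j0 \<in> ?A" using j that by (auto simp: N0_def)
    have "(\<Sum>k\<in>?A. ?T k * V N k) = (\<Sum>k\<in>?A. node_weight ?A k / ((1 + ?X k) * (\<Prod>j\<in>?A-{k}. 1 - ?X \<bar>k - j\<bar>)))"
      by (intro sum.cong refl) (simp add: node_weight_truncate V_def divide_inverse mult_ac)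
    also have "\<dots> = 1 / (\<Prod>j\<in>?A. 1 + ?X \<bar>j\<bar>)"
      using j' j by (intro finite_node_sum) auto
    also have "(\<Prod>j\<in>?A. 1 + ?X \<bar>j\<bar>) = ?c * ?QN"
      by (cases "0 \<in> ?A") (auto simp: prod.remove[of ?A 0])
    finally have "(\<Sum>k\<in>?A. ?T k * V N k) = 1 / (?c * ?QN)" .
    then have eq: "?R - (\<Sum>k\<in>?A. ?T k * V N k) = inverse ?c * (inverse ?Q - inverse ?QN)"
      by (simp add: divide_inverse algebra_simps)
    have "vanishes_below (int N) (?Q - ?QN)"
      using node_product_limit[of "- 1 :: 'a fls" 0 N A] by (auto intro: vanishes_below_mono)
    moreover have "unipotent ?Q" by (intro unipotent_mult qprod_unipotent) auto
    moreover have "unipotent ?QN" by (intro unipotent_prod unipotent_one_plus) auto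
    ultimately have "vanishes_below (int N) (inverse ?Q - inverse ?QN)"
      by (rule vanishes_below_inverse_diff)
    moreover have "vanishes_below 0 (inverse ?c)"
      using vanishes_below_inverse_one_plus_X_powi[of 0, where 'a = 'a] by auto
    ultimately have "vanishes_below (int N) (?R - (\<Sum>k\<in>?A. ?T k * V N k))"
      unfolding eq by (intro vanishes_below_int_mult)
    then show ?thesis using j by (auto intro: vanishes_below_mono)
  qed
  show "fsummable (\<lambda>k. ?T k * ?U k) A" by (rule fsum_limit(1)[OF T UV U0 R])
  show "fsum (\<lambda>k. ?T k * ?U k) A = ?R" by (rule fsum_limit(2)[OF T UV U0 R])
  have R': "vanishes_below (int N - (j0 - j1)) (0 - (\<Sum>k\<in>A \<inter> {-int N..int N}. node_weight A k * V N k))" if "N \<ge> N0" for N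
  proof -
    let ?A = "A \<inter> {-int N..int N}"
    have j': "j0 \<in> ?A" "j1 \<in> ?A" using j that by (auto simp: N0_def)
    have "(\<Sum>k\<in>?A. node_weight A k * V N k) = (\<Sum>k\<in>?A. node_weight ?A k / (\<Prod>j\<in>?A-{k}. 1 - ?X \<bar>k - j\<bar>))"
      by (intro sum.cong refl) (simp add: node_weight_truncate V_def divide_inverse mult_ac)
    also have "\<dots> = 0"
      using j' j by (intro finite_node_sum(2)) auto
    finally show ?thesis by simp
  qed
  show "fsummable (\<lambda>k. node_weight A k * ?U k) A" by (rule fsum_limit(1)[OF W UV U0 R'])
  show "fsum (\<lambda>k. node_weight A k * ?U k) A = 0" by (rule fsum_limit(2)[OF W UV U0 R'])
qed

section \<open>Watson's formula and the pentagonal number theorem\<close>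

lemma fsum_mono_neutral:
  assumes "B \<subseteq> A" "\<And>i. i \<in> A - B \<Longrightarrow> F i = 0"
  shows "fsum F A = fsum F B"
proof -
  have "{i\<in>A. F i $$ m \<noteq> 0} = {i\<in>B. F i $$ m \<noteq> 0}" for m
    using assms by force
  then show ?thesis by (simp add: fsum_def)
qed

definition alt :: "int \<Rightarrow> 'a::ring_1" where
  "alt k = (if even k then 1 else - 1)"

lemma alt_0 [simp]: "alt 0 = 1" and alt_1 [simp]: "alt 1 = - 1"
  by (simp_all add: alt_def)

lemma alt_minus [simp]: "alt (- k) = alt k"
  by (simp add: alt_def)

lemma alt_nonzero [simp]: "alt k \<noteq> (0 :: 'a::ring_1_no_zero_divisors)"
  by (simp add: alt_def)

lemma vanishes_below_alt_mult [simp]: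
  "vanishes_below n (alt k * f) \<longleftrightarrow> vanishes_below n (f :: 'a::field fls)"
  by (simp add: alt_def)

lemma vanishes_below_alt [simp]: "vanishes_below 0 (alt k :: 'a::field fls)"
  by (simp add: alt_def)

lemma fls_compose_power_alt [simp]: "d > 0 \<Longrightarrow> fls_compose_power (alt k :: 'a::field fls) d = alt k"
  by (simp add: alt_def)

section \<open>Bailey's lemma in the limit\<close>

definition qfac :: "nat \<Rightarrow> 'a::field fls" where
  "qfac n = (\<Prod>i\<in>{1..n}. 1 - fls_X ^ i)"

lemma qfac_0 [simp]: "qfac 0 = 1"
  by (simp add: qfac_def)

lemma qfac_Suc: "qfac (Suc n) = qfac n * (1 - fls_X ^ Suc n)"
  unfolding qfac_def by (subst prod.nat_ivl_Suc') (auto simp: mult.commute)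

lemma unipotent_one_minus_X_power: "n > 0 \<Longrightarrow> unipotent (1 - fls_X ^ n)"
  by (intro unipotent_one_minus) simp

lemma qfac_unipotent: "unipotent (qfac n)"
  unfolding qfac_def by (intro unipotent_prod unipotent_one_minus_X_power) auto

lemma qfac_nonzero [simp]: "qfac n \<noteq> 0"
  by (intro unipotent_nonzero qfac_unipotent)

lemma euler_approx: "vanishes_below (int n + 1) (qprod 1 {0<..} - qfac n :: 'a::field fls)"
proof -
  have "vanishes_below (int n + 1) (qprod 1 {0<..} - (\<Prod>j\<in>{1..n}. 1 - 1 * fls_X ^ j) :: 'a::field fls)"
    by (rule qprod_approx) auto
  then show ?thesis by (simp add: qfac_def)
qed

text \<open>Splitting partitions by their Durfee rectangle of excess k shows that the sum
  \<open>D k\<close> must not depend on k. Analytically, D k - D (k+1) is -q^(k+1) times the next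
  difference, hence divisible by every power of q; for growing k only the term m = 0
  survives.\<close>

lemma durfee_rectangle_sum:
  shows "fsummable (\<lambda>m. fls_X ^ (m * m + k * m) * inverse (qfac m * qfac (m + k)) :: 'a::field fls) UNIV"
    and "fsum (\<lambda>m. fls_X ^ (m * m + k * m) * inverse (qfac m * qfac (m + k))) UNIV = (inverse (qprod 1 {0<..}) :: 'a fls)"
proof -
  define t :: "nat \<Rightarrow> nat \<Rightarrow> 'a fls" where "t k m = fls_X ^ (m * m + k * m) * inverse (qfac m * qfac (m + k))" for k m
  define D where "D k = fsum (t k) UNIV" for k
  have vt: "vanishes_below (int (m * m + k * m)) (t k m)" for k m
    unfolding t_def
    by (intro vanishes_below_mult_int vanishes_below_inverse_unipotent unipotent_mult qfac_unipotent) simp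
  have st: "fsummable (t k) UNIV" for k
  proof (rule fsummableI_nat)
    fix m show "vanishes_below (int m) (t k m)"
      by (rule vanishes_below_mono[OF vt]) (cases m, auto)
  qed
  then show "fsummable (\<lambda>m. fls_X ^ (m * m + k * m) * inverse (qfac m * qfac (m + k)) :: 'a fls) UNIV"
    using st[of k] by (simp only: t_def[abs_def])
  have D0: "vanishes_below 0 (D k)" for k
    using fsum_approx[OF st, of "{}" 0 k] vanishes_below_mono[OF vt] by (auto simp: D_def)
  have rec: "D k - D (Suc k) = fls_X ^ Suc k * (D (Suc (Suc k)) - D (Suc k))" for k
  proof -
    \<comment> \<open>The summands of D (k+2), multiplied by q^(k+1) and shifted by one index. They
      arise when 1 - q^m is cancelled against the q-factorial of m.\<close>
    define A where "A m = (if m = 0 then 0 else fls_X ^ Suc k * t (Suc (Suc k)) (m - 1))" for m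
    have AS: "(\<lambda>m. A (Suc m)) = (\<lambda>m. fls_X ^ Suc k * t (Suc (Suc k)) m)" by (simp add: A_def)
    have eq: "t k m - t (Suc k) m = A m - fls_X ^ Suc k * t (Suc k) m" for m
    proof -
      have *: "t k m - t (Suc k) m = fls_X ^ (m * m + k * m) * (1 - fls_X ^ m) * inverse (qfac m * qfac (Suc (m + k)))
                  - fls_X ^ Suc k * t (Suc k) m"
      proof -
        have "qfac (Suc (m + k)) = qfac (m + k) * (1 - fls_X ^ Suc (m + k) :: 'a fls)" by (rule qfac_Suc)
        moreover have "(1 - fls_X ^ Suc (m + k) :: 'a fls) \<noteq> 0"
          by (intro unipotent_nonzero unipotent_one_minus_X_power) simp
        ultimately have "inverse (qfac (m + k)) = (1 - fls_X ^ Suc (m + k)) * (inverse (qfac (Suc (m + k))) :: 'a fls)"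
          by (simp add: field_simps)
        moreover have "fls_X ^ Suc (m + k) = (fls_X ^ Suc k * fls_X ^ m :: 'a fls)"
          by (subst power_add[symmetric]) (simp add: add.commute)
        moreover have "fls_X ^ (m * m + Suc k * m) = (fls_X ^ (m * m + k * m) * fls_X ^ m :: 'a fls)"
          by (subst power_add[symmetric]) (simp add: algebra_simps)
        ultimately show ?thesis
          unfolding t_def by (simp only: inverse_mult_distrib add_Suc_right) (simp only: algebra_simps)
      qed
      have "fls_X ^ (m * m + k * m) * (1 - fls_X ^ m) * inverse (qfac m * qfac (Suc (m + k))) = A m"
      proof (cases m)
        case (Suc n)
        have "(1 - fls_X ^ Suc n :: 'a fls) \<noteq> 0" by (intro unipotent_nonzero unipotent_one_minus_X_power) simp
        then have "(1 - fls_X ^ m) * inverse (qfac m) = (inverse (qfac n) :: 'a fls)"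
          by (simp add: Suc qfac_Suc field_simps del: power_Suc)
        moreover have "A m = fls_X ^ (m * m + k * m) * inverse (qfac n * qfac (Suc (m + k)))"
          by (simp add: A_def t_def Suc algebra_simps flip: power_add power_Suc)
        ultimately show ?thesis by (simp add: mult.assoc)
      qed (simp add: A_def)
      with * show ?thesis by simp
    qed
    have sA: "fsummable (A \<circ> Suc) UNIV" "fsum (A \<circ> Suc) UNIV = fls_X ^ Suc k * D (Suc (Suc k))"
      unfolding comp_def AS D_def by (rule fsummable_cmult[OF st], rule fsum_cmult[OF st])
    have "fsummable A (range Suc)" using sA(1) by (subst fsummable_reindex) auto
    then have "fsummable A ({0} \<union> range Suc)"
      using fsummable_UN[of UNIV A "\<lambda>b. if b then {0} else range Suc"] by (auto simp: UNIV_bool)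
    moreover have U: "{0} \<union> range Suc = UNIV" using not0_implies_Suc by blast
    ultimately have sA': "fsummable A UNIV" by simp
    have "fsum A UNIV = fsum A (range Suc)"
      using U by (intro fsum_mono_neutral) (auto simp: A_def dest!: gr0_implies_Suc)
    also have "\<dots> = fls_X ^ Suc k * D (Suc (Suc k))"
      using sA(2) by (subst fsum_reindex) auto
    finally have fA: "fsum A UNIV = fls_X ^ Suc k * D (Suc (Suc k))" .
    have "D k - D (Suc k) = fsum (\<lambda>m. A m - fls_X ^ Suc k * t (Suc k) m) UNIV"
      unfolding D_def by (subst fsum_diff[OF st st, symmetric]) (simp only: eq)
    also have "\<dots> = fls_X ^ Suc k * D (Suc (Suc k)) - fls_X ^ Suc k * D (Suc k)"
      using fA by (simp add: fsum_diff[OF sA' fsummable_cmult[OF st]] fsum_cmult[OF st] D_def)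
    finally show ?thesis by (simp add: right_diff_distrib)
  qed
  have "vanishes_below (int n) (D k - D (Suc k))" for n k
  proof (induction n arbitrary: k)
    case 0
    then show ?case using D0 by (simp add: vanishes_below_diff)
  next
    case (Suc n)
    have "vanishes_below (1 + int n) (fls_X ^ Suc k * (D (Suc (Suc k)) - D (Suc k)))"
      using Suc.IH[of "Suc k"] by (intro vanishes_below_mult) (auto simp: vanishes_below_minus_commute simp del: power_Suc)
    then show ?case by (simp add: rec del: power_Suc)
  qed
  then have "D k = D (Suc k)" for k by (intro vanishes_below_eqI[where c = 0]) simp
  then have const: "D 0 = D k" for k by (induction k) simp_all
  have "D 0 = inverse (qprod 1 {0<..})"
  proof (rule vanishes_below_eqI[where c = 0])
    fix n :: nat
    have "vanishes_below (int n) (D n - sum (t n) {0})"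
      unfolding D_def
    proof (rule fsum_approx[OF st])
      fix m :: nat assume "m \<in> UNIV - {0}"
      then show "vanishes_below (int n) (t n m)"
        by (intro vanishes_below_mono[OF vt]) (cases m, auto)
    qed auto
    moreover have "sum (t n) {0} = inverse (qfac n)" by (simp add: t_def)
    moreover have "vanishes_below (int n) (inverse (qfac n) - inverse (qprod 1 {0<..}) :: 'a fls)"
      using vanishes_below_mono[OF euler_approx, of "int n" n]
      by (intro vanishes_below_inverse_diff qfac_unipotent qprod_unipotent) (auto simp: vanishes_below_minus_commute)
    ultimately show "vanishes_below (int n - 0) (D 0 - inverse (qprod 1 {0<..}))"
      using const[of n] by (auto intro: vanishes_below_trans)
  qed
  with const[of k] show "fsum (\<lambda>m. fls_X ^ (m * m + k * m) * inverse (qfac m * qfac (m + k))) UNIV = (inverse (qprod 1 {0<..}) :: 'a fls)"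
    by (simp only: D_def t_def[abs_def])
qed

text \<open>Bailey's lemma at a = 1 with both parameters sent to infinity, for a two-sided sequence.
  After the interchange, the inner sum over n >= |r| is a Durfee rectangle sum with k =
  2|r|.\<close>

lemma bailey_limit:
  fixes \<alpha> :: "int \<Rightarrow> 'a::field fls"
  assumes \<alpha>: "\<And>r. vanishes_below 0 (\<alpha> r)"
  shows "fsum (\<lambda>n. fls_X ^ (n * n) * (\<Sum>r\<in>{-int n..int n}. \<alpha> r * inverse (qfac (nat (int n - r)) * qfac (nat (int n + r))))) UNIV =
    fsum (\<lambda>r. \<alpha> r * fls_X powi (r * r)) UNIV * inverse (qprod 1 {0<..})"
proof -
  define F where "F n r = fls_X ^ (n * n) * (\<alpha> r * inverse (qfac (nat (int n - r)) * qfac (nat (int n + r))))" for n r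
  have vF: "vanishes_below (int (n * n)) (F n r)" for n r
    unfolding F_def
    by (intro vanishes_below_mult_int \<alpha> vanishes_below_inverse_unipotent unipotent_mult qfac_unipotent) simp
  have summ: "fsummable (\<lambda>(n, r). F n r) {(n, r). n \<in> UNIV \<and> r \<in> UNIV \<and> \<bar>r\<bar> \<le> int n}"
    unfolding fsummable_def
  proof
    fix m
    have "{p \<in> {(n, r). n \<in> UNIV \<and> r \<in> UNIV \<and> \<bar>r\<bar> \<le> int n}. \<not> vanishes_below m (case p of (n, r) \<Rightarrow> F n r)}
        \<subseteq> {..nat m} \<times> {-\<bar>m\<bar>..\<bar>m\<bar>}"
    proof clarsimp
      fix n r assume *: "\<bar>r\<bar> \<le> int n" "\<not> vanishes_below m (F n r)"
      then have "\<not> m \<le> int (n * n)" using vanishes_below_mono[OF vF] by blast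
      moreover have "int n \<le> int (n * n)" by (cases n) auto
      ultimately have "int n \<le> m" by linarith
      with * show "n \<le> nat m \<and> - \<bar>m\<bar> \<le> r \<and> r \<le> \<bar>m\<bar>" by auto
    qed
    then show "finite {p \<in> {(n, r). n \<in> UNIV \<and> r \<in> UNIV \<and> \<bar>r\<bar> \<le> int n}. \<not> vanishes_below m (case p of (n, r) \<Rightarrow> F n r)}"
      by (rule finite_subset) simp
  qed
  have inner: "fsum (\<lambda>n. F n r) {n\<in>UNIV. \<bar>r\<bar> \<le> int n} = inverse (qprod 1 {0<..}) * (\<alpha> r * fls_X powi (r * r))" for r
  proof -
    define s where "s = nat \<bar>r\<bar>"
    have bij: "bij_betw (\<lambda>m. m + s) UNIV {n\<in>UNIV. \<bar>r\<bar> \<le> int n}"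
      by (rule bij_betwI[where g = "\<lambda>n. n - s"]) (auto simp: s_def)
    have "fsum (\<lambda>n. F n r) {n\<in>UNIV. \<bar>r\<bar> \<le> int n} = fsum (\<lambda>m. F (m + s) r) UNIV"
      by (rule fsum_reindex_bij[OF bij])
    also have "\<dots> = fsum (\<lambda>m. (\<alpha> r * fls_X powi (r * r)) * (fls_X ^ (m * m + 2 * s * m) * inverse (qfac m * qfac (m + 2 * s)))) UNIV"
    proof (rule fsum_cong[OF refl])
      fix m
      have "qfac (nat (int (m + s) - r)) * qfac (nat (int (m + s) + r)) = (qfac m * qfac (m + 2 * s) :: 'a fls)"
      proof (cases "r \<ge> 0")
        case True
        then have "nat (int (m + s) - r) = m" "nat (int (m + s) + r) = m + 2 * s" by (auto simp: s_def)
        then show ?thesis by simp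
      next
        case False
        then have "nat (int (m + s) - r) = m + 2 * s" "nat (int (m + s) + r) = m" by (auto simp: s_def)
        then show ?thesis by (simp add: mult.commute)
      qed
      moreover have "fls_X powi (r * r) * fls_X ^ (m * m + 2 * s * m) = (fls_X ^ ((m + s) * (m + s)) :: 'a fls)"
      proof -
        have "int s * int s = r * r" by (simp add: s_def flip: abs_mult)
        then have "fls_X powi (r * r) = (fls_X ^ (s * s) :: 'a fls)"
          by (simp flip: power_int_of_nat)
        moreover have "(m + s) * (m + s) = s * s + (m * m + 2 * s * m)" by (simp add: algebra_simps)
        ultimately show ?thesis by (simp only: power_add)
      qed
      ultimately show "F (m + s) r = (\<alpha> r * fls_X powi (r * r)) * (fls_X ^ (m * m + 2 * s * m) * inverse (qfac m * qfac (m + 2 * s)))"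
        by (simp add: F_def mult_ac)
    qed
    also have "\<dots> = (\<alpha> r * fls_X powi (r * r)) * inverse (qprod 1 {0<..})"
      by (simp only: fsum_cmult[OF durfee_rectangle_sum(1)] durfee_rectangle_sum(2))
    finally show ?thesis by (simp add: mult.commute)
  qed
  have "fsum (\<lambda>n. fls_X ^ (n * n) * (\<Sum>r\<in>{-int n..int n}. \<alpha> r * inverse (qfac (nat (int n - r)) * qfac (nat (int n + r))))) UNIV =
    fsum (\<lambda>n. fsum (F n) {r\<in>UNIV. \<bar>r\<bar> \<le> int n}) UNIV"
  proof (rule fsum_cong[OF refl])
    fix n :: nat
    have "{r\<in>UNIV. \<bar>r\<bar> \<le> int n} = {-int n..int n}" by auto
    then show "fls_X ^ (n * n) * (\<Sum>r\<in>{-int n..int n}. \<alpha> r * inverse (qfac (nat (int n - r)) * qfac (nat (int n + r)))) =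
        fsum (F n) {r\<in>UNIV. \<bar>r\<bar> \<le> int n}"
      by (simp add: fsum_finite F_def sum_distrib_left)
  qed
  also have "\<dots> = fsum (\<lambda>r. fsum (\<lambda>n. F n r) {n\<in>UNIV. \<bar>r\<bar> \<le> int n}) UNIV"
    by (rule fsum_swap[OF summ])
  also have "\<dots> = fsum (\<lambda>r. inverse (qprod 1 {0<..}) * (\<alpha> r * fls_X powi (r * r))) UNIV"
    by (simp only: inner)
  also have "\<dots> = inverse (qprod 1 {0<..}) * fsum (\<lambda>r. \<alpha> r * fls_X powi (r * r)) UNIV"
  proof (rule fsum_cmult, rule fsummableI_int[where c = 0])
    fix r :: int
    have "\<bar>r\<bar> \<le> r * r"
    proof (cases "r = 0")
      case False
      then have "\<bar>r\<bar> * 1 \<le> \<bar>r\<bar> * \<bar>r\<bar>" by (intro mult_left_mono) auto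
      then show ?thesis by simp
    qed simp
    then have "vanishes_below \<bar>r\<bar> (fls_X powi (r * r) :: 'a fls)" by simp
    then show "vanishes_below (\<bar>r\<bar> - 0) (\<alpha> r * fls_X powi (r * r))"
      using \<alpha> by (simp add: vanishes_below_int_mult)
  qed
  finally show ?thesis by (simp add: mult.commute)
qed

text \<open>The nodes between 0 and k lie at the distances 1, ..., k for k >= 0 and 1, ..., |k| - 1
  for k < 0. The extra sign in \<open>node_weight\<close> for negative k restores the parity, so one
  formula covers both cases.\<close>

lemma node_weight_interval:
  assumes "\<bar>k\<bar> \<le> int n"
  shows "node_weight {-int n..int n} k = alt k * (fls_X powi (k * (k + 1) div 2) :: 'a::field fls)"
proof -
  have prod: "(\<Prod>i\<in>{1..m}. - (fls_X ^ i) :: 'a fls) = alt (int m) * fls_X ^ (m * (m + 1) div 2)" for m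
  proof (induction m)
    case (Suc m)
    have "Suc m * (Suc m + 1) div 2 = m * (m + 1) div 2 + Suc m" by simp
    then have "fls_X ^ (Suc m * (Suc m + 1) div 2) = (fls_X ^ (m * (m + 1) div 2) * fls_X ^ Suc m :: 'a fls)"
      by (simp only: power_add)
    moreover have "alt (int (Suc m)) = (- alt (int m) :: 'a fls)" by (simp add: alt_def)
    moreover have "(\<Prod>i\<in>{1..Suc m}. - (fls_X ^ i) :: 'a fls) = - (fls_X ^ Suc m) * (\<Prod>i\<in>{1..m}. - (fls_X ^ i))"
      by (rule prod.nat_ivl_Suc') simp
    ultimately show ?case unfolding Suc.IH by (simp only: mult_minus_left mult_minus_right mult_ac)
  qed simp
  show ?thesis
  proof (cases "k \<ge> 0")
    case True
    define m where "m = nat k"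
    have km: "k = int m" using True by (simp add: m_def)
    have "(\<Prod>j\<in>{j\<in>{-int n..int n}. 0 \<le> j \<and> j < k \<or> k < j \<and> j < 0}. - (fls_X powi \<bar>k - j\<bar>)) = (\<Prod>i\<in>{1..m}. - (fls_X ^ i) :: 'a fls)"
      using assms by (intro prod.reindex_bij_witness[of _ "\<lambda>i. int m - int i" "\<lambda>j. nat (int m - j)"]) (auto simp: km power_int_def)
    moreover have "k * (k + 1) div 2 = int (m * (m + 1) div 2)" by (simp add: km zdiv_int algebra_simps)
    ultimately show ?thesis using True prod[of m] by (simp add: node_weight_def km)
  next
    case False
    define m where "m = nat (- k - 1)"
    have km: "k = - int m - 1" using False by (simp add: m_def)
    have "(\<Prod>j\<in>{j\<in>{-int n..int n}. 0 \<le> j \<and> j < k \<or> k < j \<and> j < 0}. - (fls_X powi \<bar>k - j\<bar>)) = (\<Prod>i\<in>{1..m}. - (fls_X ^ i) :: 'a fls)"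
      using assms by (intro prod.reindex_bij_witness[of _ "\<lambda>i. int i - int m - 1" "\<lambda>j. nat (j + int m + 1)"])
         (auto simp: km power_int_def intro!: arg_cong[of _ _ "\<lambda>n. fls_X ^ n"])
    moreover have "k * (k + 1) div 2 = int (m * (m + 1) div 2)" by (simp add: km zdiv_int algebra_simps)
    moreover have "alt k = (- alt (int m) :: 'a fls)" by (simp add: km alt_def)
    ultimately show ?thesis using False prod[of m] by (simp add: node_weight_def)
  qed
qed

lemma node_denominator_interval:
  assumes "\<bar>k\<bar> \<le> int n"
  shows "(\<Prod>j\<in>{-int n..int n}-{k}. 1 - fls_X powi \<bar>k - j\<bar>) = (qfac (nat (int n - k)) * qfac (nat (int n + k)) :: 'a::field fls)"
proof -
  have "(\<Prod>j\<in>{-int n..int n}-{k}. 1 - fls_X powi \<bar>k - j\<bar> :: 'a fls) =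
    (\<Prod>j\<in>{k<..int n}. 1 - fls_X powi \<bar>k - j\<bar>) * (\<Prod>j\<in>{-int n..<k}. 1 - fls_X powi \<bar>k - j\<bar>)"
    using assms by (subst prod.union_disjoint[symmetric]) (auto intro!: prod.cong)
  also have "(\<Prod>j\<in>{k<..int n}. 1 - fls_X powi \<bar>k - j\<bar>) = (qfac (nat (int n - k)) :: 'a fls)"
    unfolding qfac_def using assms
    by (intro prod.reindex_bij_witness[of _ "\<lambda>i. k + int i" "\<lambda>j. nat (j - k)"]) (auto simp: power_int_def)
  also have "(\<Prod>j\<in>{-int n..<k}. 1 - fls_X powi \<bar>k - j\<bar>) = (qfac (nat (int n + k)) :: 'a fls)"
    unfolding qfac_def using assms
    by (intro prod.reindex_bij_witness[of _ "\<lambda>i. k - int i" "\<lambda>j. nat (k - j)"]) (auto simp: power_int_def)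
  finally show ?thesis .
qed

definition pent :: "int \<Rightarrow> int" where
  "pent k = k * (3 * k + 1) div 2"

lemma two_pent: "2 * pent k = k * (3 * k + 1)"
  unfolding pent_def by simp

lemma triangular_plus_square: "k * (k + 1) div 2 + k * k = pent k"
proof -
  have "2 * (k * (k + 1) div 2) = k * (k + 1)" by simp
  then have "2 * (k * (k + 1) div 2 + k * k) = 2 * pent k" unfolding two_pent by (simp add: algebra_simps)
  then show ?thesis by simp
qed

lemma triangular_nonneg: "0 \<le> (k :: int) * (k + 1)"
  by (cases "k \<ge> 0") (auto simp: zero_le_mult_iff)

text \<open>Without the factor 1 + q^k the symmetric intervals give the unit Bailey pair: for n > 0
  the interval has negative nodes and the second half of \<open>finite_node_sum\<close> makes beta_n
  vanish, while beta_0 = 1.\<close>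

lemma pentagonal_number_theorem:
  "fsum (\<lambda>k. alt k * fls_X powi pent k) UNIV = (qprod 1 {0<..} :: 'a::field_char_0 fls)"
proof -
  let ?\<alpha> = "\<lambda>k. alt k * fls_X powi (k * (k + 1) div 2) :: 'a fls"
  have "(\<Sum>r\<in>{-int n..int n}. ?\<alpha> r * inverse (qfac (nat (int n - r)) * qfac (nat (int n + r)))) = (if n = 0 then 1 else 0)" for n
  proof (cases "n = 0")
    case False
    have "(\<Sum>r\<in>{-int n..int n}. ?\<alpha> r * inverse (qfac (nat (int n - r)) * qfac (nat (int n + r)))) =
      (\<Sum>r\<in>{-int n..int n}. node_weight {-int n..int n} r / (\<Prod>j\<in>{-int n..int n}-{r}. 1 - fls_X powi \<bar>r - j\<bar>))"
    proof (intro sum.cong refl)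
      fix r assume "r \<in> {-int n..int n}"
      then have "\<bar>r\<bar> \<le> int n" by auto
      then show "?\<alpha> r * inverse (qfac (nat (int n - r)) * qfac (nat (int n + r))) =
          node_weight {-int n..int n} r / (\<Prod>j\<in>{-int n..int n}-{r}. 1 - fls_X powi \<bar>r - j\<bar>)"
        by (simp add: node_weight_interval node_denominator_interval divide_inverse del: inverse_mult_distrib)
    qed
    also have "\<dots> = 0"
    proof (rule finite_node_sum(2))
      show "\<exists>j\<in>{-int n..int n}. 0 \<le> j" by (rule bexI[of _ 0]) auto
      show "\<exists>j\<in>{-int n..int n}. j < 0" using False by (intro bexI[of _ "- 1"]) auto
    qed simp
    finally show ?thesis using False by simp
  qed simp
  then have "fsum (\<lambda>r. ?\<alpha> r * fls_X powi (r * r)) UNIV * inverse (qprod 1 {0<..}) =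
      fsum (\<lambda>n. fls_X ^ (n * n) * (if n = 0 then 1 else 0)) UNIV"
    by (subst bailey_limit[symmetric]) (auto simp: triangular_nonneg)
  also have "\<dots> = fsum (\<lambda>n. fls_X ^ (n * n) * (if n = 0 then 1 else 0)) {0}"
    by (rule fsum_mono_neutral) auto
  also have "\<dots> = 1" by (simp add: fsum_finite)
  finally have "fsum (\<lambda>r. ?\<alpha> r * fls_X powi (r * r)) UNIV = qprod 1 {0<..}"
    using unipotent_nonzero[OF qprod_unipotent[of "1 :: 'a fls" "{0<..}"]] by (simp add: field_simps)
  moreover have "?\<alpha> r * fls_X powi (r * r) = alt r * fls_X powi pent r" for r
    by (simp add: mult.assoc flip: power_int_add triangular_plus_square)
  ultimately show ?thesis by simp
qed

lemma vanishes_below_two: "vanishes_below 0 (2 :: 'a::field fls)"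
  using vanishes_below_add[of 0 1 "1 :: 'a fls"] by simp

text \<open>The node sum over {-n..n} is the reciprocal of 2 times the squared product of the 1 +
  q^j. That 2 is 1 + q^0 from the node 0, and it is the reason for the 2 in alpha.\<close>

lemma watson:
  "fsum (\<lambda>n. fls_X ^ (n * n) * inverse (\<Prod>j\<in>{1..n}. (1 + fls_X ^ j) ^ 2)) UNIV =
   fsum (\<lambda>k. 2 * (alt k * fls_X powi pent k / (1 + fls_X powi k))) UNIV * inverse (qprod 1 {0<..} :: 'a::field_char_0 fls)"
proof -
  let ?\<alpha> = "\<lambda>k. 2 * (alt k * fls_X powi (k * (k + 1) div 2) / (1 + fls_X powi k)) :: 'a fls"
  have "(\<Sum>r\<in>{-int n..int n}. ?\<alpha> r * inverse (qfac (nat (int n - r)) * qfac (nat (int n + r)))) =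
      inverse (\<Prod>j\<in>{1..n}. (1 + fls_X ^ j) ^ 2)" for n
  proof -
    have "(\<Sum>r\<in>{-int n..int n}. ?\<alpha> r * inverse (qfac (nat (int n - r)) * qfac (nat (int n + r)))) =
      2 * (\<Sum>r\<in>{-int n..int n}. node_weight {-int n..int n} r / ((1 + fls_X powi r) * (\<Prod>j\<in>{-int n..int n}-{r}. 1 - fls_X powi \<bar>r - j\<bar>)))"
      unfolding sum_distrib_left
    proof (intro sum.cong refl)
      fix r assume "r \<in> {-int n..int n}"
      then have "\<bar>r\<bar> \<le> int n" by auto
      then show "?\<alpha> r * inverse (qfac (nat (int n - r)) * qfac (nat (int n + r))) =
          2 * (node_weight {-int n..int n} r / ((1 + fls_X powi r) * (\<Prod>j\<in>{-int n..int n}-{r}. 1 - fls_X powi \<bar>r - j\<bar>)))"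
        by (simp add: node_weight_interval node_denominator_interval divide_inverse)
    qed
    also have "\<dots> = 2 * (1 / (\<Prod>j\<in>{-int n..int n}. 1 + fls_X powi \<bar>j\<bar>))"
      by (subst finite_node_sum(1)) auto
    also have "(\<Prod>j\<in>{-int n..int n}. 1 + fls_X powi \<bar>j\<bar>) =
       (\<Prod>j\<in>{0}. 1 + fls_X powi \<bar>j\<bar>) * ((\<Prod>j\<in>{1..int n}. 1 + fls_X powi \<bar>j\<bar>) * (\<Prod>j\<in>{-int n..-1}. 1 + fls_X powi \<bar>j\<bar>) :: 'a fls)"
    proof -
      have "{-int n..int n} = {0} \<union> ({1..int n} \<union> {-int n..-1})" by auto
      moreover have "prod f ({0} \<union> ({1..int n} \<union> {-int n..-1})) = prod f {0} * (prod f {1..int n} * prod f {-int n..-1})" for f :: "int \<Rightarrow> 'a fls"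
        by (subst prod.union_disjoint, simp, simp, simp, subst prod.union_disjoint) auto
      ultimately show ?thesis by (simp only:)
    qed
    also have "(\<Prod>j\<in>{1..int n}. 1 + fls_X powi \<bar>j\<bar>) = (\<Prod>j\<in>{1..n}. 1 + fls_X ^ j :: 'a fls)"
      by (intro prod.reindex_bij_witness[of _ int nat]) (auto simp: power_int_def)
    also have "(\<Prod>j\<in>{-int n..-1}. 1 + fls_X powi \<bar>j\<bar>) = (\<Prod>j\<in>{1..n}. 1 + fls_X ^ j :: 'a fls)"
      by (intro prod.reindex_bij_witness[of _ "\<lambda>i. - int i" "\<lambda>j. nat (- j)"]) (auto simp: power_int_def)
    also have "(\<Prod>j\<in>{0}. 1 + fls_X powi \<bar>j :: int\<bar>) = (2 :: 'a fls)" by simp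
    finally have "(\<Sum>r\<in>{-int n..int n}. ?\<alpha> r * inverse (qfac (nat (int n - r)) * qfac (nat (int n + r)))) =
      2 * (1 / (2 * ((\<Prod>j\<in>{1..n}. 1 + fls_X ^ j) * (\<Prod>j\<in>{1..n}. 1 + fls_X ^ j))))" .
    moreover have "(\<Prod>j\<in>{1..n}. (1 + fls_X ^ j) ^ 2) = (\<Prod>j\<in>{1..n}. 1 + fls_X ^ j) * (\<Prod>j\<in>{1..n}. 1 + fls_X ^ j :: 'a fls)"
      by (simp only: power2_eq_square prod.distrib)
    moreover have "2 * (1 / (2 * y)) = inverse y" for y :: "'a fls" by (simp add: inverse_eq_divide)
    ultimately show ?thesis by (simp only:)
  qed
  then have "fsum (\<lambda>n. fls_X ^ (n * n) * inverse (\<Prod>j\<in>{1..n}. (1 + fls_X ^ j) ^ 2)) UNIV =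
      fsum (\<lambda>r. ?\<alpha> r * fls_X powi (r * r)) UNIV * inverse (qprod 1 {0<..})"
  proof (subst bailey_limit[symmetric])
    fix r
    have "vanishes_below 0 (alt r * fls_X powi (r * (r + 1) div 2) * inverse (1 + fls_X powi r) :: 'a fls)"
      by (intro vanishes_below_mult_int vanishes_below_inverse_one_plus_X_powi) (auto simp: triangular_nonneg)
    then show "vanishes_below 0 (?\<alpha> r)"
      unfolding divide_inverse by (rule vanishes_below_int_mult[OF vanishes_below_two])
  qed simp
  moreover have "?\<alpha> r * fls_X powi (r * r) = 2 * (alt r * fls_X powi pent r / (1 + fls_X powi r))" for r
    by (simp add: power_int_add flip: triangular_plus_square)
  ultimately show ?thesis by (simp only:)
qed

text \<open>The leading 1 of \<open>mock_f\<close> is the term n = 0, whose product is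
  empty.\<close>

lemma fps_to_fls_mock_f:
  "fps_to_fls mock_f = fsum (\<lambda>n. fls_X ^ (n * n) * inverse (\<Prod>j\<in>{1..n}. (1 + fls_X ^ j) ^ 2)) UNIV"
proof -
  let ?t = "\<lambda>n. fls_X ^ (n * n) * inverse (\<Prod>j\<in>{1..n}. (1 + fls_X ^ j) ^ 2) :: rat fls"
  have tm: "?t n = fps_to_fls (mock_f_term n)" for n
  proof -
    let ?D = "\<Prod>j\<in>{1..n}. (1 + fps_X ^ j) ^ 2 :: rat fps"
    have D0: "?D $ 0 = 1"
      unfolding fps_prod_nth_0 by (intro prod.neutral) (auto simp: fps_power_zeroth zero_power)
    then have "mock_f_term n = fps_X ^ (n * n) * inverse ?D"
      unfolding mock_f_term_def power2_eq_square[of n] by (intro fps_divide_unit) simp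
    moreover have "fps_to_fls (inverse ?D) = inverse (fps_to_fls ?D)"
      using D0 by (intro fls_inverse_fps_to_fls[symmetric]) (simp add: subdegree_eq_0_iff)
    ultimately show ?thesis
      by (simp add: fls_times_fps_to_fls fps_to_fls_power fps_to_fls_prod)
  qed
  have vt: "vanishes_below (int n) (?t n)" for n
  proof -
    have "vanishes_below 0 (inverse (\<Prod>j\<in>{1..n}. (1 + fls_X ^ j) ^ 2) :: rat fls)"
      by (intro vanishes_below_inverse_unipotent unipotent_prod unipotent_power unipotent_one_plus) auto
    moreover have "int n \<le> int (n * n)" by (cases n) auto
    ultimately show ?thesis by (intro vanishes_below_mult_int) auto
  qed
  have lim: "(\<lambda>n. \<Sum>i<n. mock_f_term (Suc i)) \<longlonglongrightarrow> mock_f - 1"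
    using summable_LIMSEQ[OF summable_mock_f] by (simp add: mock_f_def)
  have "fsum ?t UNIV = fps_to_fls mock_f"
  proof (rule fsum_eqI[where c = 0])
    show "fsummable ?t UNIV" by (rule fsummableI_nat) (rule vt)
    fix N :: nat
    have "\<forall>m\<in>{..N}. eventually (\<lambda>n. (\<Sum>i<n. mock_f_term (Suc i)) $ m = (mock_f - 1) $ m) sequentially"
      using lim by (simp add: tendsto_fps_iff)
    then have "eventually (\<lambda>n. \<forall>m\<in>{..N}. (\<Sum>i<n. mock_f_term (Suc i)) $ m = (mock_f - 1) $ m) sequentially"
      by (subst eventually_ball_finite_distrib) auto
    moreover have "eventually (\<lambda>n. n \<ge> N) sequentially" by (rule eventually_ge_at_top)
    ultimately have "eventually (\<lambda>n. n \<ge> N \<and> (\<forall>m\<in>{..N}. (\<Sum>i<n. mock_f_term (Suc i)) $ m = (mock_f - 1) $ m)) sequentially"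
      by eventually_elim auto
    then obtain n where n: "n \<ge> N" "\<forall>m\<in>{..N}. (\<Sum>i<n. mock_f_term (Suc i)) $ m = (mock_f - 1) $ m"
      by (auto simp: eventually_sequentially)
    have "sum ?t {..n} = ?t 0 + (\<Sum>i<n. ?t (Suc i))"
      by (rule sum.atMost_shift)
    also have "\<dots> = 1 + fps_to_fls (\<Sum>i<n. mock_f_term (Suc i))"
    proof -
      have "fps_to_fls (\<Sum>i<m. mock_f_term (Suc i)) = (\<Sum>i<m. ?t (Suc i))" for m
        by (induction m) (simp_all only: tm sum.lessThan_Suc fps_to_fls_plus lessThan_0 sum.empty fps_zero_to_fls)
      then show ?thesis by simp
    qed
    finally have "vanishes_below (int N) (fps_to_fls mock_f - sum ?t {..n})"
      using n(2) by (auto simp: vanishes_below_def)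
    moreover have "vanishes_below (int N) (?t i)" if "i \<in> UNIV - {..n}" for i
      using that n(1) by (intro vanishes_below_mono[OF vt]) auto
    ultimately show "\<exists>B. finite B \<and> B \<subseteq> UNIV \<and> (\<forall>i\<in>UNIV-B. vanishes_below (int N - 0) (?t i)) \<and> vanishes_below (int N - 0) (fps_to_fls mock_f - sum ?t B)"
      by (intro exI[of _ "{..n}"]) auto
  qed
  then show ?thesis ..
qed

section \<open>Level-three Appell sums split modulo 5\<close>

definition residues :: "nat \<Rightarrow> nat set \<Rightarrow> nat set" where
  "residues d D = {j. j > 0 \<and> j mod d \<in> D}"

abbreviation "res5 \<equiv> residues 5"

lemma zero_notin_residues [simp]: "0 \<notin> residues d D"
  by (simp add: residues_def)

lemma qprod_residues:
  assumes "vanishes_below 0 e" "finite D"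
  shows "qprod e (residues d D) = (\<Prod>r\<in>D. qprod e (residues d {r}))"
  using assms(2)
proof (induction D rule: finite_induct)
  case empty
  have "unipotent (qprod e {})" by (intro qprod_unipotent assms) auto
  moreover have "vanishes_below (int n) (qprod e {} - 1)" for n
    using vanishes_below_mono[OF qprod_approx[of e "{}" "{}" n]] assms by simp
  then have "qprod e {} = 1" by (intro vanishes_below_eqI[where c = 0]) simp
  ultimately show ?case by (simp add: residues_def)
next
  case (insert r D)
  have "residues d (insert r D) = residues d {r} \<union> residues d D" by (auto simp: residues_def)
  moreover have "residues d {r} \<inter> residues d D = {}" using insert by (auto simp: residues_def)
  ultimately show ?case using insert assms by (simp add: qprod_Un_disjoint)
qed

text \<open>As infinite products, \<open>P1\<close> = (q, q^4; q^5), \<open>P2\<close> = (q^2, q^3;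
  q^5) and \<open>J5\<close> = (q^5; q^5). The reciprocals of \<open>P1\<close> and
  \<open>P2\<close> are the Rogers-Ramanujan products; \<open>M1\<close> and \<open>M2\<close> are
  the counterparts of \<open>P1\<close> and \<open>P2\<close> with plus signs.\<close>

definition P1 :: "rat fls" where "P1 = qprod 1 (res5 {1, 4})"
definition P2 :: "rat fls" where "P2 = qprod 1 (res5 {2, 3})"
definition J5 :: "rat fls" where "J5 = qprod 1 (res5 {0})"
definition M1 :: "rat fls" where "M1 = qprod (- 1) (res5 {1, 4})"
definition M2 :: "rat fls" where "M2 = qprod (- 1) (res5 {2, 3})"
text \<open>The factor 2 is \<open>1 + q\<^sup>0\<close>, from the node 0.\<close>

definition M0 :: "rat fls" where "M0 = 2 * qprod (- 1) (res5 {0}) ^ 2"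

lemma P_nonzero [simp]: "P1 \<noteq> 0" "P2 \<noteq> 0" "J5 \<noteq> 0" "M1 \<noteq> 0" "M2 \<noteq> 0" "M0 \<noteq> 0"
proof -
  have "qprod e (res5 D) \<noteq> 0" if "vanishes_below 0 e" for e :: "rat fls" and D
    using that by (intro unipotent_nonzero qprod_unipotent) auto
  then show "P1 \<noteq> 0" "P2 \<noteq> 0" "J5 \<noteq> 0" "M1 \<noteq> 0" "M2 \<noteq> 0" "M0 \<noteq> 0"
    by (simp_all add: P1_def P2_def J5_def M1_def M2_def M0_def)
qed

definition classes :: "int set \<Rightarrow> int set" where
  "classes C = {k. k mod 5 \<in> C}"

text \<open>Whether gaps of residue r occur depends only on k mod 5, so the node denominators are
  constant on classes.\<close>

lemma qprod_gaps_classes: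
  assumes "vanishes_below 0 e"
  shows "qprod e (gaps_above (classes C) k) = (\<Prod>r<5. if (k mod 5 + int r) mod 5 \<in> C then qprod e (res5 {r}) else 1)"
    and "qprod e (gaps_below (classes C) k) = (\<Prod>r<5. if (k mod 5 - int r) mod 5 \<in> C then qprod e (res5 {r}) else 1)"
proof -
  have "(k mod 5 + int (d mod 5)) mod 5 = (k + int d) mod 5" "(k mod 5 - int (d mod 5)) mod 5 = (k - int d) mod 5" for d
    by (simp_all add: zmod_int mod_simps)
  then have "gaps_above (classes C) k = res5 {r\<in>{..<5}. (k mod 5 + int r) mod 5 \<in> C}"
    "gaps_below (classes C) k = res5 {r\<in>{..<5}. (k mod 5 - int r) mod 5 \<in> C}"
    by (auto simp: gaps_above_def gaps_below_def residues_def classes_def)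
  moreover have "qprod e (res5 {r\<in>{..<5}. Q r}) = (\<Prod>r<5. if Q r then qprod e (res5 {r}) else 1)" for Q
  proof -
    have "finite {r\<in>{..<5::nat}. Q r}" by simp
    then show ?thesis by (simp only: qprod_residues[OF assms, of "{r\<in>{..<5}. Q r}"] prod.inter_filter finite_lessThan)
  qed
  ultimately show "qprod e (gaps_above (classes C) k) = (\<Prod>r<5. if (k mod 5 + int r) mod 5 \<in> C then qprod e (res5 {r}) else 1)"
    and "qprod e (gaps_below (classes C) k) = (\<Prod>r<5. if (k mod 5 - int r) mod 5 \<in> C then qprod e (res5 {r}) else 1)"
    by (simp_all only:)
qed

lemma node_weight_of_nat:
  "node_weight A (int n) = (\<Prod>i<n. if int i \<in> A then - (fls_X ^ (n - i)) else 1 :: 'a::field fls)"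
proof -
  have "(\<Prod>i<n. if int i \<in> A then - (fls_X ^ (n - i)) else 1) = (\<Prod>i\<in>{i\<in>{..<n}. int i \<in> A}. - (fls_X ^ (n - i)) :: 'a fls)"
    by (rule prod.inter_filter[symmetric]) simp
  also have "\<dots> = (\<Prod>j\<in>{j\<in>A. 0 \<le> j \<and> j < int n \<or> int n < j \<and> j < 0}. - (fls_X powi \<bar>int n - j\<bar>))"
    by (intro prod.reindex_bij_witness[of _ nat int]) (auto simp: power_int_def nat_diff_distrib')
  finally show ?thesis by (simp add: node_weight_def)
qed

lemma node_weight_neg_of_nat:
  assumes "n > 0"
  shows "node_weight A (- int n) = - (\<Prod>i<n. if i > 0 \<and> - int i \<in> A then - (fls_X ^ (n - i)) else 1 :: 'a::field fls)"
proof -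
  have "(\<Prod>i<n. if i > 0 \<and> - int i \<in> A then - (fls_X ^ (n - i)) else 1) = (\<Prod>i\<in>{i\<in>{..<n}. i > 0 \<and> - int i \<in> A}. - (fls_X ^ (n - i)) :: 'a fls)"
    by (rule prod.inter_filter[symmetric]) simp
  also have "\<dots> = (\<Prod>j\<in>{j\<in>A. 0 \<le> j \<and> j < - int n \<or> - int n < j \<and> j < 0}. - (fls_X powi \<bar>- int n - j\<bar>))"
    by (intro prod.reindex_bij_witness[of _ "\<lambda>j. nat (- j)" "\<lambda>i. - int i"]) (auto simp: power_int_def intro!: arg_cong[of _ _ "\<lambda>n. fls_X ^ n"])
  finally show ?thesis using assms by (simp add: node_weight_def)
qed

text \<open>A shift by 5 preserves A and all distances, so passing from k to k + 5 only adds the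
  nodes in {0..<5}.\<close>

lemma node_weight_shift_up:
  assumes "\<And>j. j + 5 \<in> A \<longleftrightarrow> j \<in> A" "k \<ge> 0"
  shows "node_weight A (k + 5) = node_weight A k * (\<Prod>j\<in>A \<inter> {0..<5}. - (fls_X powi (k + 5 - j)) :: 'a::field fls)"
proof -
  have S: "{j\<in>A. 0 \<le> j \<and> j < k + 5 \<or> k + 5 < j \<and> j < 0} = (\<lambda>j. j + 5) ` {j\<in>A. 0 \<le> j \<and> j < k \<or> k < j \<and> j < 0} \<union> A \<inter> {0..<5}" (is "?L = ?f ` ?S \<union> ?T")
  proof (intro set_eqI iffI)
    fix j assume j: "j \<in> ?L"
    show "j \<in> ?f ` ?S \<union> ?T"
    proof (cases "j < 5")
      case False
      then have "j = ?f (j - 5)" "j - 5 \<in> ?S" using j assms by (auto simp flip: assms(1)[of "j - 5"])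
      then show ?thesis by blast
    qed (use j assms in auto)
  qed (use assms in auto)
  have fin: "finite ?S" by (rule finite_subset[of _ "{0..k}"]) (use assms in auto)
  have "(\<Prod>j\<in>?f ` ?S \<union> ?T. - (fls_X powi \<bar>k + 5 - j\<bar>) :: 'a fls) = (\<Prod>j\<in>?f ` ?S. - (fls_X powi \<bar>k + 5 - j\<bar>)) * (\<Prod>j\<in>?T. - (fls_X powi \<bar>k + 5 - j\<bar>))"
    using fin assms by (intro prod.union_disjoint) auto
  also have "(\<Prod>j\<in>?f ` ?S. - (fls_X powi \<bar>k + 5 - j\<bar>) :: 'a fls) = (\<Prod>j\<in>?S. - (fls_X powi \<bar>k - j\<bar>))"
    by (subst prod.reindex) (auto simp: inj_on_def)
  also have "(\<Prod>j\<in>?T. - (fls_X powi \<bar>k + 5 - j\<bar>) :: 'a fls) = (\<Prod>j\<in>?T. - (fls_X powi (k + 5 - j)))"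
    using assms by (intro prod.cong) auto
  finally show ?thesis
    using assms(2) by (simp add: node_weight_def S del: Un_iff)
qed

text \<open>Downwards the added nodes are those in {-5..<0}, written as j - 5 with j in
  {0..<5}.\<close>

lemma node_weight_shift_down:
  assumes "\<And>j. j + 5 \<in> A \<longleftrightarrow> j \<in> A" "k < 0"
  shows "node_weight A (k - 5) = node_weight A k * (\<Prod>j\<in>A \<inter> {0..<5}. - (fls_X powi (j - k)) :: 'a::field fls)"
proof -
  let ?f = "\<lambda>j. j - 5 :: int"
  have S: "{j\<in>A. 0 \<le> j \<and> j < k - 5 \<or> k - 5 < j \<and> j < 0} = ?f ` {j\<in>A. 0 \<le> j \<and> j < k \<or> k < j \<and> j < 0} \<union> ?f ` (A \<inter> {0..<5})" (is "?L = ?f ` ?S \<union> ?f ` ?T")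
  proof (intro set_eqI iffI)
    fix j assume j: "j \<in> ?L"
    have "j = ?f (j + 5)" "j + 5 \<in> ?S \<union> ?T" using j assms by auto
    then show "j \<in> ?f ` ?S \<union> ?f ` ?T" by blast
  next
    have *: "j - 5 \<in> A \<longleftrightarrow> j \<in> A" for j using assms(1)[of "j - 5"] by simp
    fix j assume j: "j \<in> ?f ` ?S \<union> ?f ` ?T"
    then show "j \<in> ?L" using assms(2) by (auto simp: *)
  qed
  have fin: "finite ?S" by (rule finite_subset[of _ "{k..0}"]) (use assms in auto)
  have "(\<Prod>j\<in>?f ` ?S \<union> ?f ` ?T. - (fls_X powi \<bar>k - 5 - j\<bar>) :: 'a fls) = (\<Prod>j\<in>?f ` ?S. - (fls_X powi \<bar>k - 5 - j\<bar>)) * (\<Prod>j\<in>?f ` ?T. - (fls_X powi \<bar>k - 5 - j\<bar>))"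
    using fin assms by (intro prod.union_disjoint) auto
  also have "(\<Prod>j\<in>?f ` ?S. - (fls_X powi \<bar>k - 5 - j\<bar>) :: 'a fls) = (\<Prod>j\<in>?S. - (fls_X powi \<bar>k - j\<bar>))"
    by (subst prod.reindex) (auto simp: inj_on_def)
  also have "(\<Prod>j\<in>?f ` ?T. - (fls_X powi \<bar>k - 5 - j\<bar>) :: 'a fls) = (\<Prod>j\<in>?T. - (fls_X powi (j - k)))"
    using assms by (subst prod.reindex) (auto simp: inj_on_def intro!: prod.cong)
  finally show ?thesis
    using assms(2) by (simp add: node_weight_def S del: Un_iff)
qed

text \<open>On a class of \<open>n\<close> modulo 5 the exponent \<open>pent n + b n\<close> is constant modulo 5; the rounding division drops
  this residue and turns the \<open>q\<^sup>5\<close> of the dissected series into \<open>q\<close>.\<close>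

definition wt :: "int \<Rightarrow> int \<Rightarrow> rat fls" where
  "wt b n = alt n * fls_X powi ((pent n + b * n) div 5)"

lemma pent_add_5: "pent (n + 5) = pent n + 5 * (3 * n + 8)"
proof -
  have "2 * pent (n + 5) = 2 * (pent n + 5 * (3 * n + 8))"
    unfolding two_pent distrib_left by (simp add: two_pent algebra_simps)
  then show ?thesis by simp
qed

lemma wt_add_5: "wt b (n + 5) = - (fls_X powi (3 * n + 8 + b)) * wt b n"
proof -
  have "pent (n + 5) + b * (n + 5) = pent n + b * n + (3 * n + 8 + b) * 5"
    by (simp add: pent_add_5 algebra_simps)
  then have "(pent (n + 5) + b * (n + 5)) div 5 = (pent n + b * n) div 5 + (3 * n + 8 + b)"
    by simp
  moreover have "alt (n + 5) = (- alt n :: rat fls)" by (simp add: alt_def)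
  ultimately show ?thesis by (simp add: wt_def power_int_add)
qed

lemma classes_periodic: "j + 5 \<in> classes C \<longleftrightarrow> j \<in> classes C"
  by (simp add: classes_def)

text \<open>Under n -> n + 5 the weight is multiplied by -q^(3n + 15 - (c1 + c2 + c3)) and
  \<open>wt b\<close> by -q^(3n + 8 + b); these agree exactly when the classes sum to 7 - b. Each
  class has two base values because the shift lemmas for the weight do not cross 0.\<close>

lemma node_weight_classes:
  fixes C :: "int set"
  assumes C: "C = {c1, c2, c3}" "C \<subseteq> {0..<5}" "c1 \<noteq> c2" "c1 \<noteq> c3" "c2 \<noteq> c3" "c1 + c2 + c3 = 7 - b"
    and c: "0 \<le> c" "c < 5" and base: "node_weight (classes C) c = K * wt b c" "node_weight (classes C) (c - 5) = K * wt b (c - 5)"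
    and n: "n mod 5 = c"
  shows "node_weight (classes C) n = K * wt b n"
proof -
  have AC: "classes C \<inter> {0..<5} = C" using C(2) by (auto simp: classes_def)
  have prod3: "prod f C = f c1 * (f c2 * f c3)" for f :: "int \<Rightarrow> rat fls" using C by simp
  have up: "node_weight (classes C) (k + 5) = node_weight (classes C) k * - (fls_X powi (3 * k + 8 + b) :: rat fls)" if "k \<ge> 0" for k :: int
  proof -
    have "node_weight (classes C) (k + 5) = node_weight (classes C) k * (\<Prod>j\<in>C. - (fls_X powi (k + 5 - j)) :: rat fls)"
      using node_weight_shift_up[of "classes C" k, OF classes_periodic that] unfolding AC .
    also have "(\<Prod>j\<in>C. - (fls_X powi (k + 5 - j)) :: rat fls) = - (fls_X powi ((k + 5 - c1) + ((k + 5 - c2) + (k + 5 - c3))))"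
      unfolding prod3 by (simp flip: power_int_add)
    also have "(k + 5 - c1) + ((k + 5 - c2) + (k + 5 - c3)) = 3 * k + 8 + b" using C by simp
    finally show ?thesis .
  qed
  have down: "node_weight (classes C) (k - 5) = node_weight (classes C) k * - (fls_X powi (7 - b - 3 * k) :: rat fls)" if "k < 0" for k :: int
  proof -
    have "node_weight (classes C) (k - 5) = node_weight (classes C) k * (\<Prod>j\<in>C. - (fls_X powi (j - k)) :: rat fls)"
      using node_weight_shift_down[of "classes C" k, OF classes_periodic that] unfolding AC .
    also have "(\<Prod>j\<in>C. - (fls_X powi (j - k)) :: rat fls) = - (fls_X powi ((c1 - k) + ((c2 - k) + (c3 - k))))"
      unfolding prod3 by (simp flip: power_int_add)
    also have "(c1 - k) + ((c2 - k) + (c3 - k)) = 7 - b - 3 * k" using C by simp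
    finally show ?thesis .
  qed
  have pos: "node_weight (classes C) (c + 5 * int m) = K * wt b (c + 5 * int m)" for m
  proof (induction m)
    case (Suc m)
    have "c + 5 * int (Suc m) = (c + 5 * int m) + 5" by simp
    then show ?case using Suc c by (simp only: up wt_add_5) (simp add: mult_ac)
  qed (use base in simp)
  have neg: "node_weight (classes C) (c - 5 - 5 * int m) = K * wt b (c - 5 - 5 * int m)" for m
  proof (induction m)
    case (Suc m)
    define k where "k = c - 5 - 5 * int m"
    have k: "c - 5 - 5 * int (Suc m) = k - 5" "k < 0" using c by (simp_all add: k_def)
    \<comment> \<open>The recurrence of \<open>wt\<close> from k - 5 to k is inverse to the downward
      shift of the weight: the exponents 3(k - 5) + 8 + b and 7 - b - 3k add up to 0.\<close>
    have "wt b k = - (fls_X powi (3 * (k - 5) + 8 + b)) * wt b (k - 5)"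
      using wt_add_5[of b "k - 5"] by simp
    then have "wt b k * - (fls_X powi (7 - b - 3 * k)) = (fls_X powi (3 * (k - 5) + 8 + b) * fls_X powi (7 - b - 3 * k)) * wt b (k - 5)"
      by (simp add: mult_ac)
    also have "fls_X powi (3 * (k - 5) + 8 + b) * fls_X powi (7 - b - 3 * k) = (1 :: rat fls)"
      by (simp flip: power_int_add)
    finally have "wt b k * - (fls_X powi (7 - b - 3 * k)) = wt b (k - 5)" by simp
    moreover have "node_weight (classes C) k = K * wt b k" using Suc by (simp only: k_def)
    ultimately show ?case
      unfolding k(1) down[OF k(2)] by (simp only: mult.assoc)
  qed (use base in simp)
  have eq: "n = c + 5 * (n div 5)" using n by (metis add.commute mult_div_mod_eq)
  show ?thesis
  proof (cases "n div 5 \<ge> 0")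
    case True
    then show ?thesis using pos[of "nat (n div 5)"] eq by simp
  next
    case False
    then have "c - 5 - 5 * int (nat (- (n div 5) - 1)) = n" using eq by simp
    then show ?thesis using neg[of "nat (- (n div 5) - 1)"] by (simp only:)
  qed
qed

definition appell :: "int \<Rightarrow> int \<Rightarrow> rat fls" where
  "appell b c = fsum (\<lambda>n. wt b n / (1 + fls_X powi n)) {n. n mod 5 = c}"

definition wtsum :: "int \<Rightarrow> int \<Rightarrow> rat fls" where
  "wtsum b c = fsum (wt b) {n. n mod 5 = c}"

text \<open>\<open>node_sum\<close> for A = \<open>classes C\<close>, split over the three classes:
  on each class the weight is a fixed multiple \<open>K c\<close> of \<open>wt b\<close> and the
  denominator is constant. \<open>R\<close> belongs to the evaluation point -1. The second relation
  is the one that dissects Euler's product.\<close>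

lemma three_term_relation:
  fixes C :: "int set"
  assumes C: "C = {c1, c2, c3}" "C \<subseteq> {0..<5}" "c1 \<noteq> c2" "c1 \<noteq> c3" "c2 \<noteq> c3" "c1 + c2 + c3 = 7 - b"
    and base: "\<And>c. c \<in> C \<Longrightarrow> K c \<noteq> 0 \<and> node_weight (classes C) c = K c * wt b c \<and> node_weight (classes C) (c - 5) = K c * wt b (c - 5)"
    and Dn: "\<And>n. n mod 5 \<in> C \<Longrightarrow> node_denominator (classes C) n = Dn (n mod 5)"
    and R: "(if 0 \<in> classes C then 2 else 1) * (qprod (- 1) (gaps_above (classes C) 0) * qprod (- 1) (gaps_below (classes C) 0)) = R"
  shows "K c1 / Dn c1 * appell b c1 + K c2 / Dn c2 * appell b c2 + K c3 / Dn c3 * appell b c3 = 1 / R"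
    and "K c1 / Dn c1 * wtsum b c1 + K c2 / Dn c2 * wtsum b c2 + K c3 / Dn c3 * wtsum b c3 = 0"
    and "c \<in> C \<Longrightarrow> fsummable (\<lambda>n. wt b n / (1 + fls_X powi n)) {n. n mod 5 = c}"
    and "c \<in> C \<Longrightarrow> fsummable (wt b) {n. n mod 5 = c}"
proof -
  let ?A = "classes C"
  let ?cl = "\<lambda>c. {n :: int. n mod 5 = c}"
  have A: "?A = (\<Union>c\<in>C. ?cl c)" by (auto simp: classes_def)
  have disj: "disjoint_family_on ?cl C" by (auto simp: disjoint_family_on_def)
  have fin: "finite C" using C by simp
  have w: "node_weight ?A n = K c * wt b n" if "c \<in> C" "n \<in> ?cl c" for c n
  proof (rule node_weight_classes[OF C])
    show "0 \<le> c" "c < 5" using that(1) C(2) by auto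
  qed (use base[OF that(1)] that(2) in blast)+
  have j: "c1 \<in> ?A" "0 \<le> c1" "c1 - 5 \<in> ?A" "c1 - 5 < 0"
    using C by (auto simp: classes_def mod_simps)
  have Dn0: "Dn c \<noteq> 0" if "c \<in> C" for c
    using Dn[of c] that C node_denominator_nonzero[of ?A c, where 'a = rat] by auto
  have K0: "K c \<noteq> 0" if "c \<in> C" for c using base[OF that] by simp
  \<comment> \<open>One computation serves both relations: g is 1/(1 + q^n) for the first and 1 for
    the second.\<close>
  have *: "(\<Sum>c\<in>C. K c / Dn c * fsum (\<lambda>n. wt b n * g n) (?cl c)) = S \<and> (\<forall>c\<in>C. fsummable (\<lambda>n. wt b n * g n) (?cl c))"
    if S: "fsummable (\<lambda>n. node_weight ?A n * g n * inverse (node_denominator ?A n)) ?A"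
      "fsum (\<lambda>n. node_weight ?A n * g n * inverse (node_denominator ?A n)) ?A = S" for g and S :: "rat fls"
  proof -
    have F: "node_weight ?A n * g n * inverse (node_denominator ?A n) = K c / Dn c * (wt b n * g n)" if "c \<in> C" "n \<in> ?cl c" for c n
      using w[OF that] Dn[of n] that by (simp add: divide_inverse mult_ac)
    have s1: "fsummable (\<lambda>n. K c / Dn c * (wt b n * g n)) (?cl c)" if "c \<in> C" for c
    proof -
      have "fsummable (\<lambda>n. node_weight ?A n * g n * inverse (node_denominator ?A n)) (?cl c)"
        by (rule fsummable_subset[OF S(1)]) (use that in \<open>auto simp: classes_def\<close>)
      then show ?thesis by (subst (asm) fsummable_cong[OF refl F[OF that]])
    qed
    have s2: "fsummable (\<lambda>n. wt b n * g n) (?cl c)" if "c \<in> C" for c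
      using fsummable_cmult[OF s1[OF that], of "Dn c / K c"] Dn0[OF that] K0[OF that] by simp
    have "S = (\<Sum>c\<in>C. fsum (\<lambda>n. node_weight ?A n * g n * inverse (node_denominator ?A n)) (?cl c))"
      using S unfolding A by (subst fsum_UN_disjoint[OF fin _ disj, symmetric]) auto
    also have "\<dots> = (\<Sum>c\<in>C. K c / Dn c * fsum (\<lambda>n. wt b n * g n) (?cl c))"
    proof (intro sum.cong refl)
      fix c assume c: "c \<in> C"
      have "fsum (\<lambda>n. node_weight ?A n * g n * inverse (node_denominator ?A n)) (?cl c) = fsum (\<lambda>n. K c / Dn c * (wt b n * g n)) (?cl c)"
        by (rule fsum_cong[OF refl F[OF c]])
      then show "fsum (\<lambda>n. node_weight ?A n * g n * inverse (node_denominator ?A n)) (?cl c) = K c / Dn c * fsum (\<lambda>n. wt b n * g n) (?cl c)"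
        by (simp only: fsum_cmult[OF s2[OF c]])
    qed
    finally show ?thesis using s2 by simp
  qed
  have sum3: "(\<Sum>c\<in>C. h c) = h c1 + h c2 + h c3" for h :: "int \<Rightarrow> rat fls" using C by (simp add: add.assoc)
  note ns = node_sum[OF j, where 'a = rat]
  have 1: "(\<Sum>c\<in>C. K c / Dn c * appell b c) = 1 / R \<and> (\<forall>c\<in>C. fsummable (\<lambda>n. wt b n / (1 + fls_X powi n)) (?cl c))"
    using *[of "\<lambda>n. inverse (1 + fls_X powi n)" "1 / R"] ns(1,2)
    by (simp add: R appell_def divide_inverse)
  have 2: "(\<Sum>c\<in>C. K c / Dn c * wtsum b c) = 0 \<and> (\<forall>c\<in>C. fsummable (wt b) (?cl c))"
    using *[of "\<lambda>_. 1" 0] ns(3,4) by (simp add: wtsum_def)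
  show "K c1 / Dn c1 * appell b c1 + K c2 / Dn c2 * appell b c2 + K c3 / Dn c3 * appell b c3 = 1 / R"
    using 1 by (simp add: sum3)
  show "K c1 / Dn c1 * wtsum b c1 + K c2 / Dn c2 * wtsum b c2 + K c3 / Dn c3 * wtsum b c3 = 0"
    using 2 by (simp add: sum3)
  show "c \<in> C \<Longrightarrow> fsummable (\<lambda>n. wt b n / (1 + fls_X powi n)) {n. n mod 5 = c}" using 1 by blast
  show "c \<in> C \<Longrightarrow> fsummable (wt b) {n. n mod 5 = c}" using 2 by blast
qed

lemma lessThan_5: "{..<5::nat} = {0, 1, 2, 3, 4}"
  by auto

text \<open>The nodes -5, ..., 4 provide the two base values per class for all triples.\<close>

lemma node_weight_small:
  fixes A :: "int set"
  shows "node_weight A 0 = (1 :: rat fls)"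
    "node_weight A 1 = (if 0 \<in> A then - fls_X else 1 :: rat fls)"
    "node_weight A 2 = (if 0 \<in> A then - (fls_X ^ 2) else 1) * (if 1 \<in> A then - fls_X else 1 :: rat fls)"
    "node_weight A 3 = (if 0 \<in> A then - (fls_X ^ 3) else 1) * (if 1 \<in> A then - (fls_X ^ 2) else 1) * (if 2 \<in> A then - fls_X else 1 :: rat fls)"
    "node_weight A 4 = (if 0 \<in> A then - (fls_X ^ 4) else 1) * (if 1 \<in> A then - (fls_X ^ 3) else 1) * (if 2 \<in> A then - (fls_X ^ 2) else 1) * (if 3 \<in> A then - fls_X else 1 :: rat fls)"
    "node_weight A (- 1) = (- 1 :: rat fls)"
    "node_weight A (- 2) = (- (if - 1 \<in> A then - fls_X else 1) :: rat fls)"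
    "node_weight A (- 3) = (- ((if - 1 \<in> A then - (fls_X ^ 2) else 1) * (if - 2 \<in> A then - fls_X else 1)) :: rat fls)"
    "node_weight A (- 4) = (- ((if - 1 \<in> A then - (fls_X ^ 3) else 1) * (if - 2 \<in> A then - (fls_X ^ 2) else 1) * (if - 3 \<in> A then - fls_X else 1)) :: rat fls)"
    "node_weight A (- 5) = (- ((if - 1 \<in> A then - (fls_X ^ 4) else 1) * (if - 2 \<in> A then - (fls_X ^ 3) else 1) * (if - 3 \<in> A then - (fls_X ^ 2) else 1) * (if - 4 \<in> A then - fls_X else 1)) :: rat fls)"
proof -
  have s: "{..<0::nat} = {}" "{..<1::nat} = {0}" "{..<2::nat} = {0, 1}" "{..<3::nat} = {0, 1, 2}" "{..<4::nat} = {0, 1, 2, 3}"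
    by auto
  show "node_weight A 0 = (1 :: rat fls)"
    using node_weight_of_nat[of A 0, where 'a = rat] by simp
  show "node_weight A 1 = (if 0 \<in> A then - fls_X else 1 :: rat fls)"
    using node_weight_of_nat[of A 1, where 'a = rat] by (simp add: s)
  show "node_weight A 2 = (if 0 \<in> A then - (fls_X ^ 2) else 1) * (if 1 \<in> A then - fls_X else 1 :: rat fls)"
    using node_weight_of_nat[of A 2, where 'a = rat] by (simp add: s)
  show "node_weight A 3 = (if 0 \<in> A then - (fls_X ^ 3) else 1) * (if 1 \<in> A then - (fls_X ^ 2) else 1) * (if 2 \<in> A then - fls_X else 1 :: rat fls)"
    using node_weight_of_nat[of A 3, where 'a = rat] by (simp add: s mult.assoc)
  show "node_weight A 4 = (if 0 \<in> A then - (fls_X ^ 4) else 1) * (if 1 \<in> A then - (fls_X ^ 3) else 1) * (if 2 \<in> A then - (fls_X ^ 2) else 1) * (if 3 \<in> A then - fls_X else 1 :: rat fls)"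
    using node_weight_of_nat[of A 4, where 'a = rat] by (simp add: s mult.assoc)
  show "node_weight A (- 1) = (- 1 :: rat fls)"
    using node_weight_neg_of_nat[of 1 A, where 'a = rat] by (simp add: s)
  show "node_weight A (- 2) = (- (if - 1 \<in> A then - fls_X else 1) :: rat fls)"
    using node_weight_neg_of_nat[of 2 A, where 'a = rat] by (simp add: s)
  show "node_weight A (- 3) = (- ((if - 1 \<in> A then - (fls_X ^ 2) else 1) * (if - 2 \<in> A then - fls_X else 1)) :: rat fls)"
    using node_weight_neg_of_nat[of 3 A, where 'a = rat] by (simp add: s)
  show "node_weight A (- 4) = (- ((if - 1 \<in> A then - (fls_X ^ 3) else 1) * (if - 2 \<in> A then - (fls_X ^ 2) else 1) * (if - 3 \<in> A then - fls_X else 1)) :: rat fls)"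
    using node_weight_neg_of_nat[of 4 A, where 'a = rat] by (simp add: s mult.assoc)
  show "node_weight A (- 5) = (- ((if - 1 \<in> A then - (fls_X ^ 4) else 1) * (if - 2 \<in> A then - (fls_X ^ 3) else 1) * (if - 3 \<in> A then - (fls_X ^ 2) else 1) * (if - 4 \<in> A then - fls_X else 1)) :: rat fls)"
    using node_weight_neg_of_nat[of 5 A, where 'a = rat] by (simp add: lessThan_5 mult.assoc)
qed

lemma P_split:
  "P1 = qprod 1 (res5 {1}) * qprod 1 (res5 {4})" "P2 = qprod 1 (res5 {2}) * qprod 1 (res5 {3})"
  "M1 = qprod (- 1) (res5 {1}) * qprod (- 1) (res5 {4})" "M2 = qprod (- 1) (res5 {2}) * qprod (- 1) (res5 {3})"
  unfolding P1_def P2_def M1_def M2_def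
  by (subst qprod_residues[of _ "{_, _}"], simp, simp, simp)+

lemmas triple_simps = node_weight_small wt_def pent_def classes_def alt_def power_numeral_reduce

lemma node_denominator_classes:
  "node_denominator (classes C) n =
     (\<Prod>r<5. if (n mod 5 + int r) mod 5 \<in> C then qprod 1 (res5 {r}) else 1) *
     (\<Prod>r<5. if (n mod 5 - int r) mod 5 \<in> C then qprod 1 (res5 {r}) else (1 :: rat fls))"
  by (simp add: node_denominator_def qprod_gaps_classes)

lemma node_value_classes:
  "(if 0 \<in> classes C then 2 else 1) * (qprod (- 1) (gaps_above (classes C) 0) * qprod (- 1) (gaps_below (classes C) 0)) =
   (if 0 \<in> C then 2 else 1) *
     ((\<Prod>r<5. if int r mod 5 \<in> C then qprod (- 1) (res5 {r}) else 1) *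
      (\<Prod>r<5. if (- int r) mod 5 \<in> C then qprod (- 1) (res5 {r}) else (1 :: rat fls)))"
  by (simp add: qprod_gaps_classes) (simp add: classes_def)

text \<open>In every triple below, one class is central and the other two lie at equal distance on
  either side of it modulo 5: distance 1 in the first triple for each b, distance 2 in the second.
  The central denominator therefore contains the square of \<open>P1\<close> or of
  \<open>P2\<close>, the outer ones contain \<open>P1 * P2\<close>. The common centre is 4, 2, 0 for
  b = 0, 1, 2.\<close>

lemma triple_0a:
  "1 / (J5 ^ 2 * P1 * P2) * appell 0 3 + 1 / (J5 ^ 2 * P1 ^ 2) * appell 0 4 + 1 / (J5 ^ 2 * P1 * P2) * appell 0 0 = 1 / (M0 * M1 * M2)"
  "1 / (J5 ^ 2 * P1 * P2) * wtsum 0 3 + 1 / (J5 ^ 2 * P1 ^ 2) * wtsum 0 4 + 1 / (J5 ^ 2 * P1 * P2) * wtsum 0 0 = 0"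
  "\<forall>c\<in>{3, 4, 0}. fsummable (\<lambda>n. wt 0 n / (1 + fls_X powi n)) {n. n mod 5 = c} \<and> fsummable (wt 0) {n. n mod 5 = c}"
proof -
  let ?K = "(\<lambda>_. 1) :: int \<Rightarrow> rat fls"
  have base: "c \<in> {3, 4, 0} \<Longrightarrow> ?K c \<noteq> 0 \<and> node_weight (classes {3, 4, 0}) c = ?K c * wt 0 c \<and> node_weight (classes {3, 4, 0}) (c - 5) = ?K c * wt 0 (c - 5)" for c
    by (elim insertE emptyE) (simp_all add: triple_simps)
  have Dn: "n mod 5 \<in> {3, 4, 0} \<Longrightarrow> node_denominator (classes {3, 4, 0}) n = (if n mod 5 = 4 then J5 ^ 2 * P1 ^ 2 else J5 ^ 2 * P1 * P2)" for n
    unfolding node_denominator_classes lessThan_5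
    by (elim insertE emptyE) (simp_all add: J5_def P_split power2_eq_square mult_ac)
  have R: "(if 0 \<in> classes {3, 4, 0} then 2 else 1) * (qprod (- 1) (gaps_above (classes {3, 4, 0}) 0) * qprod (- 1) (gaps_below (classes {3, 4, 0}) 0)) = M0 * M1 * M2"
    unfolding node_value_classes lessThan_5 by (simp add: M0_def P_split power2_eq_square mult_ac)
  note tr = three_term_relation[of "{3, 4, 0}" 3 4 0 0 ?K, OF refl _ _ _ _ _ base Dn R]
  show "1 / (J5 ^ 2 * P1 * P2) * appell 0 3 + 1 / (J5 ^ 2 * P1 ^ 2) * appell 0 4 + 1 / (J5 ^ 2 * P1 * P2) * appell 0 0 = 1 / (M0 * M1 * M2)"
    using tr(1) by simp
  show "1 / (J5 ^ 2 * P1 * P2) * wtsum 0 3 + 1 / (J5 ^ 2 * P1 ^ 2) * wtsum 0 4 + 1 / (J5 ^ 2 * P1 * P2) * wtsum 0 0 = 0"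
    using tr(2) by simp
  show "\<forall>c\<in>{3, 4, 0}. fsummable (\<lambda>n. wt 0 n / (1 + fls_X powi n)) {n. n mod 5 = c} \<and> fsummable (wt 0) {n. n mod 5 = c}"
    using tr(3,4) by simp
qed

lemma triple_0b:
  "- 1 / (J5 ^ 2 * P1 * P2) * appell 0 2 + 1 / (J5 ^ 2 * P2 ^ 2) * appell 0 4 + - 1 / (J5 ^ 2 * P1 * P2) * appell 0 1 = 1 / (M1 ^ 2 * M2)"
  "- 1 / (J5 ^ 2 * P1 * P2) * wtsum 0 2 + 1 / (J5 ^ 2 * P2 ^ 2) * wtsum 0 4 + - 1 / (J5 ^ 2 * P1 * P2) * wtsum 0 1 = 0"
  "\<forall>c\<in>{2, 4, 1}. fsummable (\<lambda>n. wt 0 n / (1 + fls_X powi n)) {n. n mod 5 = c} \<and> fsummable (wt 0) {n. n mod 5 = c}"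
proof -
  let ?K = "(\<lambda>c. if c = 4 then 1 else - 1) :: int \<Rightarrow> rat fls"
  have base: "c \<in> {2, 4, 1} \<Longrightarrow> ?K c \<noteq> 0 \<and> node_weight (classes {2, 4, 1}) c = ?K c * wt 0 c \<and> node_weight (classes {2, 4, 1}) (c - 5) = ?K c * wt 0 (c - 5)" for c
    by (elim insertE emptyE) (simp_all add: triple_simps)
  have Dn: "n mod 5 \<in> {2, 4, 1} \<Longrightarrow> node_denominator (classes {2, 4, 1}) n = (if n mod 5 = 4 then J5 ^ 2 * P2 ^ 2 else J5 ^ 2 * P1 * P2)" for n
    unfolding node_denominator_classes lessThan_5
    by (elim insertE emptyE) (simp_all add: J5_def P_split power2_eq_square mult_ac)
  have R: "(if 0 \<in> classes {2, 4, 1} then 2 else 1) * (qprod (- 1) (gaps_above (classes {2, 4, 1}) 0) * qprod (- 1) (gaps_below (classes {2, 4, 1}) 0)) = M1 ^ 2 * M2"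
    unfolding node_value_classes lessThan_5 by (simp add: M0_def P_split power2_eq_square mult_ac)
  note tr = three_term_relation[of "{2, 4, 1}" 2 4 1 0 ?K, OF refl _ _ _ _ _ base Dn R]
  show "- 1 / (J5 ^ 2 * P1 * P2) * appell 0 2 + 1 / (J5 ^ 2 * P2 ^ 2) * appell 0 4 + - 1 / (J5 ^ 2 * P1 * P2) * appell 0 1 = 1 / (M1 ^ 2 * M2)"
    using tr(1) by simp
  show "- 1 / (J5 ^ 2 * P1 * P2) * wtsum 0 2 + 1 / (J5 ^ 2 * P2 ^ 2) * wtsum 0 4 + - 1 / (J5 ^ 2 * P1 * P2) * wtsum 0 1 = 0"
    using tr(2) by simp
  show "\<forall>c\<in>{2, 4, 1}. fsummable (\<lambda>n. wt 0 n / (1 + fls_X powi n)) {n. n mod 5 = c} \<and> fsummable (wt 0) {n. n mod 5 = c}"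
    using tr(3,4) by simp
qed

lemma triple_1a:
  "- 1 / (J5 ^ 2 * P1 * P2) * appell 1 1 + - 1 / (J5 ^ 2 * P1 ^ 2) * appell 1 2 + - 1 / (J5 ^ 2 * P1 * P2) * appell 1 3 = 1 / (M1 * M2 ^ 2)"
  "- 1 / (J5 ^ 2 * P1 * P2) * wtsum 1 1 + - 1 / (J5 ^ 2 * P1 ^ 2) * wtsum 1 2 + - 1 / (J5 ^ 2 * P1 * P2) * wtsum 1 3 = 0"
  "\<forall>c\<in>{1, 2, 3}. fsummable (\<lambda>n. wt 1 n / (1 + fls_X powi n)) {n. n mod 5 = c} \<and> fsummable (wt 1) {n. n mod 5 = c}"
proof -
  let ?K = "(\<lambda>_. - 1) :: int \<Rightarrow> rat fls"
  have base: "c \<in> {1, 2, 3} \<Longrightarrow> ?K c \<noteq> 0 \<and> node_weight (classes {1, 2, 3}) c = ?K c * wt 1 c \<and> node_weight (classes {1, 2, 3}) (c - 5) = ?K c * wt 1 (c - 5)" for c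
    by (elim insertE emptyE) (simp_all add: triple_simps)
  have Dn: "n mod 5 \<in> {1, 2, 3} \<Longrightarrow> node_denominator (classes {1, 2, 3}) n = (if n mod 5 = 2 then J5 ^ 2 * P1 ^ 2 else J5 ^ 2 * P1 * P2)" for n
    unfolding node_denominator_classes lessThan_5
    by (elim insertE emptyE) (simp_all add: J5_def P_split power2_eq_square mult_ac)
  have R: "(if 0 \<in> classes {1, 2, 3} then 2 else 1) * (qprod (- 1) (gaps_above (classes {1, 2, 3}) 0) * qprod (- 1) (gaps_below (classes {1, 2, 3}) 0)) = M1 * M2 ^ 2"
    unfolding node_value_classes lessThan_5 by (simp add: M0_def P_split power2_eq_square mult_ac)
  note tr = three_term_relation[of "{1, 2, 3}" 1 2 3 1 ?K, OF refl _ _ _ _ _ base Dn R]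
  show "- 1 / (J5 ^ 2 * P1 * P2) * appell 1 1 + - 1 / (J5 ^ 2 * P1 ^ 2) * appell 1 2 + - 1 / (J5 ^ 2 * P1 * P2) * appell 1 3 = 1 / (M1 * M2 ^ 2)"
    using tr(1) by simp
  show "- 1 / (J5 ^ 2 * P1 * P2) * wtsum 1 1 + - 1 / (J5 ^ 2 * P1 ^ 2) * wtsum 1 2 + - 1 / (J5 ^ 2 * P1 * P2) * wtsum 1 3 = 0"
    using tr(2) by simp
  show "\<forall>c\<in>{1, 2, 3}. fsummable (\<lambda>n. wt 1 n / (1 + fls_X powi n)) {n. n mod 5 = c} \<and> fsummable (wt 1) {n. n mod 5 = c}"
    using tr(3,4) by simp
qed

lemma triple_1b:
  "1 / (J5 ^ 2 * P1 * P2) * appell 1 0 + - fls_X / (J5 ^ 2 * P2 ^ 2) * appell 1 2 + 1 / (J5 ^ 2 * P1 * P2) * appell 1 4 = 1 / (M0 * M1 * M2)"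
  "1 / (J5 ^ 2 * P1 * P2) * wtsum 1 0 + - fls_X / (J5 ^ 2 * P2 ^ 2) * wtsum 1 2 + 1 / (J5 ^ 2 * P1 * P2) * wtsum 1 4 = 0"
  "\<forall>c\<in>{0, 2, 4}. fsummable (\<lambda>n. wt 1 n / (1 + fls_X powi n)) {n. n mod 5 = c} \<and> fsummable (wt 1) {n. n mod 5 = c}"
proof -
  \<comment> \<open>The weight at the node 2 is -q^2, whereas \<open>wt 1 2\<close> is q^(9 div 5) =
    q; the ratio is -q.\<close>
  let ?K = "(\<lambda>c. if c = 2 then - fls_X else 1) :: int \<Rightarrow> rat fls"
  have base: "c \<in> {0, 2, 4} \<Longrightarrow> ?K c \<noteq> 0 \<and> node_weight (classes {0, 2, 4}) c = ?K c * wt 1 c \<and> node_weight (classes {0, 2, 4}) (c - 5) = ?K c * wt 1 (c - 5)" for c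
    by (elim insertE emptyE) (simp_all add: triple_simps)
  have Dn: "n mod 5 \<in> {0, 2, 4} \<Longrightarrow> node_denominator (classes {0, 2, 4}) n = (if n mod 5 = 2 then J5 ^ 2 * P2 ^ 2 else J5 ^ 2 * P1 * P2)" for n
    unfolding node_denominator_classes lessThan_5
    by (elim insertE emptyE) (simp_all add: J5_def P_split power2_eq_square mult_ac)
  have R: "(if 0 \<in> classes {0, 2, 4} then 2 else 1) * (qprod (- 1) (gaps_above (classes {0, 2, 4}) 0) * qprod (- 1) (gaps_below (classes {0, 2, 4}) 0)) = M0 * M1 * M2"
    unfolding node_value_classes lessThan_5 by (simp add: M0_def P_split power2_eq_square mult_ac)
  note tr = three_term_relation[of "{0, 2, 4}" 0 2 4 1 ?K, OF refl _ _ _ _ _ base Dn R]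
  show "1 / (J5 ^ 2 * P1 * P2) * appell 1 0 + - fls_X / (J5 ^ 2 * P2 ^ 2) * appell 1 2 + 1 / (J5 ^ 2 * P1 * P2) * appell 1 4 = 1 / (M0 * M1 * M2)"
    using tr(1) by simp
  show "1 / (J5 ^ 2 * P1 * P2) * wtsum 1 0 + - fls_X / (J5 ^ 2 * P2 ^ 2) * wtsum 1 2 + 1 / (J5 ^ 2 * P1 * P2) * wtsum 1 4 = 0"
    using tr(2) by simp
  show "\<forall>c\<in>{0, 2, 4}. fsummable (\<lambda>n. wt 1 n / (1 + fls_X powi n)) {n. n mod 5 = c} \<and> fsummable (wt 1) {n. n mod 5 = c}"
    using tr(3,4) by simp
qed

lemma triple_2a:
  "fls_X / (J5 ^ 2 * P1 * P2) * appell 2 4 + 1 / (J5 ^ 2 * P1 ^ 2) * appell 2 0 + fls_X / (J5 ^ 2 * P1 * P2) * appell 2 1 = 1 / (M0 * M1 ^ 2)"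
  "fls_X / (J5 ^ 2 * P1 * P2) * wtsum 2 4 + 1 / (J5 ^ 2 * P1 ^ 2) * wtsum 2 0 + fls_X / (J5 ^ 2 * P1 * P2) * wtsum 2 1 = 0"
  "\<forall>c\<in>{4, 0, 1}. fsummable (\<lambda>n. wt 2 n / (1 + fls_X powi n)) {n. n mod 5 = c} \<and> fsummable (wt 2) {n. n mod 5 = c}"
proof -
  \<comment> \<open>The factor q again comes from rounding: at the node 1 the weight is -q, whereas
    \<open>wt 2 1\<close> is -1.\<close>
  let ?K = "(\<lambda>c. if c = 0 then 1 else fls_X) :: int \<Rightarrow> rat fls"
  have base: "c \<in> {4, 0, 1} \<Longrightarrow> ?K c \<noteq> 0 \<and> node_weight (classes {4, 0, 1}) c = ?K c * wt 2 c \<and> node_weight (classes {4, 0, 1}) (c - 5) = ?K c * wt 2 (c - 5)" for c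
    by (elim insertE emptyE) (simp_all add: triple_simps)
  have Dn: "n mod 5 \<in> {4, 0, 1} \<Longrightarrow> node_denominator (classes {4, 0, 1}) n = (if n mod 5 = 0 then J5 ^ 2 * P1 ^ 2 else J5 ^ 2 * P1 * P2)" for n
    unfolding node_denominator_classes lessThan_5
    by (elim insertE emptyE) (simp_all add: J5_def P_split power2_eq_square mult_ac)
  have R: "(if 0 \<in> classes {4, 0, 1} then 2 else 1) * (qprod (- 1) (gaps_above (classes {4, 0, 1}) 0) * qprod (- 1) (gaps_below (classes {4, 0, 1}) 0)) = M0 * M1 ^ 2"
    unfolding node_value_classes lessThan_5 by (simp add: M0_def P_split power2_eq_square mult_ac)
  note tr = three_term_relation[of "{4, 0, 1}" 4 0 1 2 ?K, OF refl _ _ _ _ _ base Dn R]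
  show "fls_X / (J5 ^ 2 * P1 * P2) * appell 2 4 + 1 / (J5 ^ 2 * P1 ^ 2) * appell 2 0 + fls_X / (J5 ^ 2 * P1 * P2) * appell 2 1 = 1 / (M0 * M1 ^ 2)"
    using tr(1) by simp
  show "fls_X / (J5 ^ 2 * P1 * P2) * wtsum 2 4 + 1 / (J5 ^ 2 * P1 ^ 2) * wtsum 2 0 + fls_X / (J5 ^ 2 * P1 * P2) * wtsum 2 1 = 0"
    using tr(2) by simp
  show "\<forall>c\<in>{4, 0, 1}. fsummable (\<lambda>n. wt 2 n / (1 + fls_X powi n)) {n. n mod 5 = c} \<and> fsummable (wt 2) {n. n mod 5 = c}"
    using tr(3,4) by simp
qed

lemma triple_2b:
  "1 / (J5 ^ 2 * P2 ^ 2) * appell 2 0 + - 1 / (J5 ^ 2 * P1 * P2) * appell 2 2 + - 1 / (J5 ^ 2 * P1 * P2) * appell 2 3 = 1 / (M0 * M2 ^ 2)"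
  "1 / (J5 ^ 2 * P2 ^ 2) * wtsum 2 0 + - 1 / (J5 ^ 2 * P1 * P2) * wtsum 2 2 + - 1 / (J5 ^ 2 * P1 * P2) * wtsum 2 3 = 0"
  "\<forall>c\<in>{0, 2, 3}. fsummable (\<lambda>n. wt 2 n / (1 + fls_X powi n)) {n. n mod 5 = c} \<and> fsummable (wt 2) {n. n mod 5 = c}"
proof -
  let ?K = "(\<lambda>c. if c = 0 then 1 else - 1) :: int \<Rightarrow> rat fls"
  have base: "c \<in> {0, 2, 3} \<Longrightarrow> ?K c \<noteq> 0 \<and> node_weight (classes {0, 2, 3}) c = ?K c * wt 2 c \<and> node_weight (classes {0, 2, 3}) (c - 5) = ?K c * wt 2 (c - 5)" for c
    by (elim insertE emptyE) (simp_all add: triple_simps)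
  have Dn: "n mod 5 \<in> {0, 2, 3} \<Longrightarrow> node_denominator (classes {0, 2, 3}) n = (if n mod 5 = 0 then J5 ^ 2 * P2 ^ 2 else J5 ^ 2 * P1 * P2)" for n
    unfolding node_denominator_classes lessThan_5
    by (elim insertE emptyE) (simp_all add: J5_def P_split power2_eq_square mult_ac)
  have R: "(if 0 \<in> classes {0, 2, 3} then 2 else 1) * (qprod (- 1) (gaps_above (classes {0, 2, 3}) 0) * qprod (- 1) (gaps_below (classes {0, 2, 3}) 0)) = M0 * M2 ^ 2"
    unfolding node_value_classes lessThan_5 by (simp add: M0_def P_split power2_eq_square mult_ac)
  note tr = three_term_relation[of "{0, 2, 3}" 0 2 3 2 ?K, OF refl _ _ _ _ _ base Dn R]
  show "1 / (J5 ^ 2 * P2 ^ 2) * appell 2 0 + - 1 / (J5 ^ 2 * P1 * P2) * appell 2 2 + - 1 / (J5 ^ 2 * P1 * P2) * appell 2 3 = 1 / (M0 * M2 ^ 2)"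
    using tr(1) by simp
  show "1 / (J5 ^ 2 * P2 ^ 2) * wtsum 2 0 + - 1 / (J5 ^ 2 * P1 * P2) * wtsum 2 2 + - 1 / (J5 ^ 2 * P1 * P2) * wtsum 2 3 = 0"
    using tr(2) by simp
  show "\<forall>c\<in>{0, 2, 3}. fsummable (\<lambda>n. wt 2 n / (1 + fls_X powi n)) {n. n mod 5 = c} \<and> fsummable (wt 2) {n. n mod 5 = c}"
    using tr(3,4) by simp
qed

section \<open>Dissections modulo 5\<close>

definition J1 :: "rat fls" where "J1 = qprod 1 {0<..}"

abbreviation sub5 :: "rat fls \<Rightarrow> rat fls" where "sub5 f \<equiv> fls_compose_power f 5"

lemma J1_unipotent: "unipotent J1"
  unfolding J1_def by (intro qprod_unipotent) auto

lemma J1_nonzero [simp]: "J1 \<noteq> 0"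
  by (intro unipotent_nonzero J1_unipotent)

lemma sub5_J1: "sub5 J1 = J5"
proof -
  have "(*) 5 ` {0<..} = res5 {0}" by (auto simp: residues_def image_iff elim!: dvdE)
  then show ?thesis by (simp add: J1_def J5_def fls_compose_power_qprod)
qed

lemma UNIV_mod_5: "(UNIV :: int set) = (\<Union>c\<in>{0, 1, 2, 3, 4}. {n. n mod 5 = c})"
proof -
  have "n mod 5 \<in> {0, 1, 2, 3, 4}" for n :: int
    using pos_mod_bound[of 5 n] pos_mod_sign[of 5 n] by auto
  then show ?thesis by auto
qed

lemma fsum_mod_5:
  fixes F :: "int \<Rightarrow> 'a::ab_group_add fls"
  assumes "\<And>c. c \<in> {0, 1, 2, 3, 4} \<Longrightarrow> fsummable F {n. n mod 5 = c}"
  shows "fsummable F UNIV" "fsum F UNIV = (\<Sum>c\<in>{0, 1, 2, 3, 4}. fsum F {n. n mod 5 = c})"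
proof -
  show 1: "fsummable F UNIV"
    unfolding UNIV_mod_5 by (rule fsummable_UN) (use assms in auto)
  show "fsum F UNIV = (\<Sum>c\<in>{0, 1, 2, 3, 4}. fsum F {n. n mod 5 = c})"
    using 1 unfolding UNIV_mod_5 by (intro fsum_UN_disjoint) (auto simp: disjoint_family_on_def)
qed

lemma pent_class:
  assumes "n mod 5 = c mod 5"
  shows "(pent n + b * n) mod 5 = (pent c + b * c) mod 5"
proof -
  obtain m where m: "n = c + 5 * m"
    using assms by (metis mod_eqE)
  define h where "h = m * (15 * m + 1) div 2"
  have h: "2 * h = m * (15 * m + 1)" unfolding h_def by simp
  have "2 * pent n = 2 * pent c + 5 * (6 * m * c) + 5 * (2 * h)"
    unfolding h two_pent m by (simp add: algebra_simps)
  then have "pent n + b * n = (pent c + b * c) + 5 * (3 * m * c + h + b * m)"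
    by (simp add: m algebra_simps)
  then show ?thesis by (simp only: mod_mult_self2)
qed

lemma wt_class:
  assumes "n mod 5 = c" "(pent c + b * c) mod 5 = int r"
  shows "alt n * fls_X powi (pent n + b * n) = fls_X ^ r * sub5 (wt b n)"
    and "alt n * fls_X powi (pent n + b * n) / (1 + fls_X powi (5 * n)) = fls_X ^ r * sub5 (wt b n / (1 + fls_X powi n))"
proof -
  have "(pent n + b * n) mod 5 = int r"
    using pent_class[of n c b] assms by (metis mod_mod_trivial)
  then have eq: "pent n + b * n = int r + 5 * ((pent n + b * n) div 5)"
    by (metis add.commute mult_div_mod_eq)
  show 1: "alt n * fls_X powi (pent n + b * n) = fls_X ^ r * sub5 (wt b n)"
    by (subst eq) (simp add: wt_def power_int_add mult_ac)
  show "alt n * fls_X powi (pent n + b * n) / (1 + fls_X powi (5 * n)) = fls_X ^ r * sub5 (wt b n / (1 + fls_X powi n))"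
    by (simp add: 1 fls_compose_power_divide)
qed

lemma fsum_wt_class:
  assumes "(pent c + b * c) mod 5 = int r"
  shows "fsummable (wt b) {n. n mod 5 = c} \<Longrightarrow>
      fsummable (\<lambda>n. alt n * fls_X powi (pent n + b * n) :: rat fls) {n. n mod 5 = c} \<and>
      fsum (\<lambda>n. alt n * fls_X powi (pent n + b * n)) {n. n mod 5 = c} = fls_X ^ r * sub5 (wtsum b c)"
    and "fsummable (\<lambda>n. wt b n / (1 + fls_X powi n)) {n. n mod 5 = c} \<Longrightarrow>
      fsummable (\<lambda>n. alt n * fls_X powi (pent n + b * n) / (1 + fls_X powi (5 * n)) :: rat fls) {n. n mod 5 = c} \<and>
      fsum (\<lambda>n. alt n * fls_X powi (pent n + b * n) / (1 + fls_X powi (5 * n))) {n. n mod 5 = c} = fls_X ^ r * sub5 (appell b c)"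
proof -
  have *: "fsummable F {n. n mod 5 = c} \<and> fsum F {n. n mod 5 = c} = fls_X ^ r * sub5 (fsum G {n. n mod 5 = c})"
    if "fsummable G {n. n mod 5 = c}" "\<And>n. n mod 5 = c \<Longrightarrow> F n = fls_X ^ r * sub5 (G n)" for F G :: "int \<Rightarrow> rat fls"
  proof -
    have s: "fsummable (\<lambda>n. sub5 (G n)) {n. n mod 5 = c}" by (rule fsum_compose_power(1)) (use that in auto)
    have "fsummable F {n. n mod 5 = c} \<longleftrightarrow> fsummable (\<lambda>n. fls_X ^ r * sub5 (G n)) {n. n mod 5 = c}"
      by (rule fsummable_cong) (use that in auto)
    moreover have "fsum F {n. n mod 5 = c} = fsum (\<lambda>n. fls_X ^ r * sub5 (G n)) {n. n mod 5 = c}"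
      by (rule fsum_cong) (use that in auto)
    ultimately show ?thesis
      using s that(1) by (simp add: fsummable_cmult fsum_cmult fsum_compose_power)
  qed
  show "fsummable (wt b) {n. n mod 5 = c} \<Longrightarrow>
      fsummable (\<lambda>n. alt n * fls_X powi (pent n + b * n) :: rat fls) {n. n mod 5 = c} \<and>
      fsum (\<lambda>n. alt n * fls_X powi (pent n + b * n)) {n. n mod 5 = c} = fls_X ^ r * sub5 (wtsum b c)"
    unfolding wtsum_def by (rule *[where G = "wt b"]) (use wt_class(1) assms in auto)
  show "fsummable (\<lambda>n. wt b n / (1 + fls_X powi n)) {n. n mod 5 = c} \<Longrightarrow>
      fsummable (\<lambda>n. alt n * fls_X powi (pent n + b * n) / (1 + fls_X powi (5 * n)) :: rat fls) {n. n mod 5 = c} \<and>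
      fsum (\<lambda>n. alt n * fls_X powi (pent n + b * n) / (1 + fls_X powi (5 * n))) {n. n mod 5 = c} = fls_X ^ r * sub5 (appell b c)"
    unfolding appell_def by (rule *[where G = "\<lambda>n. wt b n / (1 + fls_X powi n)"]) (use wt_class(2) assms in auto)
qed

text \<open>The reciprocal of the Rogers--Ramanujan continued fraction, without its factor \<open>q\<^bsup>1/5\<^esup>\<close>.\<close>

definition rr :: "rat fls" where "rr = P2 / P1"

lemma rr_nonzero [simp]: "rr \<noteq> 0"
  by (simp add: rr_def)

lemma rr_unipotent: "unipotent rr"
  unfolding rr_def divide_inverse P1_def P2_def
  by (intro unipotent_mult unipotent_inverse qprod_unipotent) auto

text \<open>For n = -5m - 1 the pentagonal exponent is 25 \<open>pent m\<close> + 1: this class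
  repeats the whole pentagonal series, and after the rounded division by 5 it is Euler's product in
  q^5, up to sign.\<close>

lemma wtsum_0_4: "wtsum 0 4 = - J5"
proof -
  have bij: "bij_betw (\<lambda>m. - 5 * m - 1) UNIV {n :: int. n mod 5 = 4}"
    by (rule bij_betwI[where g = "\<lambda>n. - ((n + 1) div 5)"]) (auto, presburger+)
  have "wt 0 (- 5 * m - 1) = - sub5 (alt m * fls_X powi pent m)" for m
  proof -
    have "2 * pent (- 5 * m - 1) = 2 * (25 * pent m + 1)"
      unfolding distrib_left mult.left_commute[of 2 25] two_pent by (simp add: algebra_simps)
    then have "pent (- 5 * m - 1) = 5 * (5 * pent m) + 1" by simp
    then have "pent (- 5 * m - 1) div 5 = 5 * pent m" by simp
    moreover have "alt (- 5 * m - 1) = (- alt m :: rat fls)" by (simp add: alt_def)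
    ultimately show ?thesis by (simp add: wt_def)
  qed
  then have "wtsum 0 4 = fsum (\<lambda>m. - sub5 (alt m * fls_X powi pent m)) UNIV"
    unfolding wtsum_def by (simp add: fsum_reindex_bij[OF bij])
  moreover have summ: "fsummable (\<lambda>m. alt m * fls_X powi pent m :: rat fls) UNIV"
    using fsum_wt_class(1)[of _ 0 "nat (pent _ mod 5)"] triple_0a(3) triple_0b(3)
    by (intro fsum_mod_5(1)) auto
  ultimately have "wtsum 0 4 = - sub5 (fsum (\<lambda>m. alt m * fls_X powi pent m) UNIV)"
    using fsum_compose_power[OF _ summ, of 5] by (simp add: fsum_uminus)
  then show ?thesis by (simp add: pentagonal_number_theorem sub5_J1 flip: J1_def)
qed

text \<open>The two relations for b = 0 without the factor 1 + q^n, solved by means of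
  \<open>wtsum_0_4\<close>. The three terms correspond to the residues 0, 1, 2 that pentagonal
  numbers take modulo 5.\<close>

lemma J1_dissection: "J1 = sub5 J5 * (sub5 rr - fls_X - fls_X ^ 2 / sub5 rr)"
proof -
  have cl: "fsummable (\<lambda>n. alt n * fls_X powi pent n :: rat fls) {n. n mod 5 = c} \<and>
      fsum (\<lambda>n. alt n * fls_X powi pent n) {n. n mod 5 = c} = fls_X ^ r * sub5 (wtsum 0 c)"
    if "pent c mod 5 = int r" "c \<in> {0, 1, 2, 3, 4}" for c r
    using fsum_wt_class(1)[of c 0 r] that triple_0a(3) triple_0b(3) by auto
  have "J1 = fsum (\<lambda>n. alt n * fls_X powi pent n) UNIV"
    by (simp add: J1_def pentagonal_number_theorem)
  also have "\<dots> = (\<Sum>c\<in>{0, 1, 2, 3, 4}. fsum (\<lambda>n. alt n * fls_X powi pent n) {n. n mod 5 = c})"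
    by (rule fsum_mod_5(2)) (use cl[of _ "nat (pent _ mod 5)"] in auto)
  also have "\<dots> = sub5 (wtsum 0 0) + fls_X ^ 2 * sub5 (wtsum 0 1) + fls_X ^ 2 * sub5 (wtsum 0 2) + sub5 (wtsum 0 3) + fls_X * sub5 (wtsum 0 4)"
  proof -
    have "pent 0 mod 5 = int 0" "pent 1 mod 5 = int 2" "pent 2 mod 5 = int 2" "pent 3 mod 5 = int 0" "pent 4 mod 5 = int 1"
      by (simp_all add: pent_def)
    from this[THEN cl] show ?thesis by simp
  qed
  also have "\<dots> = sub5 (wtsum 0 0 + wtsum 0 3) + fls_X ^ 2 * sub5 (wtsum 0 1 + wtsum 0 2) + fls_X * sub5 (wtsum 0 4)"
    by (simp add: algebra_simps)
  also have "wtsum 0 0 + wtsum 0 3 = rr * J5"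
  proof -
    have "(wtsum 0 0 + wtsum 0 3) / (J5 ^ 2 * P1 * P2) = J5 / (J5 ^ 2 * P1 ^ 2)"
      using triple_0a(2) by (simp add: wtsum_0_4 add_divide_distrib algebra_simps)
    then have "wtsum 0 0 + wtsum 0 3 = J5 / (J5 ^ 2 * P1 ^ 2) * (J5 ^ 2 * P1 * P2)"
      by (simp only: divide_eq_eq) simp
    then show ?thesis by (simp add: rr_def power2_eq_square)
  qed
  also have "wtsum 0 1 + wtsum 0 2 = - (J5 / rr)"
  proof -
    have "(wtsum 0 1 + wtsum 0 2) / (J5 ^ 2 * P1 * P2) = - (J5 / (J5 ^ 2 * P2 ^ 2))"
      using triple_0b(2) by (simp add: wtsum_0_4 add_divide_distrib algebra_simps add_eq_0_iff)
    then have "wtsum 0 1 + wtsum 0 2 = - (J5 / (J5 ^ 2 * P2 ^ 2)) * (J5 ^ 2 * P1 * P2)"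
      by (simp only: divide_eq_eq) simp
    then show ?thesis by (simp add: rr_def power2_eq_square)
  qed
  finally show ?thesis
    by (simp add: wtsum_0_4 fls_compose_power_divide algebra_simps)
qed

section \<open>Extraction of the exponents 4 modulo 5\<close>

definition part5 :: "rat fls \<Rightarrow> rat fls" where
  "part5 g = Abs_fls (\<lambda>n. g $$ (5 * n + 4))"

lemma part5_nth: "part5 g $$ n = g $$ (5 * n + 4)"
proof -
  obtain N where N: "\<forall>m<N. g $$ m = 0" using fls_nth_vanishes_belowE[of g] by metis
  then have "\<forall>n<(- \<bar>N\<bar> - 4). g $$ (5 * n + 4) = 0" by auto
  then show ?thesis unfolding part5_def by (subst nth_Abs_fls_lower_bound) auto
qed

lemma part5_sum: "part5 (\<Sum>i\<in>A. f i) = (\<Sum>i\<in>A. part5 (f i))"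
  by (rule fls_eqI) (simp add: part5_nth fls_nth_sum)

text \<open>Sums of two residues modulo 5 are at most 8, and in this range only 4 is congruent to
  4.\<close>

lemma part5_monomial:
  assumes "r < 9"
  shows "part5 (fls_X ^ r * sub5 f) = (if r = 4 then f else 0)"
proof (rule fls_eqI)
  fix n
  have "part5 (fls_X ^ r * sub5 f) $$ n = sub5 f $$ (5 * n + 4 - int r)"
    by (simp add: part5_nth fls_X_power_times_conv_shift)
  also have "\<dots> = (if r = 4 then f else 0) $$ n"
  proof (cases "r = 4")
    case False
    then have "\<not> 5 dvd (5 * n + 4 - int r)" using assms by presburger
    then show ?thesis using False by (simp add: fls_nth_compose_power)
  qed (simp add: fls_nth_compose_power)
  finally show "part5 (fls_X ^ r * sub5 f) $$ n = (if r = 4 then f else 0) $$ n" .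
qed

lemma part5_product:
  "part5 ((\<Sum>k<5. fls_X ^ k * sub5 (S k)) * (\<Sum>l<5. fls_X ^ l * sub5 (p l))) = (\<Sum>k<5. S k * p (4 - k))"
proof -
  have "(\<Sum>k<5. fls_X ^ k * sub5 (S k)) * (\<Sum>l<5. fls_X ^ l * sub5 (p l)) =
      (\<Sum>k<5. \<Sum>l<5. fls_X ^ (k + l) * sub5 (S k * p l))"
    by (simp add: sum_product power_add mult_ac)
  then have "part5 ((\<Sum>k<5. fls_X ^ k * sub5 (S k)) * (\<Sum>l<5. fls_X ^ l * sub5 (p l))) =
      (\<Sum>k<5. \<Sum>l<5. if l = 4 - k then S k * p l else 0)"
    by (simp only: part5_sum) (intro sum.cong refl, subst part5_monomial, auto)
  also have "\<dots> = (\<Sum>k<5. S k * p (4 - k))"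
    by (intro sum.cong refl, subst sum.delta) auto
  finally show ?thesis .
qed

text \<open>With alpha = \<open>sub5 rr\<close>, the series \<open>sub5 X5\<close> is the norm of
  alpha - q - q^2/alpha, that is, the product of its five versions with q multiplied by a fifth root
  of unity and alpha fixed.\<close>

definition X5 :: "rat fls" where "X5 = rr ^ 5 - 11 * fls_X - fls_X ^ 2 / rr ^ 5"

lemma X5_nonzero [simp]: "X5 \<noteq> 0"
proof -
  have "vanishes_below 0 (11 :: rat fls)" by (simp add: vanishes_below_def)
  then have "vanishes_below 1 (11 * fls_X + fls_X ^ 2 * inverse (rr ^ 5))"
    using vanishes_below_mult[of 0 "11 :: rat fls" 1 fls_X]
      vanishes_below_mult_int[of 1 "fls_X ^ 2" "inverse (rr ^ 5)"]
      vanishes_below_inverse_unipotent[OF unipotent_power[OF rr_unipotent, of 5]]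
      vanishes_below_X_power[of 1 1, where 'a = rat]
    by (intro vanishes_below_add) simp_all
  moreover have "vanishes_below 1 (rr ^ 5 - 1)" using unipotent_power[OF rr_unipotent, of 5] by (simp add: unipotent_def)
  ultimately have "vanishes_below 1 ((rr ^ 5 - 1) - (11 * fls_X + fls_X ^ 2 * inverse (rr ^ 5)))"
    using vanishes_below_diff by blast
  then have "unipotent X5" by (simp add: X5_def unipotent_def divide_inverse algebra_simps)
  then show ?thesis by (rule unipotent_nonzero)
qed

text \<open>The cofactor in the norm \<open>X5\<close>, sorted by exponents modulo 5: these are the
  components of the partition generating function, with q^5 replaced by q. The numerator 5 at l = 4
  is Ramanujan's congruence for p(5n + 4).\<close>

definition partition_part :: "nat \<Rightarrow> rat fls" where
  "partition_part l = (if l = 0 then rr ^ 4 - 3 * fls_X / rr else if l = 1 then rr ^ 3 + 2 * fls_X / rr ^ 2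
     else if l = 2 then 2 * rr ^ 2 - fls_X / rr ^ 3 else if l = 3 then 3 * rr + fls_X / rr ^ 4 else 5) / (J5 * X5)"

lemma inverse_J1_dissection: "inverse J1 = (\<Sum>l<5. fls_X ^ l * sub5 (partition_part l))"
proof -
  define \<alpha> where "\<alpha> = sub5 rr"
  have sub5_nz: "sub5 f \<noteq> 0" if "f \<noteq> 0" for f
    using that fls_compose_power_inverse[of 5 f] by (metis fls_compose_power_1_left fls_compose_power_mult mult_eq_0_iff right_inverse zero_less_numeral zero_neq_one)
  have \<alpha>0: "\<alpha> \<noteq> 0" "sub5 J5 \<noteq> 0" "sub5 X5 \<noteq> 0" by (simp_all add: \<alpha>_def sub5_nz)
  have X: "sub5 X5 = \<alpha> ^ 5 - 11 * fls_X ^ 5 - fls_X ^ 10 / \<alpha> ^ 5"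
    using fls_compose_power_X_power[of 5 1, where 'a = rat] by (simp add: X5_def \<alpha>_def fls_compose_power_divide)
  have X1: "sub5 fls_X = fls_X ^ 5"
    using fls_compose_power_X_power[of 5 1, where 'a = rat] by simp
  let ?q = "fls_X :: rat fls"
  define B where "B = \<alpha> ^ 4 - 3 * ?q ^ 5 / \<alpha> + ?q * (\<alpha> ^ 3 + 2 * ?q ^ 5 / \<alpha> ^ 2) + ?q ^ 2 * (2 * \<alpha> ^ 2 - ?q ^ 5 / \<alpha> ^ 3) + ?q ^ 3 * (3 * \<alpha> + ?q ^ 5 / \<alpha> ^ 4) + ?q ^ 4 * 5"
  have "(\<Sum>l<5. ?q ^ l * sub5 (partition_part l)) = B / (sub5 J5 * sub5 X5)"
    unfolding lessThan_5 B_def by (simp add: partition_part_def fls_compose_power_divide X1 add_divide_distrib flip: \<alpha>_def)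
  moreover have "(\<alpha> - ?q - ?q ^ 2 / \<alpha>) * B = sub5 X5"
    unfolding X B_def using \<alpha>0(1) by (simp add: field_simps power_numeral_reduce)
  then have "J1 * B = sub5 J5 * sub5 X5"
    by (simp add: J1_dissection mult.assoc flip: \<alpha>_def)
  then have "inverse J1 = B / (sub5 J5 * sub5 X5)"
    using \<alpha>0 by (simp add: field_simps)
  ultimately show ?thesis by simp
qed

section \<open>Watson's sum over denominators in q^5\<close>

definition appell_term :: "int \<Rightarrow> int \<Rightarrow> rat fls" where
  "appell_term b n = alt n * fls_X powi (pent n + b * n) / (1 + fls_X powi (5 * n))"

lemma appell_term_dissection:
  assumes "\<And>c. c \<in> {0, 1, 2, 3, 4} \<Longrightarrow> fsummable (\<lambda>n. wt b n / (1 + fls_X powi n)) {n. n mod 5 = c}"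
  shows "fsummable (appell_term b) UNIV"
    and "fsum (appell_term b) UNIV = (\<Sum>c\<in>{0, 1, 2, 3, 4}. fls_X ^ nat ((pent c + b * c) mod 5) * sub5 (appell b c))"
proof -
  have *: "fsummable (appell_term b) {n. n mod 5 = c} \<and>
      fsum (appell_term b) {n. n mod 5 = c} = fls_X ^ nat ((pent c + b * c) mod 5) * sub5 (appell b c)" if "c \<in> {0, 1, 2, 3, 4}" for c
    unfolding appell_term_def[abs_def] by (rule fsum_wt_class(2)) (use assms[OF that] in auto)
  show "fsummable (appell_term b) UNIV"
    by (rule fsum_mod_5(1)) (use * in blast)
  show "fsum (appell_term b) UNIV = (\<Sum>c\<in>{0, 1, 2, 3, 4}. fls_X ^ nat ((pent c + b * c) mod 5) * sub5 (appell b c))"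
    by (subst fsum_mod_5(2)) (use * in \<open>auto intro!: sum.cong\<close>)
qed

text \<open>Since pent(-n) = pent n - n and 1/(1 + q^(-5n)) = q^(5n)/(1 + q^(5n)), reflection
  exchanges b and 4 - b; the cases b = 3 and 4 thus reduce to b = 1 and 0.\<close>

lemma appell_term_reflect: "appell_term (4 - b) (- n) = appell_term b n"
proof -
  have "2 * (pent (- n) + (4 - b) * (- n) + 5 * n) = 2 * (pent n + b * n)"
    unfolding distrib_left two_pent by (simp add: algebra_simps)
  then have e: "pent (- n) + (4 - b) * (- n) + 5 * n = pent n + b * n"
    by (rule mult_left_cancel[THEN iffD1, rotated]) simp
  have "fls_X powi (5 * n) * (1 + fls_X powi (5 * (- n))) = (1 + fls_X powi (5 * n) :: rat fls)"
    by (simp add: distrib_left flip: power_int_add)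
  then have "appell_term (4 - b) (- n) = alt n * fls_X powi (pent (- n) + (4 - b) * (- n)) / ((1 + fls_X powi (5 * n)) / fls_X powi (5 * n))"
    by (simp add: appell_term_def field_simps)
  also have "\<dots> = alt n * (fls_X powi (pent (- n) + (4 - b) * (- n)) * fls_X powi (5 * n)) / (1 + fls_X powi (5 * n))"
    by simp
  also have "fls_X powi (pent (- n) + (4 - b) * (- n)) * fls_X powi (5 * n) = (fls_X powi (pent n + b * n) :: rat fls)"
    by (subst power_int_add[symmetric]) (simp, simp only: e)
  also have "alt n * fls_X powi (pent n + b * n) / (1 + fls_X powi (5 * n)) = appell_term b n"
    by (simp add: appell_term_def)
  finally show ?thesis .
qed

text \<open>The expansion 1/(1 + x) = (1 - x + x^2 - x^3 + x^4)/(1 + x^5) with x = q^k makes all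
  denominators series in q^5, so that only numerators have to be dissected.\<close>

lemma mock_f_dissection:
  "fps_to_fls mock_f * J1 = 2 * (fsum (appell_term 2) UNIV - 2 * fsum (appell_term 1) UNIV + 2 * fsum (appell_term 0) UNIV)"
proof -
  have s: "fsummable (appell_term 0) UNIV" "fsummable (appell_term 1) UNIV" "fsummable (appell_term 2) UNIV"
    using triple_0a(3) triple_0b(3) triple_1a(3) triple_1b(3) triple_2a(3) triple_2b(3)
    by (auto intro!: appell_term_dissection(1))
  have bij: "bij_betw uminus (UNIV :: int set) UNIV" by (rule bij_betwI[where g = uminus]) auto
  have r: "fsummable (appell_term (4 - b)) UNIV \<and> fsum (appell_term (4 - b)) UNIV = fsum (appell_term b) UNIV"
    if "fsummable (appell_term b) UNIV" for b
    using that fsum_reindex_bij[OF bij, of "appell_term (4 - b)"] fsummable_reindex_bij[OF bij, of "appell_term (4 - b)"]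
    by (simp only: appell_term_reflect)
  from r[OF s(1)] r[OF s(2)] have s': "fsummable (appell_term 4) UNIV" "fsummable (appell_term 3) UNIV"
    "fsum (appell_term 4) UNIV = fsum (appell_term 0) UNIV" "fsum (appell_term 3) UNIV = fsum (appell_term 1) UNIV"
    by simp_all
  have eq: "2 * (alt k * fls_X powi pent k / (1 + fls_X powi k)) =
      2 * (appell_term 0 k - appell_term 1 k + appell_term 2 k - appell_term 3 k + appell_term 4 k)" for k
  proof -
    define x where "x = (fls_X powi k :: rat fls)"
    have x5: "fls_X powi (5 * k) = x ^ 5" by (simp add: x_def power_int_power' mult.commute)
    have t: "appell_term (int b) k = alt k * fls_X powi pent k * x ^ b / (1 + x ^ 5)" for b
      by (simp add: appell_term_def x5 power_int_add x_def power_int_power' mult.commute mult.left_commute)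
    have nz: "1 + x \<noteq> 0" "1 + x ^ 5 \<noteq> 0"
      using one_plus_X_powi_nonzero[of k, where 'a = rat] one_plus_X_powi_nonzero[of "5 * k", where 'a = rat]
      unfolding x5 x_def by simp_all
    have "1 + x ^ 5 = (1 + x) * (1 - x + x ^ 2 - x ^ 3 + x ^ 4)" by (simp add: algebra_simps power_numeral_reduce)
    then have "1 / (1 + x) = (1 - x + x ^ 2 - x ^ 3 + x ^ 4) / (1 + x ^ 5)" using nz by (simp add: field_simps)
    then have "alt k * fls_X powi pent k / (1 + x) = alt k * fls_X powi pent k * ((1 - x + x ^ 2 - x ^ 3 + x ^ 4) / (1 + x ^ 5))"
      by (metis mult.right_neutral times_divide_eq_right)
    also have "\<dots> = appell_term 0 k - appell_term 1 k + appell_term 2 k - appell_term 3 k + appell_term 4 k"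
      using t[of 0] t[of 1] t[of 2] t[of 3] t[of 4] by (simp add: add_divide_distrib diff_divide_distrib algebra_simps)
    finally show ?thesis by (simp add: x_def)
  qed
  have "fps_to_fls mock_f * J1 = fsum (\<lambda>k. 2 * (alt k * fls_X powi pent k / (1 + fls_X powi k))) UNIV"
    by (simp only: fps_to_fls_mock_f watson flip: J1_def) simp
  also have "\<dots> = 2 * (fsum (appell_term 0) UNIV - fsum (appell_term 1) UNIV + fsum (appell_term 2) UNIV - fsum (appell_term 3) UNIV + fsum (appell_term 4) UNIV)"
    using s s'(1,2) by (simp only: eq fsum_cmult fsum_add fsum_diff fsummable_add fsummable_diff)
  finally show ?thesis by (simp add: s'(3,4) algebra_simps)
qed

text \<open>For n = 5m the exponent pent n + 2n equals 25 pent m, so the central class of b = 2 is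
  Watson's own sum, in q^5 after the division by 5. This is where the terms a_f(n/5) come
  from.\<close>

lemma sub5_mock_f: "sub5 (fps_to_fls mock_f) = 2 * appell 2 0 / J5"
proof -
  let ?g = "\<lambda>k. 2 * (alt k * fls_X powi pent k / (1 + fls_X powi k)) :: rat fls"
  have bij: "bij_betw (\<lambda>m. 5 * m) UNIV {n :: int. n mod 5 = 0}"
    by (rule bij_betwI[where g = "\<lambda>n. n div 5"]) auto
  have w: "wt 2 (5 * m) / (1 + fls_X powi (5 * m)) = inverse 2 * sub5 (?g m)" for m
  proof -
    have "2 * (pent (5 * m) + 2 * (5 * m)) = 2 * (5 * (5 * pent m))"
      unfolding distrib_left mult.left_commute[of 2 5] two_pent by (simp add: algebra_simps)
    then have "(pent (5 * m) + 2 * (5 * m)) div 5 = 5 * pent m" by simp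
    moreover have "alt (5 * m) = (alt m :: rat fls)" by (simp add: alt_def)
    ultimately show ?thesis by (simp add: wt_def fls_compose_power_divide)
  qed
  have a: "appell 2 0 = fsum (\<lambda>m. inverse 2 * sub5 (?g m)) UNIV"
    unfolding appell_def by (simp only: fsum_reindex_bij[OF bij] w)
  have "fsummable (\<lambda>n. wt 2 n / (1 + fls_X powi n)) {n. n mod 5 = 0}" using triple_2a(3) by simp
  then have s1: "fsummable (\<lambda>m. inverse 2 * sub5 (?g m)) UNIV"
    by (simp only: fsummable_reindex_bij[OF bij] w)
  have s2: "fsummable ?g UNIV"
  proof (rule fsummableI_int[where c = 1])
    fix k :: int
    have "2 * (\<bar>k\<bar> - 1) \<le> 2 * pent k"
    proof -
      have "3 * \<bar>k\<bar> \<le> 3 * (k * k) + 2"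
      proof (cases "k = 0")
        case False
        then have "\<bar>k\<bar> * 1 \<le> \<bar>k\<bar> * \<bar>k\<bar>" by (intro mult_left_mono) auto
        then show ?thesis by simp
      qed simp
      then show ?thesis unfolding two_pent by (simp add: algebra_simps abs_if split: if_splits)
    qed
    then have "vanishes_below (\<bar>k\<bar> - 1) (alt k * fls_X powi pent k * inverse (1 + fls_X powi k) :: rat fls)"
      by (intro vanishes_below_mult_int[OF _ vanishes_below_inverse_one_plus_X_powi]) simp
    then show "vanishes_below (\<bar>k\<bar> - 1) (?g k)"
      unfolding divide_inverse by (rule vanishes_below_int_mult[OF vanishes_below_two])
  qed
  have "appell 2 0 = inverse 2 * sub5 (fsum ?g UNIV)"
    unfolding a using fsum_compose_power[OF _ s2, of 5] by (simp only: fsum_cmult zero_less_numeral)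
  also have "fsum ?g UNIV = fps_to_fls mock_f * J1"
    by (simp only: fps_to_fls_mock_f watson flip: J1_def) simp
  finally show ?thesis by (simp add: sub5_J1 field_simps)
qed

lemma part5_mock_f:
  defines "p \<equiv> partition_part"
  shows "part5 (fps_to_fls mock_f) =
    2 * (appell 2 0 * p 4 + (appell 2 1 + appell 2 4) * p 0 + (appell 2 2 + appell 2 3) * p 3)
    - 4 * ((appell 1 0 + appell 1 4) * p 4 + (appell 1 1 + appell 1 3) * p 1 + appell 1 2 * p 0)
    + 4 * ((appell 0 0 + appell 0 3) * p 4 + (appell 0 1 + appell 0 2) * p 2 + appell 0 4 * p 3)"
proof -
  \<comment> \<open>The component of f J1 with exponents k modulo 5, collected from the residues of
    pent c + b c.\<close>
  define S where "S k = (if k = 0 then 2 * appell 2 0 - 4 * (appell 1 0 + appell 1 4) + 4 * (appell 0 0 + appell 0 3)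
    else if k = 1 then 2 * (appell 2 2 + appell 2 3) + 4 * appell 0 4
    else if k = 2 then 4 * (appell 0 1 + appell 0 2)
    else if k = 3 then - 4 * (appell 1 1 + appell 1 3)
    else 2 * (appell 2 1 + appell 2 4) - 4 * appell 1 2)" for k :: nat
  have T0: "fsum (appell_term 0) UNIV = sub5 (appell 0 0) + fls_X ^ 2 * sub5 (appell 0 1) + fls_X ^ 2 * sub5 (appell 0 2) + sub5 (appell 0 3) + fls_X * sub5 (appell 0 4)"
    using triple_0a(3) triple_0b(3) by (subst appell_term_dissection(2)) (auto simp: pent_def)
  have T1: "fsum (appell_term 1) UNIV = sub5 (appell 1 0) + fls_X ^ 3 * sub5 (appell 1 1) + fls_X ^ 4 * sub5 (appell 1 2) + fls_X ^ 3 * sub5 (appell 1 3) + sub5 (appell 1 4)"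
    using triple_1a(3) triple_1b(3) by (subst appell_term_dissection(2)) (auto simp: pent_def)
  have T2: "fsum (appell_term 2) UNIV = sub5 (appell 2 0) + fls_X ^ 4 * sub5 (appell 2 1) + fls_X * sub5 (appell 2 2) + fls_X * sub5 (appell 2 3) + fls_X ^ 4 * sub5 (appell 2 4)"
    using triple_2a(3) triple_2b(3) by (subst appell_term_dissection(2)) (auto simp: pent_def)
  have "fps_to_fls mock_f * J1 = (\<Sum>k<5. fls_X ^ k * sub5 (S k))"
    unfolding mock_f_dissection T0 T1 T2 lessThan_5 by (simp add: S_def algebra_simps)
  then have "fps_to_fls mock_f = (\<Sum>k<5. fls_X ^ k * sub5 (S k)) * (\<Sum>l<5. fls_X ^ l * sub5 (p l))"
    unfolding p_def inverse_J1_dissection[symmetric] by (simp add: field_simps)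
  then have "part5 (fps_to_fls mock_f) = (\<Sum>k<5. S k * p (4 - k))"
    by (simp only: part5_product)
  then show ?thesis unfolding lessThan_5 by (simp add: S_def algebra_simps)
qed

text \<open>Both outer classes of a triple carry the same coefficient, so each relation determines
  the sum of the two outer pieces from the central one.\<close>

lemma appell_relations:
  defines "D \<equiv> J5 ^ 2 * P1 * P2"
  shows "appell 0 0 + appell 0 3 = D / (M0 * M1 * M2) - rr * appell 0 4"
    and "appell 0 1 + appell 0 2 = appell 0 4 / rr - D / (M1 ^ 2 * M2)"
    and "appell 1 1 + appell 1 3 = - rr * appell 1 2 - D / (M1 * M2 ^ 2)"
    and "appell 1 0 + appell 1 4 = D / (M0 * M1 * M2) + fls_X * appell 1 2 / rr"
    and "fls_X * (appell 2 1 + appell 2 4) = D / (M0 * M1 ^ 2) - rr * appell 2 0"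
    and "appell 2 2 + appell 2 3 = appell 2 0 / rr - D / (M0 * M2 ^ 2)"
proof -
  have D: "D \<noteq> 0" by (simp add: D_def)
  have D1: "J5 ^ 2 * P1 ^ 2 = D / rr" by (simp add: D_def rr_def power2_eq_square)
  have D2: "J5 ^ 2 * P2 ^ 2 = D * rr" by (simp add: D_def rr_def power2_eq_square)
  note [simp] = D
  have solve: "x = y * D" if "x / D = y" for x y using that D by (metis nonzero_divide_eq_eq)
  show "appell 0 0 + appell 0 3 = D / (M0 * M1 * M2) - rr * appell 0 4"
  proof -
    have "(appell 0 0 + rr * appell 0 4 + appell 0 3) / D = 1 / (M0 * M1 * M2)"
      using triple_0a(1)[folded D_def, unfolded D1]
      by (simp add: add_divide_distrib diff_divide_distrib algebra_simps)
    from solve[OF this] show ?thesis by (simp add: algebra_simps)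
  qed
  show "appell 0 1 + appell 0 2 = appell 0 4 / rr - D / (M1 ^ 2 * M2)"
  proof -
    have "(- appell 0 1 - appell 0 2 + appell 0 4 / rr) / D = 1 / (M1 ^ 2 * M2)"
      using triple_0b(1)[folded D_def, unfolded D2]
      by (simp add: add_divide_distrib diff_divide_distrib algebra_simps)
    from solve[OF this] show ?thesis by (simp add: algebra_simps)
  qed
  show "appell 1 1 + appell 1 3 = - rr * appell 1 2 - D / (M1 * M2 ^ 2)"
  proof -
    have "- ((appell 1 1 + appell 1 3 + rr * appell 1 2) / D) = 1 / (M1 * M2 ^ 2)"
      using triple_1a(1)[folded D_def, unfolded D1]
      by (simp add: add_divide_distrib diff_divide_distrib algebra_simps)
    then have "(appell 1 1 + appell 1 3 + rr * appell 1 2) / D = - (1 / (M1 * M2 ^ 2))"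
      by (metis minus_minus)
    then have "appell 1 1 + appell 1 3 = - (1 / (M1 * M2 ^ 2)) * D - rr * appell 1 2"
      unfolding eq_diff_eq by (rule solve)
    then show ?thesis by simp
  qed
  show "appell 1 0 + appell 1 4 = D / (M0 * M1 * M2) + fls_X * appell 1 2 / rr"
  proof -
    have "(appell 1 0 + appell 1 4 - fls_X * appell 1 2 / rr) / D = 1 / (M0 * M1 * M2)"
      using triple_1b(1)[folded D_def, unfolded D2]
      by (simp add: add_divide_distrib diff_divide_distrib algebra_simps)
    from solve[OF this] show ?thesis by (simp add: algebra_simps)
  qed
  show "fls_X * (appell 2 1 + appell 2 4) = D / (M0 * M1 ^ 2) - rr * appell 2 0"
  proof -
    have "(fls_X * appell 2 1 + fls_X * appell 2 4 + rr * appell 2 0) / D = 1 / (M0 * M1 ^ 2)"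
      using triple_2a(1)[folded D_def, unfolded D1]
      by (simp add: add_divide_distrib diff_divide_distrib algebra_simps)
    from solve[OF this] show ?thesis by (simp add: algebra_simps)
  qed
  show "appell 2 2 + appell 2 3 = appell 2 0 / rr - D / (M0 * M2 ^ 2)"
  proof -
    have "(- appell 2 2 - appell 2 3 + appell 2 0 / rr) / D = 1 / (M0 * M2 ^ 2)"
      using triple_2b(1)[folded D_def, unfolded D2]
      by (simp add: add_divide_distrib diff_divide_distrib algebra_simps)
    from solve[OF this] show ?thesis by (simp add: algebra_simps)
  qed
qed

text \<open>The total coefficient of the central piece is 0 for b = 0 and b = 1 and
  -\<open>X5\<close> for b = 2. Through the denominator \<open>J5 * X5\<close> of
  \<open>partition_part\<close> the latter leaves -2 \<open>appell 2 0\<close> / \<open>J5\<close>,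
  which f(q^5) cancels exactly.\<close>

lemma hecke_sum_product:
  "fls_X * part5 (fps_to_fls mock_f) + sub5 (fps_to_fls mock_f) =
    2 * J5 * P1 * P2 / X5 * ((rr ^ 4 - 3 * fls_X / rr) / (M0 * M1 ^ 2) - fls_X * (3 * rr + fls_X / rr ^ 4) / (M0 * M2 ^ 2)
      - 2 * fls_X * (2 * rr ^ 2 - fls_X / rr ^ 3) / (M1 ^ 2 * M2) + 2 * fls_X * (rr ^ 3 + 2 * fls_X / rr ^ 2) / (M1 * M2 ^ 2))"
proof -
  define D where "D = J5 ^ 2 * P1 * P2"
  define c where "c = 1 / (J5 * X5)"
  note ap = appell_relations[folded D_def]
  let ?q = "fls_X :: rat fls"
  define p0 where "p0 = rr ^ 4 - 3 * ?q / rr"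
  define p1 where "p1 = rr ^ 3 + 2 * ?q / rr ^ 2"
  define p2 where "p2 = 2 * rr ^ 2 - ?q / rr ^ 3"
  define p3 where "p3 = 3 * rr + ?q / rr ^ 4"
  note ps = p0_def p1_def p2_def p3_def
  have p: "partition_part 0 = c * p0" "partition_part 1 = c * p1" "partition_part 2 = c * p2" "partition_part 3 = c * p3" "partition_part 4 = c * 5"
    by (simp_all add: partition_part_def c_def ps)
  have b2: "?q * (appell 2 0 * 5 + (appell 2 1 + appell 2 4) * p0 + (appell 2 2 + appell 2 3) * p3) =
      - (appell 2 0 * X5) + D * (p0 / (M0 * M1 ^ 2) - ?q * p3 / (M0 * M2 ^ 2))"
  proof -
    have "?q * (appell 2 0 * 5 + (appell 2 1 + appell 2 4) * p0 + (appell 2 2 + appell 2 3) * p3) =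
       5 * ?q * appell 2 0 + (?q * (appell 2 1 + appell 2 4)) * p0 + ?q * (appell 2 2 + appell 2 3) * p3"
      by (simp add: algebra_simps)
    also have "\<dots> = appell 2 0 * (5 * ?q - rr * p0 + ?q * p3 / rr) + D * (p0 / (M0 * M1 ^ 2) - ?q * p3 / (M0 * M2 ^ 2))"
      unfolding ap(5,6) by (simp add: divide_inverse algebra_simps)
    also have "5 * ?q - rr * p0 + ?q * p3 / rr = - X5"
      by (simp add: ps X5_def field_simps power_numeral_reduce)
    finally show ?thesis by simp
  qed
  have b1: "(appell 1 0 + appell 1 4) * 5 + (appell 1 1 + appell 1 3) * p1 + appell 1 2 * p0 =
      D * (5 / (M0 * M1 * M2) - p1 / (M1 * M2 ^ 2))"
  proof -
    have "(appell 1 0 + appell 1 4) * 5 + (appell 1 1 + appell 1 3) * p1 + appell 1 2 * p0 =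
        appell 1 2 * (5 * ?q / rr - rr * p1 + p0) + D * (5 / (M0 * M1 * M2) - p1 / (M1 * M2 ^ 2))"
      unfolding ap(3,4) by (simp add: divide_inverse algebra_simps)
    also have "5 * ?q / rr - rr * p1 + p0 = 0"
      by (simp add: ps field_simps power_numeral_reduce)
    finally show ?thesis by simp
  qed
  have b0: "(appell 0 0 + appell 0 3) * 5 + (appell 0 1 + appell 0 2) * p2 + appell 0 4 * p3 =
      D * (5 / (M0 * M1 * M2) - p2 / (M1 ^ 2 * M2))"
  proof -
    have "(appell 0 0 + appell 0 3) * 5 + (appell 0 1 + appell 0 2) * p2 + appell 0 4 * p3 =
        appell 0 4 * (p2 / rr - 5 * rr + p3) + D * (5 / (M0 * M1 * M2) - p2 / (M1 ^ 2 * M2))"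
      unfolding ap(1,2) by (simp add: divide_inverse algebra_simps)
    also have "p2 / rr - 5 * rr + p3 = 0"
      by (simp add: ps field_simps power_numeral_reduce)
    finally show ?thesis by simp
  qed
  have "?q * part5 (fps_to_fls mock_f) =
      c * (2 * (?q * (appell 2 0 * 5 + (appell 2 1 + appell 2 4) * p0 + (appell 2 2 + appell 2 3) * p3))
        - 4 * ?q * ((appell 1 0 + appell 1 4) * 5 + (appell 1 1 + appell 1 3) * p1 + appell 1 2 * p0)
        + 4 * ?q * ((appell 0 0 + appell 0 3) * 5 + (appell 0 1 + appell 0 2) * p2 + appell 0 4 * p3))"
    unfolding part5_mock_f p by (simp add: algebra_simps)
  also have "\<dots> = - (2 * appell 2 0 * (c * X5)) + 2 * (c * D) * (p0 / (M0 * M1 ^ 2) - ?q * p3 / (M0 * M2 ^ 2)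
      - 2 * ?q * p2 / (M1 ^ 2 * M2) + 2 * ?q * p1 / (M1 * M2 ^ 2))"
    unfolding b0 b1 b2 by (simp add: divide_inverse algebra_simps)
  also have "c * X5 = 1 / J5" by (simp add: c_def)
  also have "c * D = J5 * P1 * P2 / X5" by (simp add: c_def D_def power2_eq_square)
  finally show ?thesis by (simp add: sub5_mock_f ps)
qed

lemma generating_function_eq:
  "fps_to_fls (Abs_fps (\<lambda>n. a_f (5 * of_nat n - 1) + a_f (of_nat n / 5))) =
     fls_X * part5 (fps_to_fls mock_f) + sub5 (fps_to_fls mock_f)"
proof (rule fls_eqI)
  fix k :: int
  have X: "(fls_X * part5 g) $$ k = g $$ (5 * k - 1)" for g
    by (simp add: fls_X_times_conv_shift part5_nth algebra_simps)
  show "fps_to_fls (Abs_fps (\<lambda>n. a_f (5 * of_nat n - 1) + a_f (of_nat n / 5))) $$ k =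
     (fls_X * part5 (fps_to_fls mock_f) + sub5 (fps_to_fls mock_f)) $$ k"
  proof (cases "k \<ge> 0")
    case False
    then show ?thesis by (simp add: X fls_nth_compose_power pos_imp_zdiv_neg_iff)
  next
    case True
    define n where "n = nat k"
    have k: "k = int n" using True by (simp add: n_def)
    have 1: "a_f (5 * of_nat n - 1) = fps_to_fls mock_f $$ (5 * k - 1)"
    proof (cases n)
      case 0
      \<comment> \<open>At n = 0 the convention a_f(-1) = 0 matches the vanishing of a power series
        at negative exponents.\<close>
      have "(- 1 :: rat) \<notin> \<nat>" by (auto elim!: Nats_cases)
      then show ?thesis by (simp add: 0 k a_f_def)
    next
      case (Suc m)
      have "5 * of_nat n - 1 = (of_nat (5 * m + 4) :: rat)" by (simp add: Suc)
      moreover have "5 * k - 1 = int (5 * m + 4)" by (simp add: Suc k)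
      moreover have "fps_to_fls mock_f $$ int j = mock_f $ j" for j by simp
      ultimately show ?thesis by (simp only: a_f_of_nat)
    qed
    have 2: "a_f (of_nat n / 5) = sub5 (fps_to_fls mock_f) $$ k"
    proof (cases "5 dvd n")
      case True
      then obtain m where "n = 5 * m" by auto
      then show ?thesis using a_f_of_nat[of m] by (simp add: k fls_nth_compose_power)
    next
      case False
      have "(of_nat n / 5 :: rat) \<notin> \<nat>"
      proof
        assume "(of_nat n / 5 :: rat) \<in> \<nat>"
        then obtain m where "(of_nat n / 5 :: rat) = of_nat m" by (auto elim!: Nats_cases)
        then have "(of_nat n :: rat) = of_nat (5 * m)" by simp
        then have "n = 5 * m" by (simp only: of_nat_eq_iff)
        then show False using False by simp
      qed
      then show ?thesis using False by (simp add: a_f_def k)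
    qed
    show ?thesis using True by (simp add: X 1 2 flip: n_def)
  qed
qed

section \<open>The Jacobi triple product\<close>

definition qfacd :: "nat \<Rightarrow> nat \<Rightarrow> rat fls" where
  "qfacd d n = (\<Prod>i\<in>{1..n}. 1 - fls_X ^ (d * i))"

lemma qfacd_0 [simp]: "qfacd d 0 = 1"
  by (simp add: qfacd_def)

lemma qfacd_Suc: "qfacd d (Suc n) = qfacd d n * (1 - fls_X ^ (d * Suc n))"
  unfolding qfacd_def by (subst prod.nat_ivl_Suc') (auto simp: mult.commute)

lemma qfacd_unipotent: "d > 0 \<Longrightarrow> unipotent (qfacd d n)"
  unfolding qfacd_def by (intro unipotent_prod unipotent_one_minus_X_power) auto

text \<open>Induction on M by the q-Pascal rule B(M+1, k+1) = B(M, k+1) + q^(d(M-k)) B(M,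
  k).\<close>

lemma q_binomial_theorem:
  assumes "d > 0"
  shows "(\<Prod>i<M. 1 + y * fls_X ^ (d * i)) =
    (\<Sum>k\<le>M. fls_X ^ (d * (k * (k - 1) div 2)) * y ^ k * (qfacd d M / (qfacd d k * qfacd d (M - k))))"
proof (induction M)
  case (Suc M)
  let ?q = "\<lambda>n. fls_X ^ (d * n) :: rat fls"
  define B where "B M k = qfacd d M / (qfacd d k * qfacd d (M - k))" for M k
  define a where "a M k = ?q (k * (k - 1) div 2) * y ^ k * B M k" for M k
  have nz: "qfacd d n \<noteq> 0" for n by (intro unipotent_nonzero qfacd_unipotent assms)
  have nz': "1 - ?q (Suc n) \<noteq> 0" for n
    using assms by (intro unipotent_nonzero unipotent_one_minus_X_power) simp
  have pascal: "B (Suc M) (Suc k) = B M (Suc k) + ?q (M - k) * B M k" if "k < M" for k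
  proof -
    have 1: "qfacd d (M - k) = qfacd d (M - Suc k) * (1 - ?q (M - k))"
      using qfacd_Suc[of d "M - Suc k"] that by (simp add: Suc_diff_Suc)
    have 2: "?q (Suc M) = ?q (M - k) * ?q (Suc k)"
    proof -
      have "d * Suc M = d * (M - k) + d * Suc k" using that by (subst distrib_left[symmetric]) simp
      then show ?thesis by (simp only: power_add)
    qed
    have 3: "1 - ?q (M - k) \<noteq> 0" using nz'[of "M - Suc k"] that by (simp add: Suc_diff_Suc)
    have "B M (Suc k) = qfacd d M * (1 - ?q (M - k)) / (qfacd d (Suc k) * qfacd d (M - k))"
      using 3 nz[of "M - Suc k"] nz[of "Suc k"] by (simp add: B_def 1)
    moreover have "B M k = qfacd d M * (1 - ?q (Suc k)) / (qfacd d (Suc k) * qfacd d (M - k))"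
      using nz' nz by (simp add: B_def qfacd_Suc)
    moreover have "B (Suc M) (Suc k) = qfacd d M * (1 - ?q (Suc M)) / (qfacd d (Suc k) * qfacd d (M - k))"
      by (simp add: B_def qfacd_Suc)
    moreover have "qfacd d M * (1 - ?q (Suc M)) = qfacd d M * (1 - ?q (M - k)) + ?q (M - k) * (qfacd d M * (1 - ?q (Suc k)))"
      by (simp only: 2) (simp only: algebra_simps mult_1)
    ultimately show ?thesis by (simp add: add_divide_distrib)
  qed
  have B0: "B M 0 = 1" "B M M = 1" for M using nz by (simp_all add: B_def)
  have step: "a (Suc M) (Suc k) = a M (Suc k) + a M k * (y * ?q M)" if "k < M" for k
  proof -
    have "Suc k * (Suc k - 1) div 2 = k * (k - 1) div 2 + k"
      by (cases k) auto
    moreover from this have "Suc k * (Suc k - 1) div 2 + (M - k) = k * (k - 1) div 2 + M" using that by simp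
    then have "?q (Suc k * (Suc k - 1) div 2) * ?q (M - k) = ?q (k * (k - 1) div 2) * ?q M"
      by (simp only: distrib_left[symmetric] power_add[symmetric])
    ultimately show ?thesis
      unfolding a_def pascal[OF that] by (simp add: distrib_left)
  qed
  have top: "a (Suc M) (Suc M) = a M M * (y * ?q M)"
  proof -
    have "Suc M * (Suc M - 1) div 2 = M * (M - 1) div 2 + M" by (cases M) auto
    then have "?q (Suc M * (Suc M - 1) div 2) = ?q (M * (M - 1) div 2) * ?q M"
      by (simp only: distrib_left[symmetric] power_add[symmetric])
    then show ?thesis by (simp add: a_def B0 mult_ac del: mult_Suc)
  qed
  have "(\<Prod>i<Suc M. 1 + y * ?q i) = (\<Sum>k\<le>M. a M k) * (1 + y * ?q M)"
    using Suc by (simp add: a_def B_def)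
  also have "\<dots> = (\<Sum>k\<le>M. a M k) + (\<Sum>k\<le>M. a M k * (y * ?q M))"
    by (simp add: distrib_left sum_distrib_right)
  also have "(\<Sum>k\<le>M. a M k) = a M 0 + (\<Sum>k<M. a M (Suc k))"
    by (rule sum.atMost_shift)
  also have "(\<Sum>k\<le>M. a M k * (y * ?q M)) = (\<Sum>k<M. a M k * (y * ?q M)) + a M M * (y * ?q M)"
    by (simp flip: lessThan_Suc_atMost)
  also have "a M 0 + (\<Sum>k<M. a M (Suc k)) + ((\<Sum>k<M. a M k * (y * ?q M)) + a M M * (y * ?q M)) =
      a M 0 + ((\<Sum>k<M. a M (Suc k) + a M k * (y * ?q M)) + a (Suc M) (Suc M))"
    by (simp add: sum.distrib top)
  also have "(\<Sum>k<M. a M (Suc k) + a M k * (y * ?q M)) = (\<Sum>k<M. a (Suc M) (Suc k))"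
    by (intro sum.cong refl step[symmetric]) auto
  also have "a M 0 = a (Suc M) 0" by (simp add: a_def B0)
  also have "a (Suc M) 0 + ((\<Sum>k<M. a (Suc M) (Suc k)) + a (Suc M) (Suc M)) = (\<Sum>k\<le>Suc M. a (Suc M) k)"
    by (simp only: sum.atMost_shift sum.lessThan_Suc)
  finally show ?case by (simp add: a_def B_def)
qed simp

text \<open>\<open>(-e)\<^sup>n\<close> for \<open>e = 1\<close> and \<open>e = -1\<close>, the only values that occur.\<close>

definition theta_sign :: "rat fls \<Rightarrow> int \<Rightarrow> rat fls" where
  "theta_sign e n = (if even n then 1 else - e)"

definition theta_term :: "rat fls \<Rightarrow> int \<Rightarrow> int \<Rightarrow> int \<Rightarrow> rat fls" where
  "theta_term e c d n = theta_sign e n * fls_X powi (d * (n * (n - 1) div 2) + c * n)"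

text \<open>In Ramanujan's notation, e = 1, c = 1, d = 2 gives phi(-q), and e = -1, c = d = 1 gives
  2 psi(q).\<close>

definition theta :: "rat fls \<Rightarrow> int \<Rightarrow> int \<Rightarrow> rat fls" where
  "theta e c d = fsum (theta_term e c d) UNIV"

lemma minus_sign_power: "e = 1 \<or> e = - 1 \<Longrightarrow> (- e) ^ k = theta_sign e (int k)"
  by (auto simp: theta_sign_def)

lemma theta_sign_add: "e = 1 \<or> e = - 1 \<Longrightarrow> theta_sign e (m + n) = theta_sign e m * theta_sign e n"
  by (auto simp: theta_sign_def)

lemma triangular_int: "int (k * (k - 1) div 2) = int k * (int k - 1) div 2"
  by (cases k) (simp_all add: zdiv_int algebra_simps)

text \<open>The q-binomial theorem with 2N factors, and y chosen so that the factors with i >= N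
  become 1 - e q^(c + di). The lower half, read backwards, consists of the factors -e q^(-s) (1 - e
  q^s) with s = d - c + dj. The monomials collect in \<open>pre\<close>, which also comes out of the
  sum after the shift k = N + r.\<close>

lemma finite_jacobi_triple_product:
  assumes e: "e = 1 \<or> e = - 1" and d: "d > 0" and c: "c \<le> d"
  shows "(\<Sum>r\<in>{-int N..int N}. theta_term e (int c) (int d) r * (qfacd d (2 * N) / (qfacd d (nat (int N - r)) * qfacd d (nat (int N + r))))) =
    (\<Prod>i<N. 1 - e * fls_X ^ (c + d * i)) * (\<Prod>i<N. 1 - e * fls_X ^ (d - c + d * i))"
proof -
  let ?X = "\<lambda>k. fls_X powi k :: rat fls"
  define y where "y = - e * ?X (int c - int d * int N)"
  define pre where "pre = (\<Prod>j<N. - e * ?X (- int (d - c + d * j)))"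
  have ee: "e * e = 1" using e by auto
  have "(\<Prod>i<2 * N. 1 + y * fls_X ^ (d * i)) = (\<Prod>i<N. 1 + y * fls_X ^ (d * i)) * (\<Prod>i<N. 1 + y * fls_X ^ (d * (N + i)))"
  proof -
    have "{..<2 * N} = {..<N} \<union> (\<lambda>i. N + i) ` {..<N}"
    proof (intro set_eqI iffI)
      fix i assume i: "i \<in> {..<2 * N}"
      show "i \<in> {..<N} \<union> (\<lambda>i. N + i) ` {..<N}"
      proof (cases "i < N")
        case False
        then have "i = N + (i - N)" "i - N < N" using i by auto
        then show ?thesis by blast
      qed simp
    qed auto
    moreover have "{..<N} \<inter> (\<lambda>i. N + i) ` {..<N} = {}" by auto
    ultimately show ?thesis by (simp add: prod.union_disjoint prod.reindex)
  qed
  also have "(\<Prod>i<N. 1 + y * fls_X ^ (d * (N + i))) = (\<Prod>i<N. 1 - e * fls_X ^ (c + d * i))"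
  proof (intro prod.cong refl)
    fix i
    have "int c - int d * int N + int (d * (N + i)) = int (c + d * i)" by (simp add: algebra_simps)
    then have "?X (int c - int d * int N) * fls_X ^ (d * (N + i)) = fls_X ^ (c + d * i)"
      by (metis fls_X_nonzero power_int_add power_int_of_nat)
    then show "1 + y * fls_X ^ (d * (N + i)) = 1 - e * fls_X ^ (c + d * i)" by (simp add: y_def mult.assoc)
  qed
  also have "(\<Prod>i<N. 1 + y * fls_X ^ (d * i)) = (\<Prod>j<N. 1 + y * fls_X ^ (d * (N - Suc j)))"
    by (rule prod.nat_diff_reindex[symmetric])
  also have "\<dots> = (\<Prod>j<N. - e * ?X (- int (d - c + d * j)) * (1 - e * fls_X ^ (d - c + d * j)))"
  proof (intro prod.cong refl)
    fix j assume j: "j \<in> {..<N}"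
    obtain t where "N = Suc (j + t)" using j less_iff_Suc_add[of j N] by auto
    then have "int c - int d * int N + int (d * (N - Suc j)) = - int (d - c + d * j)"
      using c by (simp add: of_nat_diff algebra_simps)
    then have "y * fls_X ^ (d * (N - Suc j)) = - e * ?X (- int (d - c + d * j))"
      unfolding y_def by (metis fls_X_nonzero mult.assoc power_int_add power_int_of_nat)
    moreover have "- e * ?X (- int n) * (1 - e * fls_X ^ n) = 1 + - e * ?X (- int n)" for n
    proof -
      have "- e * ?X (- int n) * (1 - e * fls_X ^ n) = - e * ?X (- int n) + e * e * (?X (- int n) * fls_X ^ n)"
        by (simp add: algebra_simps)
      then show ?thesis by (simp add: ee power_int_minus)
    qed
    ultimately show "1 + y * fls_X ^ (d * (N - Suc j)) = - e * ?X (- int (d - c + d * j)) * (1 - e * fls_X ^ (d - c + d * j))"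
      by (simp only:)
  qed
  also have "\<dots> = pre * (\<Prod>i<N. 1 - e * fls_X ^ (d - c + d * i))"
    by (simp only: prod.distrib pre_def)
  finally have prod: "(\<Prod>i<2 * N. 1 + y * fls_X ^ (d * i)) =
      pre * ((\<Prod>i<N. 1 - e * fls_X ^ (c + d * i)) * (\<Prod>i<N. 1 - e * fls_X ^ (d - c + d * i)))"
    by (simp add: mult_ac)
  have pre: "pre = theta_sign e (int N) * ?X (int c * int N - int d * (int N * (int N + 1) div 2))"
    unfolding pre_def
  proof (induction N)
    case (Suc N)
    have "int (Suc N) * (int (Suc N) + 1) div 2 = int N * (int N + 1) div 2 + int N + 1"
      by (simp add: algebra_simps)
    then have "int c * int (Suc N) - int d * (int (Suc N) * (int (Suc N) + 1) div 2) =
        (int c * int N - int d * (int N * (int N + 1) div 2)) + - int (d - c + d * N)"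
      using c by (simp add: of_nat_diff algebra_simps)
    moreover have "theta_sign e (int (Suc N)) = theta_sign e (int N) * - e"
      using e by (auto simp: theta_sign_def)
    ultimately show ?case using Suc by (simp add: power_int_add mult_ac)
  qed (simp add: theta_sign_def)
  have "(\<Sum>k\<le>2 * N. fls_X ^ (d * (k * (k - 1) div 2)) * y ^ k * (qfacd d (2 * N) / (qfacd d k * qfacd d (2 * N - k)))) =
     pre * (\<Sum>r\<in>{-int N..int N}. theta_term e (int c) (int d) r * (qfacd d (2 * N) / (qfacd d (nat (int N - r)) * qfacd d (nat (int N + r)))))"
    unfolding sum_distrib_left
  proof (rule sum.reindex_bij_witness[of _ "\<lambda>r. nat (int N + r)" "\<lambda>k. int k - int N"])
    fix k assume k: "k \<in> {..2 * N}"
    define r where "r = int k - int N"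
    have kr: "int k = int N + r" by (simp add: r_def)
    have n: "nat (int N - r) = 2 * N - k" "nat (int N + r) = k" using k by (auto simp: r_def)
    have ex: "int d * (int k * (int k - 1) div 2) + (int c - int d * int N) * int k =
        (int c * int N - int d * (int N * (int N + 1) div 2)) + (int d * (r * (r - 1) div 2) + int c * r)"
    proof -
      define x1 x2 x3 where x: "x1 = int k * (int k - 1) div 2" "x2 = int N * (int N + 1) div 2" "x3 = r * (r - 1) div 2"
      have "2 * x1 = int k * (int k - 1)" "2 * x2 = int N * (int N + 1)" "2 * x3 = r * (r - 1)" by (simp_all add: x)
      then have "2 * (x1 - int N * int k) = 2 * (x3 - x2)"
        by (simp add: kr algebra_simps)
      then have "int d * (x1 - int N * int k) = int d * (x3 - x2)" by simp
      then show ?thesis unfolding x[symmetric] by (simp add: kr algebra_simps)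
    qed
    have "y ^ k = theta_sign e (int k) * ?X ((int c - int d * int N) * int k)"
      unfolding y_def by (simp only: power_mult_distrib minus_sign_power[OF e] power_int_power')
    moreover have "fls_X ^ (d * (k * (k - 1) div 2)) = ?X (int d * (int k * (int k - 1) div 2))"
      by (simp only: power_int_of_nat[symmetric] of_nat_mult triangular_int)
    moreover have "theta_sign e (int k) = theta_sign e (int N) * theta_sign e r"
      by (simp only: kr theta_sign_add[OF e])
    moreover have "?X (a + b) = ?X a * ?X b" for a b by (rule power_int_add) simp
    ultimately have "fls_X ^ (d * (k * (k - 1) div 2)) * y ^ k =
        theta_sign e (int N) * theta_sign e r * ?X (int d * (int k * (int k - 1) div 2) + (int c - int d * int N) * int k)"
      by (simp only: mult_ac)
    also have "\<dots> = pre * theta_term e (int c) (int d) r"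
      unfolding ex pre theta_term_def by (simp add: power_int_add mult_ac)
    finally show "pre * (theta_term e (int c) (int d) (int k - int N) * (qfacd d (2 * N) / (qfacd d (nat (int N - (int k - int N))) * qfacd d (nat (int N + (int k - int N)))))) =
        fls_X ^ (d * (k * (k - 1) div 2)) * y ^ k * (qfacd d (2 * N) / (qfacd d k * qfacd d (2 * N - k)))"
      by (simp add: n mult_ac flip: r_def)
  qed auto
  then have "pre * (\<Sum>r\<in>{-int N..int N}. theta_term e (int c) (int d) r * (qfacd d (2 * N) / (qfacd d (nat (int N - r)) * qfacd d (nat (int N + r))))) =
     pre * ((\<Prod>i<N. 1 - e * fls_X ^ (c + d * i)) * (\<Prod>i<N. 1 - e * fls_X ^ (d - c + d * i)))"
    using q_binomial_theorem[OF d, where M = "2 * N" and y = y] prod by argo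
  moreover have "pre \<noteq> 0" using e by (auto simp: pre_def)
  ultimately show ?thesis by simp
qed

text \<open>Reducing c modulo d lets c = d stand for the positive multiples of d.\<close>

definition progression :: "nat \<Rightarrow> nat \<Rightarrow> nat set" where
  "progression c d = {j. j > 0 \<and> j mod d = c mod d}"

lemma zero_notin_progression [simp]: "0 \<notin> progression c d"
  by (simp add: progression_def)

lemma progression_approx:
  assumes "vanishes_below 0 e" "0 < c" "c \<le> d"
  shows "vanishes_below (int N) (qprod e (progression c d) - (\<Prod>i<N. 1 - e * fls_X ^ (c + d * i)))"
proof -
  let ?B = "(\<lambda>i. c + d * i) ` {..<N}"
  have "progression c d \<inter> {..N} \<subseteq> ?B"
  proof
    fix j assume "j \<in> progression c d \<inter> {..N}"
    then have j: "j > 0" "j mod d = c mod d" "j \<le> N" by (auto simp: progression_def)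
    have "c \<le> j"
    proof (cases "c = d")
      case True
      then have "d dvd j" using j by (simp add: dvd_eq_mod_eq_0)
      then show ?thesis using j True by (auto dest: dvd_imp_le)
    next
      case False
      then show ?thesis using j(2) assms by (metis mod_less mod_less_eq_dividend nat_less_le)
    qed
    then have "d dvd j - c" using j(2) by (metis mod_eq_dvd_iff_nat)
    then obtain i where i: "j - c = d * i" by auto
    have "i \<le> d * i" using assms by simp
    then have "i < N" using i j(3) \<open>c \<le> j\<close> assms(2) by linarith
    then show "j \<in> ?B" using i \<open>c \<le> j\<close> by (intro image_eqI[of _ _ i]) auto
  qed
  then have "vanishes_below (int N + 1) (qprod e (progression c d) - (\<Prod>j\<in>?B. 1 - e * fls_X ^ j))"
    using assms by (intro qprod_approx) (auto simp: progression_def)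
  also have "(\<Prod>j\<in>?B. 1 - e * fls_X ^ j) = (\<Prod>i<N. 1 - e * fls_X ^ (c + d * i))"
    using assms by (subst prod.reindex) (auto simp: inj_on_def)
  finally show ?thesis by (rule vanishes_below_mono) simp
qed

text \<open>For r < 0 the hypothesis c <= d bounds the exponent below by d r(r+1)/2, which is at
  least |r| - 1.\<close>

lemma theta_exponent_bound:
  fixes c d :: nat
  assumes "0 < c" "c \<le> d"
  shows "\<bar>r\<bar> - 1 \<le> int d * (r * (r - 1) div 2) + int c * r"
proof (cases "r \<ge> 0")
  case True
  define h where "h = r * (r - 1) div 2"
  have "2 * h = r * (r - 1)" by (simp add: h_def)
  moreover have "0 \<le> r * (r - 1)" using True by (cases "r = 0") auto
  ultimately have "0 \<le> int d * h" by simp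
  moreover have "1 * r \<le> int c * r" using assms True by (intro mult_right_mono) auto
  ultimately show ?thesis using True unfolding h_def[symmetric] by linarith
next
  case False
  define h where "h = r * (r - 1) div 2"
  have h: "2 * h = r * (r - 1)" by (simp add: h_def)
  have "0 \<le> (- r) * (- r - 1)" using False by (intro mult_nonneg_nonneg) auto
  moreover have "2 * (h + r) = (- r) * (- r - 1)" unfolding distrib_left h by (simp add: algebra_simps)
  ultimately have "0 \<le> 2 * (h + r)" by (simp only:)
  then have "0 \<le> h + r" by simp
  then have "1 * (h + r) \<le> int d * (h + r)" using assms by (intro mult_right_mono) auto
  then have "h + r \<le> int d * h + int d * r" unfolding mult_1 distrib_left .
  moreover have "int d * r \<le> int c * r" using assms False by (intro mult_right_mono_neg) auto
  moreover have "- r - 1 \<le> h + r"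
  proof -
    have "0 \<le> (- r - 1) * (- r - 2)"
      using False by (cases "r = - 1") (auto intro!: mult_nonneg_nonneg)
    moreover have "2 * (h + r) + 2 * (r + 1) = (- r - 1) * (- r - 2)" unfolding distrib_left h by (simp add: algebra_simps)
    ultimately have "0 \<le> 2 * (h + r) + 2 * (r + 1)" by (simp only:)
    then show ?thesis by arith
  qed
  ultimately show ?thesis using False unfolding h_def[symmetric] by linarith
qed

lemma theta_term_bound:
  assumes "e = 1 \<or> e = - 1" "0 < c" "c \<le> d"
  shows "vanishes_below (\<bar>r\<bar> - 1) (theta_term e (int c) (int d) r)"
proof -
  have "vanishes_below (\<bar>r\<bar> - 1) (fls_X powi (int d * (r * (r - 1) div 2) + int c * r) :: rat fls)"
    using theta_exponent_bound[OF assms(2,3), of r] by simp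
  then show ?thesis using assms(1) by (auto simp: theta_term_def theta_sign_def)
qed

lemma theta_summable:
  assumes "e = 1 \<or> e = - 1" "0 < c" "c \<le> d"
  shows "fsummable (theta_term e (int c) (int d)) UNIV"
  by (rule fsummableI_int[where c = 1]) (rule theta_term_bound[OF assms])

lemma unipotent_one_minus_mult: "vanishes_below 0 e \<Longrightarrow> n > 0 \<Longrightarrow> unipotent (1 - e * fls_X ^ n)"
  by (intro unipotent_one_minus vanishes_below_int_mult) auto

text \<open>The second product enters only through its limit \<open>R\<close>, because for c = d it
  starts with 1 - e q^0, which is not of the form 1 + O(q) and so does not fit into a
  \<open>qprod\<close>.\<close>

lemma jacobi_triple_product:
  assumes e: "e = 1 \<or> e = - 1" and c: "0 < c" "c \<le> d"
    and R: "\<And>N. vanishes_below (int N) (R - (\<Prod>i<N. 1 - e * fls_X ^ (d - c + d * i)))" "vanishes_below 0 R"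
  shows "theta e (int c) (int d) = qprod 1 (progression d d) * (qprod e (progression c d) * R)"
proof -
  let ?J = "qprod 1 (progression d d) :: rat fls"
  let ?V = "\<lambda>N r. qfacd d (2 * N) / (qfacd d (nat (int N - r)) * qfacd d (nat (int N + r)))"
  have d: "d > 0" using c by simp
  have e0: "vanishes_below 0 e" using e by auto
  have J: "unipotent ?J" by (intro qprod_unipotent) auto
  have fac: "vanishes_below (int n) (?J - qfacd d n)" for n
  proof -
    have "(\<Prod>i<n. 1 - 1 * fls_X ^ (d + d * i)) = qfacd d n"
      unfolding qfacd_def by (rule prod.reindex_bij_witness[of _ "\<lambda>i. i - 1" Suc]) (auto simp: algebra_simps)
    then show ?thesis using progression_approx[of "1 :: rat fls" d d n] d by simp
  qed
  have "fsum (\<lambda>r. theta_term e (int c) (int d) r * inverse ?J) UNIV = qprod e (progression c d) * R"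
  proof (rule fsum_limit(2)[where c = 1 and V = ?V and ?N0.0 = 0])
    fix r :: int and N :: nat
    assume r: "\<bar>r\<bar> \<le> int N"
    define n where "n = nat (int N - \<bar>r\<bar>)"
    have n: "int n = int N - \<bar>r\<bar>" using r by (simp add: n_def)
    have V1: "vanishes_below (int n) (?J - qfacd d m)" if "n \<le> m" for m
      using vanishes_below_mono[OF fac[of m], of "int n"] that by simp
    have U: "unipotent (qfacd d m)" for m by (rule qfacd_unipotent[OF d])
    \<comment> \<open>The shortest of the three q-factorials has N - |r| factors, so their quotient
      agrees with 1/J to the order that \<open>fsum_limit\<close> asks for.\<close>
    have lim: "vanishes_below (int n) (?J * (inverse ?J * inverse ?J) - qfacd d (2 * N) * (inverse (qfacd d (nat (int N - r))) * inverse (qfacd d (nat (int N + r)))))"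
      using r by (intro vanishes_below_diff_mult vanishes_below_inverse_diff V1 J U vanishes_below_int_mult vanishes_below_inverse_unipotent unipotent_imp_integral)
        (auto simp: n_def)
    show "vanishes_below (int N - \<bar>r\<bar>) (inverse ?J - ?V N r)"
    proof -
      have "?J * (inverse ?J * inverse ?J) = inverse ?J" using unipotent_nonzero[OF J] by (simp flip: mult.assoc)
      with lim show ?thesis by (simp only: divide_inverse inverse_mult_distrib flip: n)
    qed
  next
    fix N :: nat
    have "vanishes_below (int N) (qprod e (progression c d) * R - (\<Prod>i<N. 1 - e * fls_X ^ (c + d * i)) * (\<Prod>i<N. 1 - e * fls_X ^ (d - c + d * i)))"
    proof (intro vanishes_below_diff_mult progression_approx e0 c R)
      show "vanishes_below 0 (\<Prod>i<N. 1 - e * fls_X ^ (c + d * i))"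
        by (rule unipotent_imp_integral, rule unipotent_prod, rule unipotent_one_minus_mult[OF e0]) (use c in auto)
    qed
    then have "vanishes_below (int N) (qprod e (progression c d) * R - (\<Sum>r\<in>{-int N..int N}. theta_term e (int c) (int d) r * ?V N r))"
      by (simp only: finite_jacobi_triple_product[OF e d c(2)])
    then show "vanishes_below (int N - 1) (qprod e (progression c d) * R - (\<Sum>r\<in>UNIV \<inter> {-int N..int N}. theta_term e (int c) (int d) r * ?V N r))"
      by (auto intro: vanishes_below_mono)
  qed (use theta_term_bound[OF e c] vanishes_below_inverse_unipotent[OF J] in auto)
  moreover have "fsum (\<lambda>r. theta_term e (int c) (int d) r * inverse ?J) UNIV = theta e (int c) (int d) * inverse ?J"
    using fsum_cmult[OF theta_summable[OF e c], of "inverse ?J"] by (simp add: theta_def mult.commute)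
  ultimately show ?thesis using unipotent_nonzero[OF J] by (simp add: field_simps)
qed

lemma theta_product:
  assumes "e = 1 \<or> e = - 1" "0 < c" "c < d"
  shows "theta e (int c) (int d) = qprod 1 (progression d d) * (qprod e (progression c d) * qprod e (progression (d - c) d))"
proof -
  have e: "vanishes_below 0 e" using assms(1) by auto
  show ?thesis
  proof (rule jacobi_triple_product[OF assms(1,2)])
    show "vanishes_below (int N) (qprod e (progression (d - c) d) - (\<Prod>i<N. 1 - e * fls_X ^ (d - c + d * i)))" for N
      using assms by (intro progression_approx e) auto
    show "vanishes_below 0 (qprod e (progression (d - c) d))"
      by (rule unipotent_imp_integral, rule qprod_unipotent[OF e]) simp
  qed (use assms in auto)
qed

text \<open>For c = d and e = -1 the second product of the triple product starts with 1 + q^0 =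
  2.\<close>

lemma theta_product_diag:
  assumes "0 < d"
  shows "theta (- 1) (int d) (int d) = 2 * qprod 1 (progression d d) * qprod (- 1) (progression d d) ^ 2"
proof -
  have int: "vanishes_below 0 (2 * qprod (- 1) (progression d d) :: rat fls)"
    by (rule vanishes_below_int_mult[OF vanishes_below_two], rule unipotent_imp_integral, rule qprod_unipotent) simp_all
  have "theta (- 1) (int d) (int d) = qprod 1 (progression d d) * (qprod (- 1) (progression d d) * (2 * qprod (- 1) (progression d d)))"
  proof (rule jacobi_triple_product)
    show "vanishes_below (int N) (2 * qprod (- 1) (progression d d) - (\<Prod>i<N. 1 - (- 1) * fls_X ^ (d - d + d * i)) :: rat fls)" for N
    proof (cases N)
      case 0
      then show ?thesis
        using vanishes_below_diff[OF int, of 1] by simp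
    next
      case (Suc M)
      have "(\<Prod>i<N. 1 - (- 1) * fls_X ^ (d - d + d * i)) = 2 * (\<Prod>i<M. 1 - (- 1) * fls_X ^ (d + d * i) :: rat fls)"
        unfolding Suc by (subst prod.lessThan_Suc_shift) simp
      moreover have "vanishes_below (int N) (qprod (- 1) (progression d d) - (\<Prod>i<M. 1 - (- 1) * fls_X ^ (d + d * i)) :: rat fls)"
      proof -
        let ?f = "\<lambda>i. 1 - (- 1) * fls_X ^ (d + d * i) :: rat fls"
        have "vanishes_below (int N) (qprod (- 1) (progression d d) - prod ?f {..<N})"
          using assms by (intro progression_approx) auto
        \<comment> \<open>Once the 2 is split off, only M = N - 1 factors are left; the factor
          needed to reach N is 1 + O(q^N).\<close>
        moreover have "vanishes_below (int N) (prod ?f {..<N} - prod ?f {..<M})"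
        proof -
          have "prod ?f {..<N} - prod ?f {..<M} = prod ?f {..<M} * fls_X ^ (d + d * M)"
            unfolding Suc by (simp add: algebra_simps)
          moreover have "N \<le> d + d * M" using assms unfolding Suc by (cases d) auto
          then have "vanishes_below (int N) (fls_X ^ (d + d * M) :: rat fls)"
            unfolding vanishes_below_X_power by (rule of_nat_mono)
          moreover have "vanishes_below 0 (prod ?f {..<M})"
            using assms by (intro unipotent_imp_integral unipotent_prod unipotent_one_minus) (auto intro!: add_increasing2)
          ultimately show ?thesis by (simp only: vanishes_below_int_mult)
        qed
        ultimately show ?thesis by (rule vanishes_below_trans)
      qed
      ultimately show ?thesis
        by (simp only: right_diff_distrib[symmetric]) (intro vanishes_below_int_mult vanishes_below_two)
    qed
    show "vanishes_below 0 (2 * qprod (- 1) (progression d d) :: rat fls)"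
      by (rule int)
  qed (use assms in auto)
  then show ?thesis by (simp add: power2_eq_square mult_ac)
qed

section \<open>Double theta series\<close>

lemma theta_mult:
  assumes "e = 1 \<or> e = - 1" "0 < c" "c \<le> d" "e' = 1 \<or> e' = - 1" "0 < c'" "c' \<le> d'"
  shows "theta e (int c) (int d) * theta e' (int c') (int d') =
      fsum (\<lambda>(m, n). theta_term e (int c) (int d) m * theta_term e' (int c') (int d') n) UNIV"
    and "fsummable (\<lambda>(m, n). theta_term e (int c) (int d) m * theta_term e' (int c') (int d') n) UNIV"
  using fsum_times[OF theta_summable[OF assms(1-3)] theta_summable[OF assms(4-6)]]
    fsummable_times[OF theta_summable[OF assms(1-3)] theta_summable[OF assms(4-6)]]
  by (simp_all add: theta_def)

text \<open>\<open>cl\<close> names the class of an index, \<open>\<phi> r\<close> parametrises the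
  class r, and \<open>\<psi> r\<close> inverts this parametrisation.\<close>

lemma fsum_partition:
  fixes F :: "'i \<Rightarrow> 'a::ab_group_add fls"
  assumes "finite I" "fsummable F UNIV"
    and "\<And>x. cl x \<in> I \<and> \<phi> (cl x) (\<psi> (cl x) x) = x" "\<And>r p. r \<in> I \<Longrightarrow> cl (\<phi> r p) = r \<and> \<psi> r (\<phi> r p) = p"
  shows "fsum F UNIV = (\<Sum>r\<in>I. fsum (\<lambda>p. F (\<phi> r p)) UNIV)"
proof -
  have U: "(\<Union>r\<in>I. range (\<phi> r)) = UNIV" using assms(3) by (auto simp: set_eq_iff) (metis rangeI)
  have "disjoint_family_on (\<lambda>r. range (\<phi> r)) I"
    unfolding disjoint_family_on_def using assms(4) by (auto, metis)
  then have "fsum F UNIV = (\<Sum>r\<in>I. fsum F (range (\<phi> r)))"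
    using fsum_UN_disjoint[OF assms(1), of F "\<lambda>r. range (\<phi> r)"] assms(2) U by simp
  also have "\<dots> = (\<Sum>r\<in>I. fsum (\<lambda>p. F (\<phi> r p)) UNIV)"
  proof (intro sum.cong refl)
    fix r assume "r \<in> I"
    then have "inj (\<phi> r)" using assms(4) by (metis injI)
    then show "fsum F (range (\<phi> r)) = fsum (\<lambda>p. F (\<phi> r p)) UNIV"
      by (simp add: fsum_reindex comp_def)
  qed
  finally show ?thesis .
qed

definition theta_exponent :: "int \<Rightarrow> int \<Rightarrow> int \<Rightarrow> int" where
  "theta_exponent c d n = d * (n * (n - 1) div 2) + c * n"

lemma two_theta_exponent: "2 * theta_exponent c d n = n * (d * (n - 1) + 2 * c)"
proof -
  define h where "h = n * (n - 1) div 2"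
  have "2 * h = n * (n - 1)" by (simp add: h_def)
  then have "d * (2 * h) = d * (n * (n - 1))" by simp
  then show ?thesis unfolding theta_exponent_def h_def[symmetric] by (simp add: algebra_simps)
qed

text \<open>A linear change of indices that leaves no mixed term in the exponent separates the
  double series again into two theta series. Exponents are compared after doubling, which removes
  the division in n(n-1)/2.\<close>

lemma theta_class:
  assumes "e3 = 1 \<or> e3 = - 1" "0 < c3" "c3 \<le> d3" "e4 = 1 \<or> e4 = - 1" "0 < c4" "c4 \<le> d4"
    and sgn: "\<And>u v. theta_sign e1 (f u v) * theta_sign e2 (g u v) = s * (theta_sign e3 u * theta_sign e4 v)"
    and ex: "\<And>u v. 2 * theta_exponent c1 d1 (f u v) + 2 * theta_exponent c2 d2 (g u v) =
        2 * k + (2 * theta_exponent (int c3) (int d3) u + 2 * theta_exponent (int c4) (int d4) v)"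
  shows "fsum (\<lambda>(u, v). theta_term e1 c1 d1 (f u v) * theta_term e2 c2 d2 (g u v)) UNIV =
    s * fls_X powi k * (theta e3 (int c3) (int d3) * theta e4 (int c4) (int d4))"
proof -
  let ?X = "\<lambda>k. fls_X powi k :: rat fls"
  have add: "?X (a + b) = ?X a * ?X b" for a b by (rule power_int_add) simp
  have "theta_term e1 c1 d1 (f u v) * theta_term e2 c2 d2 (g u v) =
      s * ?X k * (theta_term e3 (int c3) (int d3) u * theta_term e4 (int c4) (int d4) v)" for u v
  proof -
    have "theta_exponent c1 d1 (f u v) + theta_exponent c2 d2 (g u v) =
        k + (theta_exponent (int c3) (int d3) u + theta_exponent (int c4) (int d4) v)"
      using ex[of u v] by linarith
    then have "?X (theta_exponent c1 d1 (f u v)) * ?X (theta_exponent c2 d2 (g u v)) =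
        ?X k * (?X (theta_exponent (int c3) (int d3) u) * ?X (theta_exponent (int c4) (int d4) v))"
      by (simp only: add[symmetric])
    then have "(theta_sign e1 (f u v) * theta_sign e2 (g u v)) * (?X (theta_exponent c1 d1 (f u v)) * ?X (theta_exponent c2 d2 (g u v))) =
        (s * (theta_sign e3 u * theta_sign e4 v)) * (?X k * (?X (theta_exponent (int c3) (int d3) u) * ?X (theta_exponent (int c4) (int d4) v)))"
      by (simp only: sgn)
    then show ?thesis
      unfolding theta_term_def theta_exponent_def[symmetric] by (simp only: mult_ac)
  qed
  then have "fsum (\<lambda>(u, v). theta_term e1 c1 d1 (f u v) * theta_term e2 c2 d2 (g u v)) UNIV =
      fsum (\<lambda>p. s * ?X k * (case p of (u, v) \<Rightarrow> theta_term e3 (int c3) (int d3) u * theta_term e4 (int c4) (int d4) v)) UNIV"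
    by (intro fsum_cong) auto
  also have "\<dots> = s * ?X k * fsum (\<lambda>(u, v). theta_term e3 (int c3) (int d3) u * theta_term e4 (int c4) (int d4) v) UNIV"
    by (rule fsum_cmult[OF theta_mult(2)[OF assms(1-6)]])
  finally show ?thesis by (simp only: theta_mult(1)[OF assms(1-6)])
qed

text \<open>Because (u + v)^2 + (u - v)^2 = 2u^2 + 2v^2, a multiple of m^2 + n^2 stays diagonal on
  each parity class of m + n.\<close>

lemma fsum_parity_classes:
  fixes F :: "int \<times> int \<Rightarrow> 'a::ab_group_add fls"
  assumes "fsummable F UNIV"
  shows "fsum F UNIV = fsum (\<lambda>(u, v). F (u + v, u - v)) UNIV + fsum (\<lambda>(u, v). F (u + v, u - v + 1)) UNIV"
proof -
  have "fsum F UNIV = (\<Sum>r\<in>{0, 1}. fsum (\<lambda>p. F ((\<lambda>r (u, v). (u + v, u - v + r)) r p)) UNIV)"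
  proof (rule fsum_partition[where cl = "\<lambda>(m, n). (m + n) mod 2" and \<psi> = "\<lambda>r (m, n). ((m + n) div 2, (m - n + 1) div 2)"])
    fix x :: "int \<times> int"
    obtain m n where x: "x = (m, n)" by force
    have "(m + n) div 2 + (m - n + 1) div 2 = m" by presburger
    moreover have "(m + n) div 2 - (m - n + 1) div 2 + (m + n) mod 2 = n" by presburger
    moreover have "(m + n) mod 2 \<in> {0, 1}" by auto
    ultimately show "(case x of (m, n) \<Rightarrow> (m + n) mod 2) \<in> {0, 1} \<and>
        (\<lambda>r (u, v). (u + v, u - v + r)) (case x of (m, n) \<Rightarrow> (m + n) mod 2)
          ((\<lambda>r (m, n). ((m + n) div 2, (m - n + 1) div 2)) (case x of (m, n) \<Rightarrow> (m + n) mod 2) x) = x"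
      by (simp add: x)
  next
    fix r :: int and p :: "int \<times> int"
    assume r: "r \<in> {0, 1}"
    obtain u v where p: "p = (u, v)" by force
    have "r = 0 \<or> r = 1" using r by simp
    then have "(u + v + (u - v + r)) mod 2 = r \<and> (u + v + (u - v + r)) div 2 = u \<and> (u + v - (u - v + r) + 1) div 2 = v"
      by presburger
    then show "(case (\<lambda>r (u, v). (u + v, u - v + r)) r p of (m, n) \<Rightarrow> (m + n) mod 2) = r \<and>
        (\<lambda>r (m, n). ((m + n) div 2, (m - n + 1) div 2)) r ((\<lambda>r (u, v). (u + v, u - v + r)) r p) = p"
      by (simp add: p)
  qed (use assms in auto)
  then show ?thesis by (simp add: case_prod_unfold)
qed

text \<open>As 5 = 2^2 + 1^2, the map (u, v) -> (2u + v, 2v - u) multiplies the sum of squares by 5.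
  Its image has index 5 and is given by 2m - n = 0 modulo 5; the pairs (\<open>\<alpha> r\<close>,
  \<open>\<beta> r\<close>) represent its cosets.\<close>

lemma fsum_five_classes:
  fixes F :: "int \<times> int \<Rightarrow> 'a::ab_group_add fls"
  assumes "fsummable F UNIV" and \<alpha>\<beta>: "\<And>r. r \<in> {0, 1, 2, 3, 4} \<Longrightarrow> (2 * \<alpha> r - \<beta> r) mod 5 = (r :: int)"
  shows "fsum F UNIV = (\<Sum>r\<in>{0, 1, 2, 3, 4}. fsum (\<lambda>(u, v). F (2 * u + v + \<alpha> r, 2 * v - u + \<beta> r)) UNIV)"
proof -
  let ?cl = "\<lambda>(m, n). (2 * m - n) mod 5 :: int"
  let ?\<phi> = "\<lambda>r (u, v). (2 * u + v + \<alpha> r, 2 * v - u + \<beta> r)"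
  let ?\<psi> = "\<lambda>r (m, n). ((2 * (m - \<alpha> r) - (n - \<beta> r)) div 5, ((m - \<alpha> r) + 2 * (n - \<beta> r)) div 5)"
  have "fsum F UNIV = (\<Sum>r\<in>{0, 1, 2, 3, 4}. fsum (\<lambda>p. F (?\<phi> r p)) UNIV)"
  proof (rule fsum_partition[where cl = ?cl and \<psi> = ?\<psi>])
    fix x :: "int \<times> int"
    obtain m n where x: "x = (m, n)" by force
    define r where "r = (2 * m - n) mod 5"
    have r: "r \<in> {0, 1, 2, 3, 4}"
      using pos_mod_bound[of 5 "2 * m - n"] pos_mod_sign[of 5 "2 * m - n"] by (auto simp: r_def)
    define a b where "a = m - \<alpha> r" and "b = n - \<beta> r"
    have "(2 * m - n) mod 5 = (2 * \<alpha> r - \<beta> r) mod 5" using \<alpha>\<beta>[OF r] by (simp add: r_def)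
    then have "5 dvd (2 * m - n) - (2 * \<alpha> r - \<beta> r)" by (simp add: mod_eq_dvd_iff)
    then have "5 dvd 2 * a - b" by (simp add: a_def b_def algebra_simps)
    then obtain k where "2 * a - b = 5 * k" by auto
    then have b: "b = 2 * a - 5 * k" by simp
    have "(2 * a - b) div 5 = k" "(a + 2 * b) div 5 = a - 2 * k" by (simp_all add: b)
    then have "2 * ((2 * a - b) div 5) + (a + 2 * b) div 5 = a" "2 * ((a + 2 * b) div 5) - (2 * a - b) div 5 = b"
      by (simp_all add: b)
    then show "?cl x \<in> {0, 1, 2, 3, 4} \<and> ?\<phi> (?cl x) (?\<psi> (?cl x) x) = x"
      using r by (simp add: x a_def b_def flip: r_def)
  next
    fix r :: int and p :: "int \<times> int"
    assume r: "r \<in> {0, 1, 2, 3, 4}"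
    obtain u v where p: "p = (u, v)" by force
    have "(2 * (2 * u + v + \<alpha> r) - (2 * v - u + \<beta> r)) mod 5 = (2 * \<alpha> r - \<beta> r + 5 * u) mod 5" by (simp add: algebra_simps)
    also have "\<dots> = r" using \<alpha>\<beta>[OF r] by simp
    finally show "?cl (?\<phi> r p) = r \<and> ?\<psi> r (?\<phi> r p) = p"
      by (simp add: p)
  qed (use assms in auto)
  then show ?thesis by (simp add: case_prod_unfold)
qed

lemma theta_sign_simps: "theta_sign 1 n = alt n" "theta_sign (- 1) n = 1"
  by (simp_all add: theta_sign_def alt_def)

text \<open>Exchanging the signs of the two theta series changes only the sign of the odd class, so
  the sum and the difference of the two cases isolate one product each.\<close>

lemma theta_product_parity:
  assumes "e1 = 1 \<and> e2 = - 1 \<and> s = 1 \<or> e1 = - 1 \<and> e2 = 1 \<and> s = - 1"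
  shows "theta e1 2 5 * theta e2 1 5 = theta 1 3 10 * theta 1 6 10 + s * fls_X * (theta 1 8 10 * theta 1 1 10)"
proof -
  have e: "e1 = 1 \<or> e1 = - 1" "e2 = 1 \<or> e2 = - 1" using assms by auto
  have "theta e1 2 5 * theta e2 1 5 = fsum (\<lambda>(m, n). theta_term e1 2 5 m * theta_term e2 1 5 n) UNIV"
    using theta_mult(1)[of e1 2 5 e2 1 5] e by simp
  also have "\<dots> = fsum (\<lambda>(u, v). theta_term e1 2 5 (u + v) * theta_term e2 1 5 (u - v)) UNIV +
      fsum (\<lambda>(u, v). theta_term e1 2 5 (u + v) * theta_term e2 1 5 (u - v + 1)) UNIV"
    using fsum_parity_classes[OF theta_mult(2)[of e1 2 5 e2 1 5]] e by (simp add: case_prod_unfold)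
  also have "fsum (\<lambda>(u, v). theta_term e1 2 5 (u + v) * theta_term e2 1 5 (u - v)) UNIV = 1 * fls_X powi 0 * (theta 1 (int 3) (int 10) * theta 1 (int 6) (int 10))"
  proof (rule theta_class)
    show "theta_sign e1 (u + v) * theta_sign e2 (u - v) = 1 * (theta_sign 1 u * theta_sign 1 v)" for u v
      using assms by (auto simp: theta_sign_simps alt_def)
    show "2 * theta_exponent 2 5 (u + v) + 2 * theta_exponent 1 5 (u - v) = 2 * 0 + (2 * theta_exponent (int 3) (int 10) u + 2 * theta_exponent (int 6) (int 10) v)" for u v
      unfolding two_theta_exponent by (simp add: algebra_simps)
  qed auto
  also have "fsum (\<lambda>(u, v). theta_term e1 2 5 (u + v) * theta_term e2 1 5 (u - v + 1)) UNIV = s * fls_X powi 1 * (theta 1 (int 8) (int 10) * theta 1 (int 1) (int 10))"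
  proof (rule theta_class)
    show "theta_sign e1 (u + v) * theta_sign e2 (u - v + 1) = s * (theta_sign 1 u * theta_sign 1 v)" for u v
      using assms by (auto simp: theta_sign_simps alt_def)
    show "2 * theta_exponent 2 5 (u + v) + 2 * theta_exponent 1 5 (u - v + 1) = 2 * 1 + (2 * theta_exponent (int 8) (int 10) u + 2 * theta_exponent (int 1) (int 10) v)" for u v
      unfolding two_theta_exponent by (simp add: algebra_simps)
  qed auto
  finally show ?thesis by simp
qed

text \<open>The left side is phi(-q)^2. The class r = 0 gives phi(-q^5)^2, and the four others share
  the factor -q.\<close>

lemma theta_square_five_alternating:
  "theta 1 1 2 ^ 2 = theta 1 5 10 ^ 2 - fls_X * (theta 1 7 10 * theta 1 1 10 + theta 1 9 10 * theta 1 7 10 + theta 1 1 10 * theta 1 3 10 + theta 1 3 10 * theta 1 9 10)"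
proof -
  let ?F = "\<lambda>(m, n). theta_term 1 1 2 m * theta_term 1 1 2 n"
  \<comment> \<open>Short coset representatives keep the new parameters c between 1 and 10, as
    \<open>theta_class\<close> requires.\<close>
  let ?\<alpha> = "\<lambda>r :: int. if r = 2 then 1 else if r = 3 then - 1 else 0 :: int" and ?\<beta> = "\<lambda>r :: int. if r = 1 then - 1 else if r = 4 then 1 else 0 :: int"
  have "theta 1 1 2 ^ 2 = fsum ?F UNIV"
    using theta_mult(1)[of 1 1 2 1 1 2] by (simp add: power2_eq_square)
  also have "\<dots> = (\<Sum>r\<in>{0, 1, 2, 3, 4}. fsum (\<lambda>(u, v). ?F (2 * u + v + ?\<alpha> r, 2 * v - u + ?\<beta> r)) UNIV)"
    using theta_mult(2)[of 1 1 2 1 1 2] by (intro fsum_five_classes) auto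
  also have "\<dots> = fsum (\<lambda>(u, v). ?F (2 * u + v + 0, 2 * v - u + 0)) UNIV + fsum (\<lambda>(u, v). ?F (2 * u + v + 0, 2 * v - u + - 1)) UNIV
      + fsum (\<lambda>(u, v). ?F (2 * u + v + 1, 2 * v - u + 0)) UNIV + fsum (\<lambda>(u, v). ?F (2 * u + v + - 1, 2 * v - u + 0)) UNIV
      + fsum (\<lambda>(u, v). ?F (2 * u + v + 0, 2 * v - u + 1)) UNIV"
    by simp
  also have "fsum (\<lambda>(u, v). ?F (2 * u + v + 0, 2 * v - u + 0)) UNIV = 1 * fls_X powi 0 * (theta 1 (int 5) (int 10) * theta 1 (int 5) (int 10))"
    unfolding prod.case by (rule theta_class) (simp_all only: two_theta_exponent, auto simp: theta_sign_simps alt_def algebra_simps)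
  also have "fsum (\<lambda>(u, v). ?F (2 * u + v + 0, 2 * v - u + - 1)) UNIV = - 1 * fls_X powi 1 * (theta 1 (int 7) (int 10) * theta 1 (int 1) (int 10))"
    unfolding prod.case by (rule theta_class) (simp_all only: two_theta_exponent, auto simp: theta_sign_simps alt_def algebra_simps)
  also have "fsum (\<lambda>(u, v). ?F (2 * u + v + 1, 2 * v - u + 0)) UNIV = - 1 * fls_X powi 1 * (theta 1 (int 9) (int 10) * theta 1 (int 7) (int 10))"
    unfolding prod.case by (rule theta_class) (simp_all only: two_theta_exponent, auto simp: theta_sign_simps alt_def algebra_simps)
  also have "fsum (\<lambda>(u, v). ?F (2 * u + v + - 1, 2 * v - u + 0)) UNIV = - 1 * fls_X powi 1 * (theta 1 (int 1) (int 10) * theta 1 (int 3) (int 10))"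
    unfolding prod.case by (rule theta_class) (simp_all only: two_theta_exponent, auto simp: theta_sign_simps alt_def algebra_simps)
  also have "fsum (\<lambda>(u, v). ?F (2 * u + v + 0, 2 * v - u + 1)) UNIV = - 1 * fls_X powi 1 * (theta 1 (int 3) (int 10) * theta 1 (int 9) (int 10))"
    unfolding prod.case by (rule theta_class) (simp_all only: two_theta_exponent, auto simp: theta_sign_simps alt_def algebra_simps)
  finally show ?thesis by (simp add: power2_eq_square algebra_simps)
qed

text \<open>The left side is 4 psi(q)^2. Here the class r = 2 is the one that gives
  psi(q^5)^2.\<close>

lemma theta_square_five_positive:
  "theta (- 1) 1 1 ^ 2 = fls_X * theta (- 1) 5 5 ^ 2 + (theta (- 1) 3 5 * theta (- 1) 4 5 + theta (- 1) 1 5 * theta (- 1) 3 5 + theta (- 1) 4 5 * theta (- 1) 2 5 + theta (- 1) 2 5 * theta (- 1) 1 5)"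
proof -
  let ?F = "\<lambda>(m, n). theta_term (- 1) 1 1 m * theta_term (- 1) 1 1 n"
  \<comment> \<open>The exponent m(m+1)/2 + n(n+1)/2 is centred at (-1/2, -1/2), so the coset r = 4
    is represented by (-1, -1).\<close>
  let ?\<alpha> = "\<lambda>r :: int. if r = 2 then 1 else if r = 3 then - 1 else if r = 4 then - 1 else 0 :: int" and ?\<beta> = "\<lambda>r :: int. if r = 1 then - 1 else if r = 4 then - 1 else 0 :: int"
  have "theta (- 1) 1 1 ^ 2 = fsum ?F UNIV"
    using theta_mult(1)[of "- 1" 1 1 "- 1" 1 1] by (simp add: power2_eq_square)
  also have "\<dots> = (\<Sum>r\<in>{0, 1, 2, 3, 4}. fsum (\<lambda>(u, v). ?F (2 * u + v + ?\<alpha> r, 2 * v - u + ?\<beta> r)) UNIV)"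
    using theta_mult(2)[of "- 1" 1 1 "- 1" 1 1] by (intro fsum_five_classes) auto
  also have "\<dots> = fsum (\<lambda>(u, v). ?F (2 * u + v + 0, 2 * v - u + 0)) UNIV + fsum (\<lambda>(u, v). ?F (2 * u + v + 0, 2 * v - u + - 1)) UNIV
      + fsum (\<lambda>(u, v). ?F (2 * u + v + 1, 2 * v - u + 0)) UNIV + fsum (\<lambda>(u, v). ?F (2 * u + v + - 1, 2 * v - u + 0)) UNIV
      + fsum (\<lambda>(u, v). ?F (2 * u + v + - 1, 2 * v - u + - 1)) UNIV"
    by simp
  also have "fsum (\<lambda>(u, v). ?F (2 * u + v + 0, 2 * v - u + 0)) UNIV = 1 * fls_X powi 0 * (theta (- 1) (int 3) (int 5) * theta (- 1) (int 4) (int 5))"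
    unfolding prod.case by (rule theta_class) (simp_all only: two_theta_exponent, auto simp: theta_sign_simps alt_def algebra_simps)
  also have "fsum (\<lambda>(u, v). ?F (2 * u + v + 0, 2 * v - u + - 1)) UNIV = 1 * fls_X powi 0 * (theta (- 1) (int 4) (int 5) * theta (- 1) (int 2) (int 5))"
    unfolding prod.case by (rule theta_class) (simp_all only: two_theta_exponent, auto simp: theta_sign_simps alt_def algebra_simps)
  also have "fsum (\<lambda>(u, v). ?F (2 * u + v + 1, 2 * v - u + 0)) UNIV = 1 * fls_X powi 1 * (theta (- 1) (int 5) (int 5) * theta (- 1) (int 5) (int 5))"
    unfolding prod.case by (rule theta_class) (simp_all only: two_theta_exponent, auto simp: theta_sign_simps alt_def algebra_simps)
  also have "fsum (\<lambda>(u, v). ?F (2 * u + v + - 1, 2 * v - u + 0)) UNIV = 1 * fls_X powi 0 * (theta (- 1) (int 1) (int 5) * theta (- 1) (int 3) (int 5))"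
    unfolding prod.case by (rule theta_class) (simp_all only: two_theta_exponent, auto simp: theta_sign_simps alt_def algebra_simps)
  also have "fsum (\<lambda>(u, v). ?F (2 * u + v + - 1, 2 * v - u + - 1)) UNIV = 1 * fls_X powi 0 * (theta (- 1) (int 2) (int 5) * theta (- 1) (int 1) (int 5))"
    unfolding prod.case by (rule theta_class) (simp_all only: two_theta_exponent, auto simp: theta_sign_simps alt_def algebra_simps)
  finally show ?thesis by (simp add: power2_eq_square algebra_simps)
qed

declare One_nat_def [simp del]

section \<open>Identities of level 10\<close>

definition Eu :: "nat \<Rightarrow> rat fls" where
  "Eu k = qprod 1 (residues k {0})"

lemma Eu_unipotent: "unipotent (Eu k)"
  unfolding Eu_def by (intro qprod_unipotent) auto

lemma Eu_nonzero [simp]: "Eu k \<noteq> 0"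
  by (intro unipotent_nonzero Eu_unipotent)

lemma fps_to_fls_J_Eu: "k \<ge> 1 \<Longrightarrow> fps_to_fls (J k) = Eu k"
  by (simp add: fps_to_fls_J Eu_def residues_def dvd_eq_mod_eq_0)

abbreviation sub2 :: "rat fls \<Rightarrow> rat fls" where "sub2 f \<equiv> fls_compose_power f 2"

lemma sub2_Eu: "k > 0 \<Longrightarrow> sub2 (Eu k) = Eu (2 * k)"
proof -
  assume "k > 0"
  have "(*) 2 ` residues k {0} = residues (2 * k) {0}"
  proof (intro set_eqI iffI)
    fix j assume "j \<in> residues (2 * k) {0}"
    then obtain i where "j = 2 * k * i" "j > 0" by (auto simp: residues_def mod_eq_0_iff_dvd elim!: dvdE)
    then show "j \<in> (*) 2 ` residues k {0}" by (intro image_eqI[of _ _ "k * i"]) (auto simp: residues_def)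
  qed (auto simp: residues_def)
  then show ?thesis by (simp add: Eu_def fls_compose_power_qprod)
qed

text \<open>The products of level 10 below are monomials in these ten series, so that identities
  between products become comparisons of exponents.\<close>

definition xr :: "nat \<Rightarrow> rat fls" where "xr c = qprod 1 (residues 10 {c})"

lemma xr_nonzero [simp]: "xr c \<noteq> 0"
  unfolding xr_def by (intro unipotent_nonzero qprod_unipotent) auto

lemma qprod_residues_10: "finite D \<Longrightarrow> qprod 1 (residues 10 D) = (\<Prod>c\<in>D. xr c)"
  unfolding xr_def by (rule qprod_residues) auto

lemma residues_10:
  "residues 1 {0} = residues 10 {0, 1, 2, 3, 4, 5, 6, 7, 8, 9}"
  "residues 2 {0} = residues 10 {0, 2, 4, 6, 8}"
  "residues 2 {1} = residues 10 {1, 3, 5, 7, 9}"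
  "residues 5 {0} = residues 10 {0, 5}"
  "residues 5 {1, 4} = residues 10 {1, 4, 6, 9}"
  "residues 5 {2, 3} = residues 10 {2, 3, 7, 8}"
  unfolding residues_def by (intro Collect_cong, simp, presburger)+

lemma double_residues_5:
  "(*) 2 ` residues 1 {0} = residues 2 {0}"
  "(*) 2 ` residues 5 {0} = residues 10 {0}"
  "(*) 2 ` residues 5 {1, 4} = residues 10 {2, 8}"
  "(*) 2 ` residues 5 {2, 3} = residues 10 {4, 6}"
  unfolding residues_def by (intro set_eqI, simp add: image_iff, presburger)+

lemma Eu_xr:
  "Eu 1 = xr 0 * xr 1 * xr 2 * xr 3 * xr 4 * xr 5 * xr 6 * xr 7 * xr 8 * xr 9"
  "Eu 2 = xr 0 * xr 2 * xr 4 * xr 6 * xr 8"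
  "Eu 5 = xr 0 * xr 5"
  "Eu 10 = xr 0"
  "qprod 1 (residues 2 {1}) = xr 1 * xr 3 * xr 5 * xr 7 * xr 9"
  unfolding Eu_def residues_10 by (simp_all add: qprod_residues_10 xr_def[symmetric])

lemma PM_xr:
  "P1 = xr 1 * xr 4 * xr 6 * xr 9" "P2 = xr 2 * xr 3 * xr 7 * xr 8"
  "P1 * M1 = xr 2 * xr 8" "P2 * M2 = xr 4 * xr 6"
  unfolding P1_def P2_def M1_def M2_def
  by (simp_all add: qprod_minus_plus double_residues_5 qprod_residues_10) (simp_all add: residues_10 qprod_residues_10)

lemma J5_Eu: "J5 = Eu 5"
  by (simp add: J5_def Eu_def)

lemma qprod_plus_Eu:
  "qprod (- 1) (residues 1 {0}) = Eu 2 / Eu 1" "qprod (- 1) (residues 5 {0}) = Eu 10 / Eu 5"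
proof -
  have "Eu 1 * qprod (- 1) (residues 1 {0}) = Eu 2"
    unfolding Eu_def by (subst qprod_minus_plus) (simp_all add: double_residues_5)
  then show "qprod (- 1) (residues 1 {0}) = Eu 2 / Eu 1" by (simp add: field_simps)
  have "Eu 5 * qprod (- 1) (residues 5 {0}) = Eu 10"
    unfolding Eu_def by (subst qprod_minus_plus) (simp_all add: double_residues_5)
  then show "qprod (- 1) (residues 5 {0}) = Eu 10 / Eu 5" by (simp add: field_simps)
qed

lemma M0_Eu: "M0 = 2 * (Eu 10 / Eu 5) ^ 2"
  by (simp add: M0_def qprod_plus_Eu)

lemma progression_residues: "progression c d = residues d {c mod d}"
  by (simp add: progression_def residues_def)

lemma theta_10:
  assumes "0 < c" "c < 10"
  shows "theta 1 (int c) 10 = xr 0 * (xr c * xr (10 - c))"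
  using theta_product[of 1 c 10] assms by (simp add: progression_residues xr_def)

lemma theta_5:
  "theta 1 1 5 = Eu 5 * P1" "theta 1 2 5 = Eu 5 * P2"
  "theta (- 1) 1 5 = Eu 5 * M1" "theta (- 1) 4 5 = Eu 5 * M1" "theta (- 1) 2 5 = Eu 5 * M2" "theta (- 1) 3 5 = Eu 5 * M2"
  using theta_product[of 1 1 5] theta_product[of 1 2 5] theta_product[of "- 1" 1 5] theta_product[of "- 1" 4 5]
    theta_product[of "- 1" 2 5] theta_product[of "- 1" 3 5]
  by (simp_all add: progression_residues Eu_def P_split mult_ac)

lemma theta_other:
  "theta 1 1 2 = Eu 1 ^ 2 / Eu 2" "theta 1 5 10 = Eu 5 ^ 2 / Eu 10"
  "theta (- 1) 1 1 = 2 * Eu 2 ^ 2 / Eu 1" "theta (- 1) 5 5 = 2 * Eu 10 ^ 2 / Eu 5"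
proof -
  show "theta 1 1 2 = Eu 1 ^ 2 / Eu 2"
    using theta_product[of 1 1 2] by (simp add: progression_residues Eu_def[of 2, symmetric] Eu_xr field_simps power2_eq_square)
  show "theta 1 5 10 = Eu 5 ^ 2 / Eu 10"
    using theta_10[of 5] by (simp add: Eu_xr field_simps power2_eq_square)
  show "theta (- 1) 1 1 = 2 * Eu 2 ^ 2 / Eu 1"
    using theta_product_diag[of 1] by (simp add: progression_residues qprod_plus_Eu Eu_def[of 1, symmetric] power2_eq_square)
  show "theta (- 1) 5 5 = 2 * Eu 10 ^ 2 / Eu 5"
    using theta_product_diag[of 5] by (simp add: progression_residues qprod_plus_Eu Eu_def[of 5, symmetric] power2_eq_square)
qed

text \<open>The sum and the difference of the two sign cases of \<open>theta_product_parity\<close>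
  are 2A and 2qB. Multiplied by \<open>P1 * M1\<close> and \<open>P2 * M2\<close> respectively, they
  are the same monomials in the \<open>xr\<close> as the left-hand sides.\<close>

lemma weierstrass_relations:
  "M0 * P2 ^ 2 * M2 = P1 * M1 * (P2 * M1 + P1 * M2)"
  "fls_X * M0 * P1 ^ 2 * M1 = P2 * M2 * (P2 * M1 - P1 * M2)"
proof -
  define A where "A = xr 0 ^ 2 * (xr 3 * xr 7 * xr 4 * xr 6)"
  define B where "B = xr 0 ^ 2 * (xr 8 * xr 2 * xr 1 * xr 9)"
  have 1: "Eu 5 ^ 2 * (P2 * M1) = A + fls_X * B"
    using theta_product_parity[of 1 "- 1" 1] theta_10[of 3] theta_10[of 6] theta_10[of 8] theta_10[of 1]
    by (simp add: theta_5 A_def B_def power2_eq_square mult_ac)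
  have 2: "Eu 5 ^ 2 * (P1 * M2) = A - fls_X * B"
    using theta_product_parity[of "- 1" 1 "- 1"] theta_10[of 3] theta_10[of 6] theta_10[of 8] theta_10[of 1]
    by (simp add: theta_5 A_def B_def power2_eq_square mult_ac)
  have sum: "2 * A = Eu 5 ^ 2 * (P2 * M1 + P1 * M2)" and diff: "2 * (fls_X * B) = Eu 5 ^ 2 * (P2 * M1 - P1 * M2)"
    using 1 2 by algebra+
  have M: "Eu 5 ^ 2 * M0 = 2 * xr 0 ^ 2" by (simp add: M0_Eu Eu_xr(4) power_divide)
  have "Eu 5 ^ 2 * (M0 * P2 ^ 2 * M2) = (Eu 5 ^ 2 * M0) * P2 * (P2 * M2)" by (simp add: power2_eq_square mult_ac)
  also have "\<dots> = P1 * M1 * (2 * A)"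
    unfolding M PM_xr(3,4) A_def unfolding PM_xr(2) by (simp only: mult_ac)
  also have "\<dots> = Eu 5 ^ 2 * (P1 * M1 * (P2 * M1 + P1 * M2))"
    using sum by (simp only: mult_ac)
  finally show "M0 * P2 ^ 2 * M2 = P1 * M1 * (P2 * M1 + P1 * M2)" by simp
  have "Eu 5 ^ 2 * (fls_X * M0 * P1 ^ 2 * M1) = fls_X * (Eu 5 ^ 2 * M0) * P1 * (P1 * M1)" by (simp add: power2_eq_square mult_ac)
  also have "\<dots> = P2 * M2 * (2 * (fls_X * B))"
    unfolding M PM_xr(3,4) B_def unfolding PM_xr(1) by (simp only: mult_ac)
  also have "\<dots> = Eu 5 ^ 2 * (P2 * M2 * (P2 * M1 - P1 * M2))"
    using diff by (simp only: mult_ac)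
  finally show "fls_X * M0 * P1 ^ 2 * M1 = P2 * M2 * (P2 * M1 - P1 * M2)" by simp
qed

lemma eta_products:
  "P1 * P2 = Eu 1 / Eu 5" "M1 * M2 = Eu 2 * Eu 5 / (Eu 1 * Eu 10)"
proof -
  show P: "P1 * P2 = Eu 1 / Eu 5" by (simp add: PM_xr(1,2) Eu_xr mult_ac)
  have "(P1 * P2) * (M1 * M2) = Eu 2 / Eu 10"
    using PM_xr(3,4) by (simp add: Eu_xr mult_ac)
  then have "Eu 1 / Eu 5 * (M1 * M2) = Eu 2 / Eu 10" unfolding P .
  then show "M1 * M2 = Eu 2 * Eu 5 / (Eu 1 * Eu 10)" by (simp add: field_simps)
qed

section \<open>The Hauptmodul of level 10\<close>

definition hh :: "rat fls" where
  "hh = fls_X * Eu 1 * Eu 10 ^ 5 / (Eu 2 * Eu 5 ^ 5)"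

text \<open>The five-class formula for phi(-q)^2 is divided by phi(-q^5)^2, the one for psi(q)^2 by
  its four remaining products, which all equal \<open>Eu 5 ^ 2 * (M1 * M2)\<close>.\<close>

lemma hauptmodul_relations:
  "1 - 4 * hh = Eu 1 ^ 4 * Eu 10 ^ 2 / (Eu 2 ^ 2 * Eu 5 ^ 4)"
  "1 + hh = Eu 2 ^ 3 * Eu 10 / (Eu 1 * Eu 5 ^ 3)"
proof -
  have odd: "xr 1 * xr 9 * (xr 3 * xr 7) = Eu 1 * Eu 10 / (Eu 2 * Eu 5)"
    by (simp add: Eu_xr)
  have "(Eu 1 ^ 2 / Eu 2) ^ 2 = (Eu 5 ^ 2 / Eu 10) ^ 2 - fls_X * (4 * (xr 0 ^ 2 * (xr 1 * xr 9 * (xr 3 * xr 7))))"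
    using theta_square_five_alternating theta_10[of 1] theta_10[of 3] theta_10[of 7] theta_10[of 9]
    by (simp add: theta_other power2_eq_square algebra_simps flip: One_nat_def)
  then have "(Eu 1 ^ 2 / Eu 2) ^ 2 = (Eu 5 ^ 2 / Eu 10) ^ 2 - 4 * fls_X * Eu 10 ^ 3 * Eu 1 / (Eu 2 * Eu 5)"
    unfolding odd Eu_xr(4)[symmetric] by (simp add: power2_eq_square power3_eq_cube mult_ac)
  then have "(Eu 1 ^ 2 / Eu 2) ^ 2 * (Eu 10 ^ 2 / Eu 5 ^ 4) = 1 - 4 * hh"
    by (simp add: hh_def field_simps power_numeral_reduce)
  then show "1 - 4 * hh = Eu 1 ^ 4 * Eu 10 ^ 2 / (Eu 2 ^ 2 * Eu 5 ^ 4)"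
    by (simp add: field_simps power_numeral_reduce)
  have "(2 * Eu 2 ^ 2 / Eu 1) ^ 2 = fls_X * (2 * Eu 10 ^ 2 / Eu 5) ^ 2 + 4 * Eu 5 ^ 2 * (M1 * M2)"
    using theta_square_five_positive by (simp add: theta_other theta_5 power2_eq_square algebra_simps)
  then have "4 * ((Eu 2 ^ 2 / Eu 1) ^ 2 * (Eu 1 * Eu 10 / (Eu 2 * Eu 5 ^ 3))) = 4 * (1 + hh)"
    unfolding eta_products hh_def by (simp add: field_simps power_numeral_reduce)
  then have "(Eu 2 ^ 2 / Eu 1) ^ 2 * (Eu 1 * Eu 10 / (Eu 2 * Eu 5 ^ 3)) = 1 + hh"
    unfolding mult_cancel_left by simp
  then show "1 + hh = Eu 2 ^ 3 * Eu 10 / (Eu 1 * Eu 5 ^ 3)"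
    by (simp add: field_simps power_numeral_reduce)
qed

text \<open>A uniformiser in which \<open>q\<close>, \<^term>\<open>M0\<close>, \<^term>\<open>M2\<close> and \<^term>\<open>hh\<close> all become rational up to
  powers of \<^term>\<open>rr\<close> and \<^term>\<open>M1\<close>.\<close>

definition kk :: "rat fls" where
  "kk = (P2 * M1 - P1 * M2) / (P2 * M1 + P1 * M2)"

definition ll :: "rat fls" where
  "ll = P1 * M2 / (P2 * M1)"

lemma kk_sum_nonzero: "P2 * M1 + P1 * M2 \<noteq> 0"
proof
  assume "P2 * M1 + P1 * M2 = 0"
  then have "M0 * P2 ^ 2 * M2 = 0" using weierstrass_relations(1) by simp
  then show False by simp
qed

lemma one_kk: "1 + kk = 2 * P2 * M1 / (P2 * M1 + P1 * M2)" "1 - kk = 2 * P1 * M2 / (P2 * M1 + P1 * M2)"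
  using kk_sum_nonzero by (simp_all add: kk_def field_simps)

lemma kk_nonzero [simp]: "1 + kk \<noteq> 0" "1 - kk \<noteq> 0" "kk \<noteq> 1"
proof -
  show "1 + kk \<noteq> 0" "1 - kk \<noteq> 0" using kk_sum_nonzero by (simp_all add: one_kk)
  then show "kk \<noteq> 1" by auto
qed

lemma ll_kk: "(1 + kk) * ll = 1 - kk"
  using kk_sum_nonzero by (simp add: one_kk ll_def field_simps)

lemma ll_nonzero [simp]: "ll \<noteq> 0"
  by (simp add: ll_def)

text \<open>The second and third equations are the two Weierstrass relations. If R is the
  Rogers-Ramanujan continued fraction, then q / \<open>rr ^ 5\<close> is R(q)^5, and the third is
  Ramanujan's R(q)^5 = k ((1 - k)/(1 + k))^2 for his parameter k = R(q) R(q^2)^2.\<close>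

lemma parametrisation:
  "M2 = rr * ll * M1" "M0 = 2 * M1 / (rr ^ 2 * (1 - kk))" "fls_X = kk * rr ^ 5 * ll ^ 2"
proof -
  show "M2 = rr * ll * M1" by (simp add: rr_def ll_def)
  have "M0 = P1 * M1 * (P2 * M1 + P1 * M2) / (P2 ^ 2 * M2)"
    using weierstrass_relations(1) by (simp add: field_simps)
  moreover have "2 * M1 / (rr ^ 2 * (1 - kk)) = P1 * M1 * (P2 * M1 + P1 * M2) / (P2 ^ 2 * M2)"
    using kk_sum_nonzero unfolding one_kk rr_def by (simp add: power_divide divide_simps) (simp add: power2_eq_square)
  ultimately show M0: "M0 = 2 * M1 / (rr ^ 2 * (1 - kk))" by simp
  have "fls_X * (M0 * P1 ^ 2 * M1) = P2 * M2 * (kk * (P2 * M1 + P1 * M2))"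
    using weierstrass_relations(2) kk_sum_nonzero by (simp add: kk_def mult_ac)
  also have "\<dots> = kk * rr * (P1 * M2) * (P2 * M1 + P1 * M2)" by (simp add: rr_def)
  also have "\<dots> = kk * rr * ll * (P2 * M1) * (P2 * M1 + P1 * M2)" by (simp add: ll_def)
  also have "(P2 * M1 + P1 * M2) = M0 * P2 ^ 2 * M2 / (P1 * M1)"
    using weierstrass_relations(1) by (simp add: field_simps)
  also have "kk * rr * ll * (P2 * M1) * (M0 * P2 ^ 2 * M2 / (P1 * M1)) = (kk * rr ^ 5 * ll ^ 2) * (M0 * P1 ^ 2 * M1)"
    unfolding rr_def ll_def by (simp add: field_simps power_numeral_reduce)
  finally show "fls_X = kk * rr ^ 5 * ll ^ 2" by simp
qed

lemma hh_kk: "hh = kk / (1 - kk ^ 2)"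
proof -
  have "hh = fls_X * M0 ^ 2 / (4 * (M1 * M2))"
    unfolding eta_products M0_Eu hh_def by (simp add: field_simps power_numeral_reduce)
  also have "\<dots> = kk * ll / (1 - kk) ^ 2"
  proof -
    have "fls_X * M0 ^ 2 / (4 * (M1 * M2)) = (kk * rr ^ 5 * ll ^ 2) * (2 * M1 / (rr ^ 2 * (1 - kk))) ^ 2 / (4 * (M1 * (rr * ll * M1)))"
      by (simp only: parametrisation(3)[symmetric] parametrisation(2)[symmetric] parametrisation(1)[symmetric])
    also have "\<dots> = kk * ll / (1 - kk) ^ 2"
      by (simp add: power_divide power_mult_distrib divide_simps) (simp add: power_numeral_reduce mult_ac)
    finally show ?thesis .
  qed
  also have "ll = (1 - kk) / (1 + kk)" using ll_kk by (simp add: field_simps)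
  also have "kk * ((1 - kk) / (1 + kk)) / (1 - kk) ^ 2 = kk / ((1 + kk) * (1 - kk))"
    by (simp add: power2_eq_square)
  also have "(1 + kk) * (1 - kk) = 1 - kk ^ 2" by (simp add: algebra_simps power2_eq_square)
  finally show ?thesis .
qed

text \<open>After the substitution every term is r^6/(2 m^3) times a function of k and l, and l = (1
  - k)/(1 + k). The square of 1 - 4k - k^2 appears in both results and will cancel from their
  quotient.\<close>

lemma brace_evaluation:
  fixes r k l m :: "'a :: field_char_0"
  assumes nz: "r \<noteq> 0" "m \<noteq> 0" "l \<noteq> 0" "1 - k \<noteq> 0" "1 + k \<noteq> 0" and l: "(1 + k) * l = 1 - k"
    and q: "q = k * r ^ 5 * l ^ 2" and m0: "m0 = 2 * m / (r ^ 2 * (1 - k))" and m2: "m2 = r * l * m"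
  shows "(r ^ 4 - 3 * q / r) / (m0 * m ^ 2) - q * (3 * r + q / r ^ 4) / (m0 * m2 ^ 2)
      - 2 * q * (2 * r ^ 2 - q / r ^ 3) / (m ^ 2 * m2) + 2 * q * (r ^ 3 + 2 * q / r ^ 2) / (m * m2 ^ 2) =
      r ^ 6 / (2 * m ^ 3) * ((1 - 4 * k - k ^ 2) ^ 2 * (1 + k ^ 2) / (1 + k) ^ 3)"
    (is "?t1 - ?t2 - ?t3 + ?t4 = _")
    and "r ^ 5 - 11 * q - q ^ 2 / r ^ 5 = r ^ 5 * ((1 - 4 * k - k ^ 2) ^ 2 * (1 + k - k ^ 2) / (1 + k) ^ 4)"
proof -
  \<comment> \<open>In terms of n the only denominator of l is a variable.\<close>
  define n where "n = 1 + k"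
  have k_eq: "k = n - 1" by (simp add: n_def)
  have l': "l = (2 - n) / n" using l nz by (simp add: n_def field_simps)
  have "?t1 = r ^ 6 / (2 * m ^ 3) * ((1 - k) * (1 - 3 * k * l ^ 2))"
    unfolding q m0 using nz by (simp add: field_simps power_numeral_reduce)
  moreover have "?t2 = r ^ 6 / (2 * m ^ 3) * ((1 - k) * (3 * k + k ^ 2 * l ^ 2))"
    unfolding q m0 m2 using nz by (simp add: field_simps power_numeral_reduce)
  moreover have "?t3 = r ^ 6 / (2 * m ^ 3) * (4 * k * l * (2 - k * l ^ 2))"
    unfolding q m0 m2 using nz by (simp add: field_simps power_numeral_reduce)
  moreover have "?t4 = r ^ 6 / (2 * m ^ 3) * (4 * k * (1 + 2 * k * l ^ 2))"
    unfolding q m0 m2 using nz by (simp add: field_simps power_numeral_reduce)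
  ultimately have "?t1 - ?t2 - ?t3 + ?t4 = r ^ 6 / (2 * m ^ 3) *
      ((1 - k) * (1 - 3 * k * l ^ 2) - (1 - k) * (3 * k + k ^ 2 * l ^ 2) - 4 * k * l * (2 - k * l ^ 2) + 4 * k * (1 + 2 * k * l ^ 2))"
    by (simp only: distrib_left right_diff_distrib)
  also have "(1 - k) * (1 - 3 * k * l ^ 2) - (1 - k) * (3 * k + k ^ 2 * l ^ 2) - 4 * k * l * (2 - k * l ^ 2) + 4 * k * (1 + 2 * k * l ^ 2) =
      (1 - 4 * k - k ^ 2) ^ 2 * (1 + k ^ 2) / (1 + k) ^ 3"
    unfolding k_eq l' using nz(5)[unfolded k_eq] by (simp add: field_simps power_numeral_reduce)
  finally show "?t1 - ?t2 - ?t3 + ?t4 = r ^ 6 / (2 * m ^ 3) * ((1 - 4 * k - k ^ 2) ^ 2 * (1 + k ^ 2) / (1 + k) ^ 3)" .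
  have "r ^ 5 - 11 * q - q ^ 2 / r ^ 5 = r ^ 5 * (1 - 11 * k * l ^ 2 - k ^ 2 * l ^ 4)"
    unfolding q using nz by (simp add: field_simps power_numeral_reduce)
  also have "1 - 11 * k * l ^ 2 - k ^ 2 * l ^ 4 = (1 - 4 * k - k ^ 2) ^ 2 * (1 + k - k ^ 2) / (1 + k) ^ 4"
    unfolding k_eq l' using nz(5)[unfolded k_eq] by (simp add: field_simps power_numeral_reduce)
  finally show "r ^ 5 - 11 * q - q ^ 2 / r ^ 5 = r ^ 5 * ((1 - 4 * k - k ^ 2) ^ 2 * (1 + k - k ^ 2) / (1 + k) ^ 4)" .
qed

text \<open>Once the common square is cancelled, 1 + k - k^2 = (1 - k^2)(1 + h) and
  \<open>rr * (1 + kk) / M1 ^ 3\<close> = 2/(\<open>M0\<close> \<open>M1\<close> \<open>M2\<close>)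
  bring in eta quotients; only (1 + k^2)/(1 - k^2) is left.\<close>

lemma hecke_sum_eta:
  "fls_X * part5 (fps_to_fls mock_f) + sub5 (fps_to_fls mock_f) =
    Eu 1 ^ 3 * Eu 5 ^ 4 / (Eu 2 ^ 4 * Eu 10 ^ 2) * ((1 + kk ^ 2) / (1 - kk ^ 2))"
proof -
  define w where "w = 1 - 4 * kk - kk ^ 2"
  define v where "v = 1 + kk - kk ^ 2"
  have ev: "fls_X * part5 (fps_to_fls mock_f) + sub5 (fps_to_fls mock_f) =
      2 * J5 * P1 * P2 / X5 * (rr ^ 6 / (2 * M1 ^ 3) * (w ^ 2 * (1 + kk ^ 2) / (1 + kk) ^ 3))"
    unfolding w_def hecke_sum_product
    by (subst brace_evaluation(1)[where k = kk and l = ll]) (use ll_kk parametrisation in auto)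
  have X5: "X5 = rr ^ 5 * (w ^ 2 * v / (1 + kk) ^ 4)"
    unfolding w_def v_def X5_def
    by (subst brace_evaluation(2)[where k = kk and l = ll and m = M1]) (use ll_kk parametrisation in auto)
  then have wv: "w \<noteq> 0" "v \<noteq> 0" using X5_nonzero by auto
  have k2: "1 - kk ^ 2 = (1 + kk) * (1 - kk)" by (simp add: algebra_simps power2_eq_square)
  have k2nz: "1 - kk ^ 2 \<noteq> 0" unfolding k2 by simp
  have "v / (1 - kk ^ 2) = 1 + hh" using k2nz by (simp add: hh_kk v_def field_simps)
  then have "v / (1 - kk ^ 2) = Eu 2 ^ 3 * Eu 10 / (Eu 1 * Eu 5 ^ 3)" by (simp add: hauptmodul_relations)
  then have v: "v = Eu 2 ^ 3 * Eu 10 / (Eu 1 * Eu 5 ^ 3) * (1 - kk ^ 2)" using k2nz by (simp add: field_simps)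
  have "M0 * (rr * ll * M1) * (rr * (1 + kk)) = 2 * M1 ^ 2"
  proof -
    have "M0 * (rr * ll * M1) * (rr * (1 + kk)) = 2 * M1 / (rr ^ 2 * (1 - kk)) * (rr ^ 2 * M1 * ((1 + kk) * ll))"
      unfolding parametrisation(2)[symmetric] by (simp add: power2_eq_square mult_ac)
    also have "\<dots> = 2 * M1 ^ 2" unfolding ll_kk by (simp add: power2_eq_square)
    finally show ?thesis .
  qed
  then have "M0 * M2 * (rr * (1 + kk)) = 2 * M1 ^ 2" by (simp only: parametrisation(1)[symmetric])
  then have "rr * (1 + kk) = 2 * M1 ^ 2 / (M0 * M2)" by (simp add: nonzero_eq_divide_eq mult_ac)
  then have "rr * (1 + kk) / M1 ^ 3 = 2 / (M0 * (M1 * M2))" by (simp add: power_numeral_reduce)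
  also have "\<dots> = Eu 1 * Eu 5 / (Eu 2 * Eu 10)"
    unfolding eta_products M0_Eu by (simp add: field_simps power_numeral_reduce)
  finally have u: "rr * (1 + kk) / M1 ^ 3 = Eu 1 * Eu 5 / (Eu 2 * Eu 10)" .
  have "2 * J5 * P1 * P2 / X5 * (rr ^ 6 / (2 * M1 ^ 3) * (w ^ 2 * (1 + kk ^ 2) / (1 + kk) ^ 3)) =
      J5 * (P1 * P2) * (rr * (1 + kk) / M1 ^ 3) * ((1 + kk ^ 2) / v)"
    unfolding X5 using wv by (simp add: divide_simps) (simp add: power_numeral_reduce)
  also have "\<dots> = Eu 5 * (Eu 1 / Eu 5) * (Eu 1 * Eu 5 / (Eu 2 * Eu 10)) * ((1 + kk ^ 2) / (Eu 2 ^ 3 * Eu 10 / (Eu 1 * Eu 5 ^ 3) * (1 - kk ^ 2)))"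
    unfolding u eta_products J5_Eu v ..
  also have "\<dots> = Eu 1 ^ 3 * Eu 5 ^ 4 / (Eu 2 ^ 4 * Eu 10 ^ 2) * ((1 + kk ^ 2) / (1 - kk ^ 2))"
    by (simp add: power_numeral_reduce mult_ac)
  finally show ?thesis unfolding ev .
qed

section \<open>The quadratic relation of level 20\<close>

definition gg :: "rat fls" where
  "gg = fls_X ^ 2 * Eu 2 * Eu 20 ^ 5 / (Eu 4 * Eu 10 ^ 5)"

lemma sub2_hh: "sub2 hh = gg"
proof -
  have "sub2 fls_X = fls_X ^ 2" using fls_compose_power_X_power[of 2 1] by simp
  then show ?thesis by (simp add: hh_def gg_def fls_compose_power_divide sub2_Eu)
qed

lemma hauptmodul_relations_sub2:
  "1 - 4 * gg = Eu 2 ^ 4 * Eu 20 ^ 2 / (Eu 4 ^ 2 * Eu 10 ^ 4)"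
  "1 + gg = Eu 4 ^ 3 * Eu 20 / (Eu 2 * Eu 10 ^ 3)"
proof -
  have "sub2 (1 - 4 * hh) = sub2 (Eu 1 ^ 4 * Eu 10 ^ 2 / (Eu 2 ^ 2 * Eu 5 ^ 4))"
    by (simp only: hauptmodul_relations)
  then show "1 - 4 * gg = Eu 2 ^ 4 * Eu 20 ^ 2 / (Eu 4 ^ 2 * Eu 10 ^ 4)"
    by (simp add: fls_compose_power_divide sub2_hh sub2_Eu)
  have "sub2 (1 + hh) = sub2 (Eu 2 ^ 3 * Eu 10 / (Eu 1 * Eu 5 ^ 3))"
    by (simp only: hauptmodul_relations)
  then show "1 + gg = Eu 4 ^ 3 * Eu 20 / (Eu 2 * Eu 10 ^ 3)"
    by (simp add: fls_compose_power_divide sub2_hh sub2_Eu)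
qed

lemma vanishes_below_hh_gg: "vanishes_below 0 hh" "vanishes_below 1 gg"
proof -
  have E: "vanishes_below 0 (Eu i * Eu j ^ 5 * inverse (Eu k * Eu l ^ 5))" for i j k l
    by (intro unipotent_imp_integral unipotent_mult unipotent_inverse unipotent_power Eu_unipotent)
  have "vanishes_below 0 (fls_X ^ 1 * (Eu 1 * Eu 10 ^ 5 * inverse (Eu 2 * Eu 5 ^ 5)))"
    by (intro vanishes_below_mult_int E) (simp only: vanishes_below_X_power)
  then show "vanishes_below 0 hh" by (simp add: hh_def divide_inverse mult_ac)
  have "vanishes_below 1 (fls_X ^ 2 * (Eu 2 * Eu 20 ^ 5 * inverse (Eu 4 * Eu 10 ^ 5)))"
    by (intro vanishes_below_mult_int E) simp
  then show "vanishes_below 1 gg" by (simp add: gg_def divide_inverse mult_ac)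
qed

text \<open>All factors of h^2 (1 - 4g)^2 (1 + g) = g (1 + h)^2 (1 - 4h) are eta quotients, so this
  equation is a comparison of exponents. The difference of its sides is the quadratic polynomial
  times 1 + 4hg, and the latter has constant term 1.\<close>

lemma hauptmodul_quadratic: "4 * hh * gg ^ 2 + 2 * hh * gg + hh ^ 2 - gg = 0"
proof -
  have "hh ^ 2 * ((1 - 4 * gg) ^ 2 * (1 + gg)) = gg * ((1 + hh) ^ 2 * (1 - 4 * hh))"
    unfolding hauptmodul_relations hauptmodul_relations_sub2 unfolding hh_def gg_def
    by (simp add: field_simps power_numeral_reduce)
  moreover have "hh ^ 2 * ((1 - 4 * gg) ^ 2 * (1 + gg)) - gg * ((1 + hh) ^ 2 * (1 - 4 * hh)) =
      (4 * hh * gg ^ 2 + 2 * hh * gg + hh ^ 2 - gg) * (1 + 4 * hh * gg)"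
    by algebra
  ultimately have "(4 * hh * gg ^ 2 + 2 * hh * gg + hh ^ 2 - gg) * (1 + 4 * hh * gg) = 0" by simp
  moreover have "vanishes_below 1 (2 * (2 * (hh * gg)) :: rat fls)"
    by (intro vanishes_below_int_mult vanishes_below_two vanishes_below_hh_gg)
  then have "unipotent (1 + 4 * hh * gg)" by (intro unipotent_one_plus) (simp add: mult.assoc)
  then have "1 + 4 * hh * gg \<noteq> 0" by (rule unipotent_nonzero)
  ultimately show ?thesis by simp
qed

definition rhs_first :: "rat fls" where
  "rhs_first = Eu 2 ^ 4 * Eu 10 ^ 2 / (Eu 1 * Eu 4 ^ 3 * Eu 20)"

definition rhs_second :: "rat fls" where
  "rhs_second = Eu 1 ^ 2 * Eu 4 ^ 3 * Eu 5 * Eu 20 / (Eu 2 ^ 5 * Eu 10)"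

text \<open>With G = 1 + g and H = (1 + h)^2 the relation says H + 4hG^2 = (6h + 1)G. Since (H -
  4hG^2)^2 = (H + 4hG^2)^2 - 16hG^2 H, the factor G^2 comes out, and the rest is the discriminant (1
  - 4h)(1 + 4h^2).\<close>

lemma quadratic_square:
  fixes h g a :: "'a :: field"
  assumes rel: "4 * h * g ^ 2 + 2 * h * g + h ^ 2 - g = 0" and nz: "1 + g \<noteq> 0" "1 + h \<noteq> 0"
  shows "(a / (1 + g) - a * (4 * h * (1 + g) / (1 + h) ^ 2)) ^ 2 = a ^ 2 * (1 - 4 * h) / (1 + h) ^ 4 * (1 + 4 * h ^ 2)"
proof -
  define G H where "G = 1 + g" and "H = (1 + h) ^ 2"
  have nz': "G \<noteq> 0" "H \<noteq> 0" using nz by (simp_all add: G_def H_def)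
  have "H + 4 * h * G ^ 2 = (6 * h + 1) * G" using rel unfolding G_def H_def by algebra
  then have "(H - 4 * h * G ^ 2) ^ 2 = G ^ 2 * ((6 * h + 1) ^ 2 - 16 * h * H)" by algebra
  also have "(6 * h + 1) ^ 2 - 16 * h * H = (1 - 4 * h) * (1 + 4 * h ^ 2)" unfolding H_def by algebra
  finally have sq: "(H - 4 * h * G ^ 2) ^ 2 = G ^ 2 * ((1 - 4 * h) * (1 + 4 * h ^ 2))" .
  have "a / G - a * (4 * h * G / H) = a * (H - 4 * h * G ^ 2) / (G * H)"
    using nz' by (simp add: field_simps power2_eq_square)
  then have "(a / G - a * (4 * h * G / H)) ^ 2 = a ^ 2 * (G ^ 2 * ((1 - 4 * h) * (1 + 4 * h ^ 2))) / (G ^ 2 * H ^ 2)"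
    by (simp add: power_divide power_mult_distrib sq)
  also have "\<dots> = a ^ 2 * (1 - 4 * h) / H ^ 2 * (1 + 4 * h ^ 2)" using nz' by simp
  also have "H ^ 2 = (1 + h) ^ 4" by (simp add: H_def power_mult[symmetric])
  finally show ?thesis by (simp add: G_def H_def)
qed

text \<open>Relative to the common factor \<open>a\<close>, both terms of the right-hand side are
  rational in g and h. On the other side (1 - k^2)^2 + 4k^2 = (1 + k^2)^2 makes 1 + 4h^2 a
  square.\<close>

lemma squares_agree:
  "(rhs_first - 4 * fls_X * rhs_second) ^ 2 =
    (Eu 1 ^ 3 * Eu 5 ^ 4 / (Eu 2 ^ 4 * Eu 10 ^ 2) * ((1 + kk ^ 2) / (1 - kk ^ 2))) ^ 2"
proof -
  define a where "a = Eu 2 ^ 3 / (Eu 1 * Eu 10)"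
  have nz: "1 + gg \<noteq> 0" "1 + hh \<noteq> 0" by (simp_all add: hauptmodul_relations hauptmodul_relations_sub2)
  have first: "rhs_first = a / (1 + gg)"
    unfolding hauptmodul_relations_sub2 a_def rhs_first_def by (simp add: power_numeral_reduce mult_ac)
  have second: "4 * fls_X * rhs_second = a * (4 * hh * (1 + gg) / (1 + hh) ^ 2)"
    unfolding hauptmodul_relations hauptmodul_relations_sub2 unfolding a_def hh_def rhs_second_def
    by (simp add: power_numeral_reduce mult_ac)
  have k2nz: "1 - kk ^ 2 \<noteq> 0"
  proof -
    have "1 - kk ^ 2 = (1 + kk) * (1 - kk)" by (simp add: algebra_simps power2_eq_square)
    then show ?thesis by simp
  qed
  have "(1 - kk ^ 2) ^ 2 + 4 * kk ^ 2 = (1 + kk ^ 2) ^ 2" by algebra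
  then have k: "1 + 4 * hh ^ 2 = ((1 + kk ^ 2) / (1 - kk ^ 2)) ^ 2"
    unfolding hh_kk power_divide using k2nz by (simp add: add_divide_eq_iff)
  have "(rhs_first - 4 * fls_X * rhs_second) ^ 2 = a ^ 2 * (1 - 4 * hh) / (1 + hh) ^ 4 * (1 + 4 * hh ^ 2)"
    unfolding first second by (rule quadratic_square[OF hauptmodul_quadratic nz])
  also have "a ^ 2 * (1 - 4 * hh) / (1 + hh) ^ 4 = (Eu 1 ^ 3 * Eu 5 ^ 4 / (Eu 2 ^ 4 * Eu 10 ^ 2)) ^ 2"
    unfolding hauptmodul_relations a_def by (simp add: power_numeral_reduce mult_ac)
  finally show ?thesis unfolding k by (simp only: power_mult_distrib)
qed

lemma rhs_unipotent: "unipotent (rhs_first - 4 * fls_X * rhs_second)"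
proof -
  have u: "unipotent rhs_first" "unipotent rhs_second"
    unfolding rhs_first_def rhs_second_def divide_inverse
    by (intro unipotent_mult unipotent_inverse unipotent_power Eu_unipotent)+
  have "vanishes_below 1 (2 * (2 * (fls_X ^ 1 * rhs_second)) :: rat fls)"
    by (rule vanishes_below_int_mult[OF vanishes_below_two], rule vanishes_below_int_mult[OF vanishes_below_two],
        rule vanishes_below_mult_int[OF _ unipotent_imp_integral[OF u(2)]]) (simp only: vanishes_below_X_power)
  then have "vanishes_below 1 (4 * fls_X * rhs_second)" by (simp add: mult.assoc)
  with u(1) have "vanishes_below 1 (rhs_first - 1 - 4 * fls_X * rhs_second)"
    unfolding unipotent_def by (rule vanishes_below_diff)
  then show ?thesis by (simp add: unipotent_def algebra_simps)
qed

lemma fls_identity: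
  "fls_X * part5 (fps_to_fls mock_f) + sub5 (fps_to_fls mock_f) = rhs_first - 4 * fls_X * rhs_second"
proof -
  let ?F = "Eu 1 ^ 3 * Eu 5 ^ 4 / (Eu 2 ^ 4 * Eu 10 ^ 2) * ((1 + kk ^ 2) / (1 - kk ^ 2))"
  define D where "D = rhs_first - 4 * fls_X * rhs_second"
  have "?F = D \<or> ?F = - D"
    using squares_agree[symmetric] unfolding power2_eq_iff D_def .
  moreover have "?F \<noteq> - D"
  proof
    assume F: "?F = - D"
    \<comment> \<open>In x and y, both with constant term 1, (1 + k^2)/(1 - k^2) = (x^2 +
      y^2)/(2xy). After clearing denominators, every summand is a product of series with constant
      term 1, up to sign.\<close>
    define x y where "x = P2 * M1" and "y = P1 * M2"
    have nz: "x \<noteq> 0" "y \<noteq> 0" "x + y \<noteq> 0" using kk_sum_nonzero by (simp_all add: x_def y_def)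
    have "kk ^ 2 = (x - y) ^ 2 / (x + y) ^ 2" by (simp only: kk_def x_def y_def power_divide)
    then have "1 + kk ^ 2 = ((x + y) ^ 2 + (x - y) ^ 2) / (x + y) ^ 2" "1 - kk ^ 2 = ((x + y) ^ 2 - (x - y) ^ 2) / (x + y) ^ 2"
      using nz by (simp_all add: add_divide_distrib diff_divide_distrib)
    then have "(1 + kk ^ 2) / (1 - kk ^ 2) = ((x + y) ^ 2 + (x - y) ^ 2) / ((x + y) ^ 2 - (x - y) ^ 2)"
      using nz by simp
    also have "\<dots> = (2 * (x ^ 2 + y ^ 2)) / (2 * (2 * x * y))"
      by (intro arg_cong2[where f = "(/)"]) algebra+
    finally have "(1 + kk ^ 2) / (1 - kk ^ 2) = (x ^ 2 + y ^ 2) / (2 * x * y)"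
      by (simp only: mult_divide_mult_cancel_left_if) simp
    then have "Eu 1 ^ 3 * Eu 5 ^ 4 / (Eu 2 ^ 4 * Eu 10 ^ 2) * ((x ^ 2 + y ^ 2) / (2 * x * y)) = - D"
      using F by simp
    then have eq: "Eu 1 ^ 3 * Eu 5 ^ 4 * x ^ 2 + Eu 1 ^ 3 * Eu 5 ^ 4 * y ^ 2 =
        - (D * x * y * Eu 2 ^ 4 * Eu 10 ^ 2) - D * x * y * Eu 2 ^ 4 * Eu 10 ^ 2"
      using nz by (simp add: field_simps)
    have "unipotent P1" "unipotent P2" "unipotent M1" "unipotent M2"
      unfolding P1_def P2_def M1_def M2_def by (intro qprod_unipotent; simp)+
    then have "unipotent x" "unipotent y" by (simp_all add: x_def y_def unipotent_mult)
    moreover have "unipotent D" unfolding D_def by (rule rhs_unipotent)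
    ultimately have "(Eu 1 ^ 3 * Eu 5 ^ 4 * x ^ 2) $$ 0 = 1" "(Eu 1 ^ 3 * Eu 5 ^ 4 * y ^ 2) $$ 0 = 1"
      "(D * x * y * Eu 2 ^ 4 * Eu 10 ^ 2) $$ 0 = 1"
      by (simp_all add: unipotent_nth_0 unipotent_mult unipotent_power Eu_unipotent)
    \<comment> \<open>The constant coefficients would give 1 + 1 = -1 - 1.\<close>
    with arg_cong[OF eq, of "\<lambda>f. f $$ 0"] show False
      by (simp only: fls_plus_nth fls_minus_nth fls_uminus_nth)
  qed
  ultimately show ?thesis unfolding hecke_sum_eta D_def by blast
qed

lemma fps_to_fls_divide:
  fixes f g :: "'a :: field fps"
  assumes "fps_nth g 0 \<noteq> 0"
  shows "fps_to_fls (f / g) = fps_to_fls f / fps_to_fls g"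
  using assms by (simp add: fps_divide_unit divide_inverse fls_times_fps_to_fls fls_inverse_fps_to_fls subdegree_eq_0)

lemma fps_nth_J_0: "k \<ge> 1 \<Longrightarrow> fps_nth (J k) 0 = 1"
  using unipotent_nth_0[OF Eu_unipotent, of k] by (simp flip: fps_to_fls_J_Eu)

theorem theorem3p1:
  shows "Abs_fps (\<lambda>n. a_f (5 * of_nat n - 1) + a_f (of_nat n / 5)) =
    (J 2 ^ 4 * J 10 ^ 2) / (J 1 * J 4 ^ 3 * J 20)
    - 4 * fps_X * ((J 1 ^ 2 * J 4 ^ 3 * J 5 * J 20) / (J 2 ^ 5 * J 10))"
proof -
  have nz: "fps_nth (J 1 * J 4 ^ 3 * J 20) 0 \<noteq> 0" "fps_nth (J 2 ^ 5 * J 10) 0 \<noteq> 0"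
    by (simp_all add: fps_nth_J_0 fps_power_zeroth)
  have "fps_to_fls (Abs_fps (\<lambda>n. a_f (5 * of_nat n - 1) + a_f (of_nat n / 5))) = rhs_first - 4 * fls_X * rhs_second"
    by (simp only: generating_function_eq fls_identity)
  also have "\<dots> = fps_to_fls ((J 2 ^ 4 * J 10 ^ 2) / (J 1 * J 4 ^ 3 * J 20)
      - 4 * fps_X * ((J 1 ^ 2 * J 4 ^ 3 * J 5 * J 20) / (J 2 ^ 5 * J 10)))"
    unfolding rhs_first_def rhs_second_def fps_to_fls_minus fls_times_fps_to_fls fps_to_fls_divide[OF nz(1)] fps_to_fls_divide[OF nz(2)]
    by (simp add: fls_times_fps_to_fls fps_to_fls_power fps_to_fls_J_Eu fps_X_to_fls)
  finally show ?thesis by (simp only: fps_to_fls_eq_iff)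
qed

end
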